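(* Let $(Q,\le)$ be a non-empty well-quasi-order. Then $o(i^F_{\omega^\omega}(Q)) = o(\mathsf{T_f}(Q)) = g(o(Q))$, where $g(1)=\omega$ and $g(\alpha)=\bar\varepsilon(-2+\alpha)$ for $\alpha\ge2$.
   Context: A quasi-order is a set with a reflexive, transitive relation. It is a well-quasi-order (wqo) if every infinite sequence $(x_i)_{i<\omega}$ has $i<j$ with $x_i\le x_j$. For a wqo $Q$, $o(Q)$ (the maximal order type) is the supremum of the order types of all linearizations of $Q$, i.e. linear quasi-orders on the same set extending $\le$. Sequences: a transfinite sequence over $Q$ of length $\alpha$ (with $\alpha$ a non-zero ordinal) is a function $\sigma:\alpha\to Q$, and $|\sigma|=\alpha$. Define $\sigma\preceq\tau$ if there is a strictly increasing $f:|\sigma|\to|\tau|$ with $\sigma(i)\le_Q\tau(f(i))$ for all $i$. The sequence $\sigma$ has finite range if it takes finitely many values. A proper tail of $\sigma$ is a sequence $i\mapsto\sigma(\delta+i)$ for $0\le i<-\delta+|\sigma|$, where $0<\delta<|\sigma|$ and $-\delta+|\sigma|$ is the unique $\beta$ with $\delta+\beta=|\sigma|$. The sequence $\sigma$ is indecomposable if $\sigma\preceq\tau$ for every proper tail $\tau$ of $\sigma$. $i^F_\alpha(Q)$ is the set of indecomposable sequences over $Q$ with finite range and length $<\alpha$, ordered by $\preceq$. Trees: $\mathsf{T_f}(Q)$ is the smallest class containing the leaf $\cdot q$ for each $q\in Q$, and containing $\cdot(\tau_0,\dots,\tau_{k-1})$ (an unlabelled root with children $\tau_i$) for every finite set $\{\tau_0,\dots,\tau_{k-1}\}\subseteq\mathsf{T_f}(Q)$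 with $k\ge1$. It is ordered by $\le_T$, defined recursively: - $\cdot x\le_T\cdot y$ iff $x\le_Q y$; - $\cdot x\le_T\cdot(\tau_j)_{j<l}$ iff $\cdot x\le_T\tau_j$ for some $j$; - $\cdot(\sigma_i)_{i<k}\le_T\cdot(\tau_j)_{j<l}$ iff every $\sigma_i$ is $\le_T$ some $\tau_j$; - a non-leaf tree is never $\le_T$ a leaf. Epsilon numbers: $(\varepsilon_\alpha)$ enumerates the fixed points of $\beta\mapsto\omega^\beta$ increasingly. Define $\bar\varepsilon(\alpha)=\varepsilon_{\alpha+1}$ if $\alpha=\gamma+n$ with $n<\omega$ and $\varepsilon_\gamma=\gamma$; otherwise $\bar\varepsilon(\alpha)=\varepsilon_\alpha$. Here $-2+\alpha$ is the unique $\beta$ with $2+\beta=\alpha$. *)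

theory Defs
  imports Main "HOL-Library.FSet"
begin

definition wqo_on :: "'a set \<Rightarrow> ('a \<Rightarrow> 'a \<Rightarrow> bool) \<Rightarrow> bool" where
  "wqo_on Q le \<longleftrightarrow>
     (\<forall>x\<in>Q. le x x) \<and>
     (\<forall>x\<in>Q. \<forall>y\<in>Q. \<forall>z\<in>Q. le x y \<longrightarrow> le y z \<longrightarrow> le x z) \<and>
     (\<forall>f::nat \<Rightarrow> 'a. (\<forall>i. f i \<in> Q) \<longrightarrow> (\<exists>i j. i < j \<and> le (f i) (f j)))"

definition linearization :: "'a set \<Rightarrow> ('a \<Rightarrow> 'a \<Rightarrow> bool) \<Rightarrow> ('a \<Rightarrow> 'a \<Rightarrow> bool) \<Rightarrow> bool" where
  "linearization A le L \<longleftrightarrow>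
     (\<forall>x\<in>A. L x x) \<and>
     (\<forall>x\<in>A. \<forall>y\<in>A. \<forall>z\<in>A. L x y \<longrightarrow> L y z \<longrightarrow> L x z) \<and>
     (\<forall>x\<in>A. \<forall>y\<in>A. L x y \<or> L y x) \<and>
     (\<forall>x\<in>A. \<forall>y\<in>A. le x y \<longrightarrow> L x y)"

definition lin_cls :: "'a set \<Rightarrow> ('a \<Rightarrow> 'a \<Rightarrow> bool) \<Rightarrow> 'a \<Rightarrow> 'a set" where
  "lin_cls A L x = {y \<in> A. L x y \<and> L y x}"

definition lin_type :: "'a set \<Rightarrow> ('a \<Rightarrow> 'a \<Rightarrow> bool) \<Rightarrow> 'a set rel" where
  "lin_type A L = {(lin_cls A L x, lin_cls A L y) | x y. x \<in> A \<and> y \<in> A \<and> L x y}"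

text \<open>is_max_order_type A le alpha: the well-order \<alpha> represents o(A), i.e. the
  supremum of the order types of all linearizations (all linearizations are well-orders
  of type \<le> \<alpha>, and every ordinal below \<alpha> is exceeded by some linearization).\<close>
definition is_max_order_type :: "'a set \<Rightarrow> ('a \<Rightarrow> 'a \<Rightarrow> bool) \<Rightarrow> 'b rel \<Rightarrow> bool" where
  "is_max_order_type A le \<alpha> \<longleftrightarrow>
     Well_order \<alpha> \<and>
     (\<forall>L. linearization A le L \<longrightarrow> (lin_type A L, \<alpha>) \<in> ordLeq) \<and>
     (\<forall>x\<in>Field \<alpha>. \<exists>L. linearization A le L \<and> (Restr \<alpha> (underS \<alpha> x), lin_type A L) \<in> ordLess)"

definition fsupp :: "'b rel \<Rightarrow> ('b \<Rightarrow> nat) set" where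
  "fsupp \<beta> = {f. (\<forall>x. x \<notin> Field \<beta> \<longrightarrow> f x = 0) \<and> finite {x. f x \<noteq> 0}}"

definition rel_max :: "'b rel \<Rightarrow> 'b set \<Rightarrow> 'b" where
  "rel_max \<beta> D = (THE m. m \<in> D \<and> (\<forall>y\<in>D. (y, m) \<in> \<beta>))"

text \<open>\<omega>^\<beta> as finitely supported functions \<beta> \<rightarrow> \<omega> (Cantor normal form),
  compared at the largest exponent where they differ.\<close>
definition omega_pow :: "'b rel \<Rightarrow> ('b \<Rightarrow> nat) rel" where
  "omega_pow \<beta> = {(f, g). f \<in> fsupp \<beta> \<and> g \<in> fsupp \<beta> \<and>
      (f = g \<or> f (rel_max \<beta> {x. f x \<noteq> g x}) < g (rel_max \<beta> {x. f x \<noteq> g x}))}"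

definition is_eps_point :: "'b rel \<Rightarrow> bool" where
  "is_eps_point \<beta> \<longleftrightarrow> Well_order \<beta> \<and> (omega_pow \<beta>, \<beta>) \<in> ordIso"

definition eps_below :: "'b rel \<Rightarrow> 'b set" where
  "eps_below \<beta> = {x \<in> Field \<beta>. is_eps_point (Restr \<beta> (underS \<beta> x))}"

definition is_eps :: "'c rel \<Rightarrow> 'b rel \<Rightarrow> bool" where
  "is_eps \<gamma> \<beta> \<longleftrightarrow> is_eps_point \<beta> \<and> (Restr \<beta> (eps_below \<beta>), \<gamma>) \<in> ordIso"

definition is_eps_succ :: "'c rel \<Rightarrow> 'b rel \<Rightarrow> bool" where
  "is_eps_succ \<gamma> \<beta> \<longleftrightarrow> is_eps_point \<beta> \<and>
     (\<exists>m\<in>eps_below \<beta>. (\<forall>y\<in>eps_below \<beta>. (y, m) \<in> \<beta>) \<and>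
        (Restr \<beta> (eps_below \<beta> - {m}), \<gamma>) \<in> ordIso)"

text \<open>\<alpha> = \<gamma> + n with n < \<omega> and \<epsilon>_\<gamma> = \<gamma>: \<gamma> is an initial segment of \<alpha> with finite
  complement.\<close>
definition ebar_case :: "'c rel \<Rightarrow> bool" where
  "ebar_case \<alpha> \<longleftrightarrow> (\<exists>C. (C = Field \<alpha> \<or> (\<exists>x\<in>Field \<alpha>. C = underS \<alpha> x)) \<and>
      finite (Field \<alpha> - C) \<and> is_eps (Restr \<alpha> C) (Restr \<alpha> C))"

definition is_ebar :: "'c rel \<Rightarrow> 'b rel \<Rightarrow> bool" where
  "is_ebar \<alpha> \<beta> \<longleftrightarrow> (if ebar_case \<alpha> then is_eps_succ \<alpha> \<beta> else is_eps \<alpha> \<beta>)"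

text \<open>\<beta> = g(\<alpha>): g(1) = \<omega>, g(\<alpha>) = \<epsilon>-bar(-2+\<alpha>) for \<alpha> \<ge> 2, where -2+\<alpha> is the
  order type of \<alpha> with its two least elements removed.\<close>
definition is_g :: "'c rel \<Rightarrow> 'b rel \<Rightarrow> bool" where
  "is_g \<alpha> \<beta> \<longleftrightarrow> Well_order \<alpha> \<and>
     ((card (Field \<alpha>) = 1 \<and> (\<beta>, natLeq) \<in> ordIso) \<or>
      (\<exists>a b. a \<in> Field \<alpha> \<and> b \<in> Field \<alpha> \<and> a \<noteq> b \<and>
         (\<forall>x\<in>Field \<alpha>. (a, x) \<in> \<alpha>) \<and> (\<forall>x\<in>Field \<alpha> - {a}. (b, x) \<in> \<alpha>) \<and>
         is_ebar (Restr \<alpha> (Field \<alpha> - {a, b})) \<beta>))"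

text \<open>A sequence is a well-order r on a (nonempty) subset of nat (its length is the
  order type of r) together with a labelling; every sequence of countable length,
  in particular of length < \<omega>^\<omega>, is represented.\<close>
type_synonym 'a tseq = "nat rel \<times> (nat \<Rightarrow> 'a)"

definition seq_emb :: "('a \<Rightarrow> 'a \<Rightarrow> bool) \<Rightarrow> 'a tseq \<Rightarrow> 'a tseq \<Rightarrow> bool" where
  "seq_emb le s t \<longleftrightarrow> (\<exists>f. (\<forall>i\<in>Field (fst s). f i \<in> Field (fst t) \<and> le (snd s i) (snd t (f i))) \<and>
     (\<forall>i\<in>Field (fst s). \<forall>j\<in>Field (fst s). (i, j) \<in> fst s \<and> i \<noteq> j \<longrightarrow>
        (f i, f j) \<in> fst t \<and> f i \<noteq> f j))"

definition proper_tails :: "'a tseq \<Rightarrow> 'a tseq set" where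
  "proper_tails s = {(Restr (fst s) (above (fst s) x), snd s) | x.
      x \<in> Field (fst s) \<and> (\<exists>y\<in>Field (fst s). (y, x) \<in> fst s \<and> y \<noteq> x)}"

definition indecomposable :: "('a \<Rightarrow> 'a \<Rightarrow> bool) \<Rightarrow> 'a tseq \<Rightarrow> bool" where
  "indecomposable le s \<longleftrightarrow> (\<forall>t\<in>proper_tails s. seq_emb le s t)"

definition iF_omega_omega :: "'a set \<Rightarrow> ('a \<Rightarrow> 'a \<Rightarrow> bool) \<Rightarrow> 'a tseq set" where
  "iF_omega_omega Q le = {s. Well_order (fst s) \<and> Field (fst s) \<noteq> {} \<and>
      (fst s, omega_pow natLeq) \<in> ordLess \<and> snd s ` Field (fst s) \<subseteq> Q \<and>
      finite (snd s ` Field (fst s)) \<and> indecomposable le s}"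

datatype 'a ftree = Leaf 'a | Node "'a ftree fset"

inductive_set ftrees :: "'a set \<Rightarrow> 'a ftree set" for Q :: "'a set" where
  leaf: "x \<in> Q \<Longrightarrow> Leaf x \<in> ftrees Q"
| node: "ts \<noteq> {||} \<Longrightarrow> (\<And>t. t |\<in>| ts \<Longrightarrow> t \<in> ftrees Q) \<Longrightarrow> Node ts \<in> ftrees Q"

inductive tree_le :: "('a \<Rightarrow> 'a \<Rightarrow> bool) \<Rightarrow> 'a ftree \<Rightarrow> 'a ftree \<Rightarrow> bool" for le where
  leaf_leaf: "le x y \<Longrightarrow> tree_le le (Leaf x) (Leaf y)"
| leaf_node: "t |\<in>| ts \<Longrightarrow> tree_le le (Leaf x) t \<Longrightarrow> tree_le le (Leaf x) (Node ts)"
| node_node: "(\<And>s. s |\<in>| ss \<Longrightarrow> \<exists>t. t |\<in>| ts \<and> tree_le le s t) \<Longrightarrow>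
              tree_le le (Node ss) (Node ts)"

end

theory Submission
  imports Defs "HOL-Library.Multiset_Order"
begin

text \<open>
  The maximal order type of a well-quasi-order \<open>A\<close> equals its rank: the least ordinal exceeding
  the ranks of all sets \<open>{y \<in> A. \<not> x \<le> y}\<close> with \<open>x \<in> A\<close> (de Jongh and Parikh). Ranks are
  subadditive for the natural sum, so upper bounds follow by recursion: a tree not above
  \<open>Node ts\<close> is a leaf, or all its children lie in \<open>{s. \<not> u \<le> s}\<close> for one \<open>u \<in> ts\<close>, and finite
  subsets of a set of rank \<open>c\<close> under domination have rank at most \<open>\<omega>\<^sup>c\<close>. Hence the rank of the
  trees over \<open>Q\<close> is at most the least epsilon number above \<open>o(Q)\<close> and above the ranks of the trees
  over all \<open>{y \<in> Q. \<not> q \<le> y}\<close>; this recursion is solved by the function \<open>g\<close>.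

  For the lower bound, epsilon numbers are sent to leaves, and an ordinal with Cantor normal form
  \<open>M\<close> to a node with one child for each exponent of \<open>M\<close>, made of the tree of that exponent and a
  linear stem whose height grows along the normal form. This map reflects the order.

  Finally, sending \<open>Node ts\<close> to the \<open>\<omega>\<close>-fold repetition of the concatenated sequences of its
  children embeds the trees into the indecomposable sequences, and every indecomposable sequence
  of finite range and length below \<open>\<omega>\<^sup>\<omega>\<close> is equivalent to one of this form.
\<close>

text \<open>Two demands shape the bounds. Nodes whose children range over a set of rank c have rank
  up to \<open>\<omega>\<^sup>c\<close>, so a bound has to be an epsilon number; and the leaves are
  a copy of Q, so it has to exceed o(Q) as well. The second demand is the origin of the bar: at a
  point \<gamma> with \<epsilon>_\<gamma> = \<gamma> the epsilon number in line is not above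
  \<gamma>, and the whole finite run after \<gamma> moves on by one. The subtraction of two comes
  from the lower bound: the least label is spent on the stems and the next one on the ordinal zero,
  so labels are free for epsilon numbers from index two on. With a single class of labels only the
  height separates trees, hence the value \<omega>. Rank bounds are multisets because the natural
  sum then is multiset addition, strictly monotone in both arguments, and sums of multisets below
  \<open>{#b#}\<close> stay below it. The given well-orders live on arbitrary types and are moved
  into one type of ordinals by isomorphisms; there, epsilon numbers are indexed from two on, which
  avoids ordinal subtraction.\<close>

unbundle cardinal_syntax

subsection \<open>Ordinals\<close>

text \<open>\<open>'x ordinal\<close> consists of the ordinals of cardinality at most that of \<open>'x + nat\<close>. HOL has no
  type of all ordinals, so \<open>'x\<close> has to be chosen large enough for the well-orders at hand.\<close>
abbreviation (input) ocard :: "'x itself \<Rightarrow> ('x + nat) set rel" where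
  "ocard _ \<equiv> cardSuc (card_of (UNIV :: ('x + nat) set))"

typedef 'x ordinal = "Field (ocard TYPE('x))"
  using Field_cardSuc_not_empty card_of_Card_order by blast

instantiation ordinal :: (type) wellorder
begin

definition less_eq_ordinal :: "'a ordinal \<Rightarrow> 'a ordinal \<Rightarrow> bool" where
  "a \<le> b \<longleftrightarrow> (Rep_ordinal a, Rep_ordinal b) \<in> ocard TYPE('a)"

definition less_ordinal :: "'a ordinal \<Rightarrow> 'a ordinal \<Rightarrow> bool" where
  "(a :: 'a ordinal) < b \<longleftrightarrow> a \<le> b \<and> a \<noteq> b"

instance
proof -
  let ?r = "ocard TYPE('a)"
  have wo: "Well_order ?r"
    using cardSuc_Well_order card_of_Card_order by blast
  have lo: "Linear_order ?r" and wf: "wf (?r - Id)"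
    using wo unfolding well_order_on_def by auto
  have refl: "Refl ?r" and tr: "trans ?r" and anti: "antisym ?r" and tot: "Total ?r"
    using lo unfolding linear_order_on_def partial_order_on_def preorder_on_def by auto
  have rep: "Rep_ordinal a \<in> Field ?r" for a :: "'a ordinal"
    using Rep_ordinal by blast
  have less: "a < b \<longleftrightarrow> (Rep_ordinal a, Rep_ordinal b) \<in> ?r - Id" for a b :: "'a ordinal"
    by (auto simp: less_ordinal_def less_eq_ordinal_def Rep_ordinal_inject)
  have le_refl: "a \<le> a" for a :: "'a ordinal"
    using refl rep unfolding less_eq_ordinal_def refl_on_def by auto
  have le_trans: "a \<le> b \<Longrightarrow> b \<le> c \<Longrightarrow> a \<le> c" for a b c :: "'a ordinal"
    unfolding less_eq_ordinal_def using tr by (meson transD)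
  have le_anti: "a \<le> b \<Longrightarrow> b \<le> a \<Longrightarrow> a = b" for a b :: "'a ordinal"
    unfolding less_eq_ordinal_def using anti by (metis Rep_ordinal_inject antisymD)
  have le_tot: "a \<le> b \<or> b \<le> a" for a b :: "'a ordinal"
    using tot rep[of a] rep[of b] le_refl unfolding less_eq_ordinal_def total_on_def
    by (metis Rep_ordinal_inject)
  have wfl: "wf {(a :: 'a ordinal, b). a < b}"
    using wf_inv_image[OF wf, of Rep_ordinal] by (simp add: inv_image_def less)
  show "OFCLASS('a ordinal, wellorder_class)"
  proof
    fix x y z :: "'a ordinal" and P
    show "x < y \<longleftrightarrow> x \<le> y \<and> \<not> y \<le> x"
      using le_anti le_refl by (auto simp: less_ordinal_def)
    show "x \<le> x" by (rule le_refl)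
    show "x \<le> y \<Longrightarrow> y \<le> z \<Longrightarrow> x \<le> z" by (rule le_trans)
    show "x \<le> y \<Longrightarrow> y \<le> x \<Longrightarrow> x = y" by (rule le_anti)
    show "x \<le> y \<or> y \<le> x" by (rule le_tot)
    show "(\<And>x. (\<And>y. y < x \<Longrightarrow> P y) \<Longrightarrow> P x) \<Longrightarrow> P x"
      using wf_induct_rule[OF wfl, of P x] by blast
  qed
qed

end

text \<open>The size condition under which families of ordinals have strict upper bounds in
  \<open>'x ordinal\<close>.\<close>

definition small :: "'x itself \<Rightarrow> 's set \<Rightarrow> bool" where
  "small _ S \<longleftrightarrow> (\<exists>f :: 's \<Rightarrow> 'x + nat. inj_on f S)"

lemma small_subset: "small TYPE('x) S \<Longrightarrow> T \<subseteq> S \<Longrightarrow> small TYPE('x) T"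
  unfolding small_def using inj_on_subset by blast

text \<open>Infinite successor cardinals are regular, so so few ordinals are not cofinal; the
  summand \<open>nat\<close> in \<open>ocard\<close> provides infinity.\<close>

lemma ocard_bounded:
  fixes K :: "('x + nat) set set"
  assumes K: "K \<subseteq> Field (ocard TYPE('x))" and card: "|K| \<le>o |UNIV :: ('x + nat) set|"
  shows "\<exists>b \<in> Field (ocard TYPE('x)). \<forall>k\<in>K. (k, b) \<in> ocard TYPE('x) \<and> k \<noteq> b"
proof -
  let ?r = "ocard TYPE('x)"
  have co: "Card_order ?r" using cardSuc_Card_order card_of_Card_order by blast
  then have wo: "Well_order ?r" unfolding card_order_on_def by blast
  have inf: "\<not> finite (Field ?r)"
    by (simp add: card_of_cardSuc_finite)
  have reg: "regularCard ?r"
    by (rule infinite_cardSuc_regularCard) (simp_all add: Field_card_of card_of_card_order_on)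
  have "|K| <o ?r"
    using card cardSuc_ordLeq_ordLess[OF card_of_Card_order card_of_Card_order] by blast
  then have "\<not> cofinal K ?r"
    using reg K unfolding regularCard_def by (meson not_ordLess_ordIso)
  then obtain a where a: "a \<in> Field ?r" "\<And>b. b \<in> K \<Longrightarrow> a = b \<or> (a, b) \<notin> ?r"
    unfolding cofinal_def by blast
  \<comment> \<open>The failure of cofinality gives a weak bound \<open>a\<close> only; an infinite
    cardinal is a limit, so there is a \<open>c\<close> strictly above.\<close>
  obtain c where c: "c \<in> Field ?r" "a \<noteq> c" "(a, c) \<in> ?r"
    using infinite_Card_order_limit[OF co inf a(1)] by blast
  have lin: "refl_on (Field ?r) ?r" "trans ?r" "antisym ?r" "total_on (Field ?r) ?r"
    using wo unfolding well_order_on_def linear_order_on_def partial_order_on_def preorder_on_def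
    by blast+
  have "(k, c) \<in> ?r \<and> k \<noteq> c" if "k \<in> K" for k
  proof -
    have k: "k \<in> Field ?r" using that K by blast
    have ka: "(k, a) \<in> ?r"
    proof (cases "a = k")
      case True
      then show ?thesis using refl_onD[OF lin(1) k] by (simp only:)
    next
      case False
      then show ?thesis using a(2)[OF that] lin(4) k a(1) unfolding total_on_def by metis
    qed
    have "k \<noteq> c" using antisymD[OF lin(3) ka] c(2,3) by metis
    with transD[OF lin(2) ka c(3)] show ?thesis by (rule conjI)
  qed
  then show ?thesis using c(1) by blast
qed

lemma small_bounded:
  assumes "small TYPE('x) S"
  shows "\<exists>b :: 'x ordinal. \<forall>s\<in>S. g s < b"
proof -
  let ?K = "(\<lambda>s. Rep_ordinal (g s)) ` S"
  obtain f :: "_ \<Rightarrow> 'x + nat" where f: "inj_on f S" using assms small_def by blast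
  have "|?K| \<le>o |S|" by (rule card_of_image)
  also have "|S| \<le>o |UNIV :: ('x + nat) set|" using f card_of_ordLeq by blast
  finally have "|?K| \<le>o |UNIV :: ('x + nat) set|" .
  moreover have "?K \<subseteq> Field (ocard TYPE('x))" using Rep_ordinal by blast
  ultimately obtain b where b: "b \<in> Field (ocard TYPE('x))"
    "\<forall>k\<in>?K. (k, b) \<in> ocard TYPE('x) \<and> k \<noteq> b"
    using ocard_bounded[of ?K] by blast
  then have "g s < Abs_ordinal b" if "s \<in> S" for s
    using that unfolding less_ordinal_def less_eq_ordinal_def
    by (metis Abs_ordinal_inverse image_eqI)
  then show ?thesis by blast
qed

lemma small_lessThan: "small TYPE('x) {..<(a :: 'x ordinal)}"
proof -
  let ?r = "ocard TYPE('x)"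
  have co: "Card_order ?r" using cardSuc_Card_order card_of_Card_order by blast
  have "|underS ?r (Rep_ordinal a)| <o ?r"
    by (rule card_of_underS[OF co]) (rule Rep_ordinal)
  then have "|underS ?r (Rep_ordinal a)| \<le>o |UNIV :: ('x + nat) set|"
    using cardSuc_ordLeq_ordLess[OF card_of_Card_order card_of_Card_order] by blast
  then obtain f :: "_ \<Rightarrow> 'x + nat" where f: "inj_on f (underS ?r (Rep_ordinal a))"
    unfolding card_of_ordLeq[symmetric] by (elim exE conjE)
  have "inj_on (f \<circ> Rep_ordinal) {..<a}"
  proof (rule comp_inj_on)
    show "inj_on Rep_ordinal {..<a}" by (meson Rep_ordinal_inject inj_onI)
    show "inj_on f (Rep_ordinal ` {..<a})"
      by (rule inj_on_subset[OF f]) (auto simp: underS_def less_ordinal_def less_eq_ordinal_def Rep_ordinal_inject)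
  qed
  then show ?thesis unfolding small_def by blast
qed

text \<open>A multiset over the ordinals stands for the ordinal with that Cantor normal form: the
  multiset order compares normal forms, \<open>+\<close> is the natural sum and \<open>{#a#}\<close> is \<open>\<omega>\<^sup>a\<close>.\<close>


lemma small_bounded_mset:
  assumes "small TYPE('x) S"
  shows "\<exists>b :: 'x ordinal. \<forall>s\<in>S. g s < {#b#}"
proof -
  \<comment> \<open>If \<open>g s\<close> is empty, its maximum is an unspecified ordinal. This is
    harmless, since only members of \<open>g s\<close> have to lie below \<open>b\<close>.\<close>
  obtain b :: "'x ordinal" where "\<forall>s\<in>S. Max_mset (g s) < b"
    using small_bounded[OF assms, of "\<lambda>s. Max_mset (g s)"] by blast
  then have "\<forall>s\<in>S. g s < {#b#}"
    unfolding mset_lt_single_right_iff by (meson Max_ge finite_set_mset le_less_trans)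
  then show ?thesis by blast
qed

text \<open>Enumerates the multisets in increasing order, so \<open>cnf a\<close> is the Cantor
  normal form of \<open>a\<close>. The \<open>LEAST\<close> is meaningful because
  \<open>small_bounded_mset\<close> bounds the earlier values.\<close>

function cnf :: "'x ordinal \<Rightarrow> 'x ordinal multiset" where
  "cnf a = (LEAST M. \<forall>b. b < a \<longrightarrow> cnf b < M)"
  by auto
termination by (relation "{(b, a). b < a}") (auto simp: wf)

declare cnf.simps [simp del]

lemma cnf_strict: "b < a \<Longrightarrow> cnf b < cnf (a :: 'x ordinal)"
proof -
  assume "b < a"
  obtain c :: "'x ordinal" where "\<forall>b\<in>{..<a}. cnf b < {#c#}"
    using small_bounded_mset[OF small_lessThan] by blast
  then have "\<exists>M. \<forall>b. b < a \<longrightarrow> cnf b < M" by (metis lessThan_iff)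
  from LeastI_ex[OF this] \<open>b < a\<close> show ?thesis
    by (simp add: cnf.simps[of a])
qed

lemma cnf_least: "(\<And>b. b < a \<Longrightarrow> cnf b < M) \<Longrightarrow> cnf a \<le> M"
  by (subst cnf.simps) (rule Least_le, blast)

lemma cnf_less_iff [simp]: "cnf a < cnf b \<longleftrightarrow> a < b"
  by (metis cnf_strict less_asym linorder_neqE)

lemma cnf_le_iff [simp]: "cnf a \<le> cnf b \<longleftrightarrow> a \<le> b"
  by (metis cnf_less_iff not_le)

lemma cnf_eq_iff [simp]: "cnf a = cnf b \<longleftrightarrow> a = b"
  by (metis cnf_le_iff order_antisym order_refl)

text \<open>A skipped multiset would have been a smaller candidate for the least one, so the values
  of \<open>cnf\<close> are downward closed.\<close>

lemma cnf_onto: "M < cnf a \<Longrightarrow> \<exists>b<a. M = cnf b"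
proof (induction a rule: less_induct)
  case (less a)
  then obtain b where "b < a" "M \<le> cnf b"
    using cnf_least[of a M] by (meson not_le)
  then show ?case using less.IH[of b] by (metis less_trans order_le_less)
qed

lemma cnf_le_single: "cnf a \<le> {#a#}"
proof (induction a rule: less_induct)
  case (less a)
  show ?case by (rule cnf_least) (metis less mset_lt_single_iff le_less_trans)
qed

definition eps :: "'x ordinal \<Rightarrow> bool" where
  "eps a \<longleftrightarrow> cnf a = {#a#}"

text \<open>Makes recursion along exponents well founded away from the epsilon numbers.\<close>

lemma not_eps_cnf: "\<not> eps a \<Longrightarrow> x \<in># cnf a \<Longrightarrow> x < a"
  using cnf_le_single[of a] unfolding eps_def by (metis mset_lt_single_right_iff order_le_less)

lemma eps_onto: "eps b \<Longrightarrow> M < {#b#} \<Longrightarrow> \<exists>c<b. M = cnf c"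
  unfolding eps_def using cnf_onto by metis

section \<open>Order types as ordinals\<close>

lemma strict_mono_ge:
  fixes f :: "'o::wellorder \<Rightarrow> 'o"
  assumes "\<And>x y. x < y \<Longrightarrow> y < a \<Longrightarrow> f x < f y" and "x < a"
  shows "x \<le> f x"
  using assms(2)
proof (induction x rule: less_induct)
  case (less x)
  show ?case
  proof (rule ccontr)
    assume "\<not> x \<le> f x"
    then have lt: "f x < x" by simp
    then have "f x \<le> f (f x)" using less by (meson less_trans)
    then show False using assms(1)[OF lt less.prems] by simp
  qed
qed

lemma strict_mono_le:
  fixes f :: "'o::wellorder \<Rightarrow> 'o"
  assumes "\<And>x y. x < y \<Longrightarrow> y < a \<Longrightarrow> f x < f y" and "\<And>x. x < a \<Longrightarrow> f x < b"
  shows "a \<le> b"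
proof (rule ccontr)
  assume "\<not> a \<le> b"
  then have "b < a" by simp
  then show False using strict_mono_ge[of a f b] assms by (meson leD)
qed

text \<open>The rank function of the well-founded strict part. Totality makes it recover
  \<open>L\<close>, with equivalent elements sharing a value, and its range has no gaps.\<close>

lemma collapse:
  fixes A :: "'a set" and L :: "'a \<Rightarrow> 'a \<Rightarrow> bool"
  assumes small: "small TYPE('x) A"
    and tot: "\<And>x y. x \<in> A \<Longrightarrow> y \<in> A \<Longrightarrow> L x y \<or> L y x"
    and tr: "\<And>x y z. x \<in> A \<Longrightarrow> y \<in> A \<Longrightarrow> z \<in> A \<Longrightarrow> L x y \<Longrightarrow> L y z \<Longrightarrow> L x z"
    and wf: "wf {(y, x). y \<in> A \<and> x \<in> A \<and> \<not> L x y}"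
  obtains F :: "'a \<Rightarrow> 'x ordinal" and a where
    "\<And>x y. x \<in> A \<Longrightarrow> y \<in> A \<Longrightarrow> L x y \<longleftrightarrow> F x \<le> F y" and "F ` A = {..<a}"
proof -
  define R where "R = {(y, x). y \<in> A \<and> x \<in> A \<and> \<not> L x y}"
  define F :: "'a \<Rightarrow> 'x ordinal" where
    "F = wfrec R (\<lambda>f x. LEAST c. \<forall>y. (y, x) \<in> R \<longrightarrow> f y < c)"
  have wfR: "wf R" using wf R_def by simp
  have F: "F x = (LEAST c. \<forall>y. (y, x) \<in> R \<longrightarrow> F y < c)" for x
    by (subst F_def, subst wfrec[OF wfR]) (simp add: F_def [symmetric] cut_def cong: imp_cong)
  obtain bd where bd: "\<forall>y\<in>A. F y < bd" using small_bounded[OF small] by blast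
  have lt: "F y < F x" if "(y, x) \<in> R" for x y
  proof -
    have "\<exists>c. \<forall>y. (y, x) \<in> R \<longrightarrow> F y < c" using bd unfolding R_def by blast
    from LeastI_ex[OF this] show ?thesis using that by (simp add: F[of x, symmetric])
  qed
  have ex: "\<exists>y. (y, x) \<in> R \<and> c \<le> F y" if "c < F x" for c x
    using not_less_Least[of c "\<lambda>c. \<forall>y. (y, x) \<in> R \<longrightarrow> F y < c"] that F[of x] not_le by metis
  have iff: "L x y \<longleftrightarrow> F x \<le> F y" if "x \<in> A" "y \<in> A" for x y
  proof
    assume "L x y"
    have "\<forall>z. (z, x) \<in> R \<longrightarrow> F z < F y"
      using that \<open>L x y\<close> tr lt unfolding R_def by blast
    then show "F x \<le> F y" by (subst F[of x]) (rule Least_le)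
  next
    assume "F x \<le> F y"
    then show "L x y" using that lt[of y x] unfolding R_def by fastforce
  qed
  have down: "c \<in> F ` A" if "x \<in> A" "c < F x" for c x
    using wfR that
  proof (induction x rule: wf_induct_rule)
    case (less x)
    obtain y where y: "(y, x) \<in> R" "c \<le> F y" using ex[OF less.prems(2)] by blast
    then have "y \<in> A" unfolding R_def by blast
    then show ?case using less.IH[OF y(1)] y(2) by (cases "c = F y") auto
  qed
  \<comment> \<open>By \<open>down\<close> the range is downward closed, so it consists of the
    ordinals below the first one that it omits.\<close>
  define a where "a = (LEAST c. c \<notin> F ` A)"
  have "a \<notin> F ` A" unfolding a_def by (rule LeastI_ex) (use bd in \<open>metis imageE less_irrefl\<close>)
  then have "F ` A = {..<a}"
    using down not_less_Least[of _ "\<lambda>c. c \<notin> F ` A"] a_def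
    by (auto, metis image_eqI not_less_iff_gr_or_eq)
  with iff show ?thesis using that by blast
qed

text \<open>The standard well-order of type \<open>a\<close>, by which relations on other types are
  compared with ordinals.\<close>

definition oseg :: "'x ordinal \<Rightarrow> 'x ordinal rel" where
  "oseg a = {(x, y). x \<le> y \<and> y < a}"

lemma Field_oseg [simp]: "Field (oseg a) = {..<a}"
  by (auto simp: oseg_def Field_def)

lemma Well_order_oseg: "Well_order (oseg a)"
proof -
  have "wf (oseg a - Id)"
    by (rule wf_subset[OF wf]) (auto simp: oseg_def)
  then show ?thesis
    unfolding well_order_on_def linear_order_on_def partial_order_on_def preorder_on_def
    by (auto simp: refl_on_def trans_def antisym_def total_on_def oseg_def Field_def)
qed

lemma oseg_less: "a < b \<Longrightarrow> oseg a <o oseg b"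
proof -
  assume ab: "a < b"
  have "wo_rel (oseg b)" using Well_order_oseg by (simp add: wo_rel_def)
  then have "wo_rel.ofilter (oseg b) {..<a}"
    unfolding wo_rel.ofilter_def[OF \<open>wo_rel (oseg b)\<close>] Field_oseg
    using ab by (auto simp: under_def oseg_def)
  then have "Restr (oseg b) {..<a} <o oseg b"
    using ab ofilter_ordLess[OF Well_order_oseg] by (metis Field_oseg lessThan_strict_subset_iff)
  moreover have "Restr (oseg b) {..<a} = oseg a" using ab by (auto simp: oseg_def)
  ultimately show ?thesis by simp
qed

lemma oseg_less_iff: "oseg a <o oseg b \<longleftrightarrow> a < b"
  by (metis Well_order_oseg linorder_neqE not_ordLess_ordLeq oseg_less ordLess_imp_ordLeq ordLess_irreflexive)

lemma oseg_le_iff: "oseg a \<le>o oseg b \<longleftrightarrow> a \<le> b"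
  using oseg_less_iff not_ordLeq_iff_ordLess[OF Well_order_oseg Well_order_oseg]
  by (metis not_less)

lemma ordIso_osegI:
  assumes "bij_betw F (Field r) {..<a}" "Well_order r"
    "\<And>x y. x \<in> Field r \<Longrightarrow> y \<in> Field r \<Longrightarrow> (x, y) \<in> r \<longleftrightarrow> F x \<le> F y"
  shows "r =o oseg a"
proof -
  have "iso r (oseg a) F"
    unfolding iso_iff2 Field_oseg using assms(1,3) by (auto simp: oseg_def bij_betw_def)
  then show ?thesis unfolding ordIso_def using assms(2) Well_order_oseg by blast
qed

lemma ordIso_osegE:
  assumes "r =o oseg a"
  obtains F where "bij_betw F (Field r) {..<a}"
    "\<And>x y. x \<in> Field r \<Longrightarrow> y \<in> Field r \<Longrightarrow> (x, y) \<in> r \<longleftrightarrow> F x \<le> F y"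
proof -
  obtain F where "iso r (oseg a) F" using assms unfolding ordIso_def by blast
  then have "bij_betw F (Field r) {..<a}"
    and "\<And>x y. x \<in> Field r \<Longrightarrow> y \<in> Field r \<Longrightarrow> (x, y) \<in> r \<longleftrightarrow> F x \<le> F y"
    unfolding iso_iff2 Field_oseg by (auto simp: oseg_def bij_betw_def)
  then show ?thesis using that by blast
qed

lemma Well_order_oseg_ex:
  assumes wo: "Well_order r" and small: "small TYPE('x) (Field r)"
  obtains a :: "'x ordinal" where "r =o oseg a"
proof -
  have lin: "refl_on (Field r) r" "trans r" "antisym r" "total_on (Field r) r" "wf (r - Id)"
    using wo unfolding well_order_on_def linear_order_on_def partial_order_on_def preorder_on_def
    by auto
  have tot: "(x, y) \<in> r \<or> (y, x) \<in> r" if "x \<in> Field r" "y \<in> Field r" for x y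
    using lin that by (metis refl_onD total_on_def)
  have "{(y, x). y \<in> Field r \<and> x \<in> Field r \<and> (x, y) \<notin> r} \<subseteq> r - Id"
    using tot lin(1) by (auto simp: refl_on_def)
  then have wf: "wf {(y, x). y \<in> Field r \<and> x \<in> Field r \<and> (x, y) \<notin> r}"
    using lin(5) wf_subset by blast
  obtain F :: "_ \<Rightarrow> 'x ordinal" and a where F:
    "\<And>x y. x \<in> Field r \<Longrightarrow> y \<in> Field r \<Longrightarrow> (x, y) \<in> r \<longleftrightarrow> F x \<le> F y" "F ` Field r = {..<a}"
    by (rule collapse[OF small, of "\<lambda>x y. (x, y) \<in> r"]) (use tot wf lin(2) in \<open>auto dest: transD\<close>)
  have "inj_on F (Field r)"
    by (rule inj_onI) (metis F(1) lin(3) antisymD order_refl)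
  with F have "r =o oseg a" by (intro ordIso_osegI[of F] wo) (auto simp: bij_betw_def)
  then show ?thesis using that by blast
qed

subsection \<open>Rank and the theorem of de Jongh and Parikh\<close>

abbreviation left :: "('a \<Rightarrow> 'a \<Rightarrow> bool) \<Rightarrow> 'a set \<Rightarrow> 'a \<Rightarrow> 'a set" where
  "left le A x \<equiv> {y \<in> A. \<not> le x y}"

text \<open>A relation and not a function, so that bounds can be stated before ranks are known to
  exist, with values in any well-order.\<close>

inductive rkle :: "('a \<Rightarrow> 'a \<Rightarrow> bool) \<Rightarrow> 'a set \<Rightarrow> 'o::wellorder \<Rightarrow> bool" for le where
  rkleI: "\<forall>x\<in>A. \<exists>c. c < d \<and> rkle le (left le A x) c \<Longrightarrow> rkle le A d"

lemma rkle_left: "rkle le A d \<Longrightarrow> x \<in> A \<Longrightarrow> \<exists>c<d. rkle le (left le A x) c"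
  by (erule rkle.cases) blast

lemma rkle_mono: "rkle le A c \<Longrightarrow> B \<subseteq> A \<Longrightarrow> c \<le> d \<Longrightarrow> rkle le B d"
proof (induction c arbitrary: A B d rule: less_induct)
  case (less c)
  show ?case
  proof (rule rkleI, rule ballI)
    fix x assume "x \<in> B"
    then obtain c' where c': "c' < c" "rkle le (left le A x) c'"
      using rkle_left[OF less.prems(1)] less.prems(2) by blast
    have "left le B x \<subseteq> left le A x" using less.prems(2) by blast
    then have "rkle le (left le B x) c'" using less.IH[OF c'] by blast
    then show "\<exists>c<d. rkle le (left le B x) c" using c'(1) less.prems(3) by (meson less_le_trans)
  qed
qed

text \<open>Passing to the residual at \<open>x\<close> shrinks both parts, and the bound of the
  part containing \<open>x\<close> drops; addition of multisets is strictly monotone on each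
  side.\<close>

lemma rkle_Un:
  fixes c d :: "'o::wellorder multiset"
  assumes "rkle le A c" "rkle le B d"
  shows "rkle le (A \<union> B) (c + d)"
proof -
  have "rkle le (A \<union> B) s" if "rkle le A c" "rkle le B d" "c + d = s"
    for A B and c d s :: "'o multiset"
    using that
  proof (induction s arbitrary: A B c d rule: less_induct)
    case (less s)
    show ?case
    proof (rule rkleI, rule ballI)
      fix x assume "x \<in> A \<union> B"
      have eq: "left le (A \<union> B) x = left le A x \<union> left le B x" by blast
      show "\<exists>c<s. rkle le (left le (A \<union> B) x) c"
      proof (cases "x \<in> A")
        case True
        then obtain c' where c': "c' < c" "rkle le (left le A x) c'"
          using rkle_left less.prems by metis
        have "rkle le (left le B x) d" by (rule rkle_mono[OF less.prems(2)]) auto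
        moreover have "c' + d < s" using add_strict_right_mono[OF c'(1)] less.prems(3) by metis
        ultimately have "rkle le (left le A x \<union> left le B x) (c' + d)"
          using less.IH[OF _ c'(2) _ refl] by blast
        then show ?thesis using \<open>c' + d < s\<close> unfolding eq by blast
      next
        case False
        then obtain d' where d': "d' < d" "rkle le (left le B x) d'"
          using rkle_left less.prems \<open>x \<in> A \<union> B\<close> by (metis UnE)
        have "rkle le (left le A x) c" by (rule rkle_mono[OF less.prems(1)]) auto
        moreover have "c + d' < s" using add_strict_left_mono[OF d'(1)] less.prems(3) by metis
        ultimately have "rkle le (left le A x \<union> left le B x) (c + d')"
          using less.IH[OF _ _ d'(2) refl] by blast
        then show ?thesis using \<open>c + d' < s\<close> unfolding eq by blast
      qed
    qed
  qed
  then show ?thesis using assms by blast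
qed

text \<open>\<open>\<omega>\<^sup>b\<close> is additively indecomposable: multisets below
  \<open>{#b#}\<close> are those with all exponents below \<open>b\<close>, which sums
  preserve.\<close>

lemma rkle_finite_UN:
  fixes b :: "'o::wellorder"
  assumes "finite I" "\<And>i. i \<in> I \<Longrightarrow> \<exists>c<{#b#}. rkle le (A i) c"
  shows "\<exists>c<{#b#}. rkle le (\<Union>i\<in>I. A i) c"
  using assms
proof (induction I rule: finite_induct)
  case empty
  have "rkle le {} {#}" by (rule rkleI) simp
  then show ?case by (intro exI[of _ "{#}"]) simp
next
  case (insert i I)
  then obtain c d where "c < {#b#}" "rkle le (A i) c" "d < {#b#}" "rkle le (\<Union>i\<in>I. A i) d"
    by (metis insertCI)
  then show ?case using rkle_Un[of le "A i" c "\<Union>i\<in>I. A i" d]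
    by (intro exI[of _ "c + d"]) auto
qed

section \<open>Existence of ranks\<close>

definition good_on :: "('a \<Rightarrow> 'a \<Rightarrow> bool) \<Rightarrow> 'a set \<Rightarrow> bool" where
  "good_on le A \<longleftrightarrow> (\<forall>f :: nat \<Rightarrow> 'a. (\<forall>i. f i \<in> A) \<longrightarrow> (\<exists>i j. i < j \<and> le (f i) (f j)))"

text \<open>Otherwise residuals with \<open>P\<close> could be taken forever. Each chosen point lies
  in all earlier residuals, so the points would form a bad sequence.\<close>

lemma good_on_minimal:
  assumes "good_on le A" "P A"
  obtains B where "B \<subseteq> A" "P B" "\<And>a. a \<in> B \<Longrightarrow> \<not> P (left le B a)"
proof -
  have "\<exists>B. B \<subseteq> A \<and> P B \<and> (\<forall>a\<in>B. \<not> P (left le B a))"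
  proof (rule ccontr)
    assume *: "\<not> ?thesis"
    define R where "R p q \<longleftrightarrow> fst q = left le (fst p) (snd p)" for p q :: "'a set \<times> 'a"
    define S where "S p \<longleftrightarrow> fst p \<subseteq> A \<and> P (fst p) \<and> snd p \<in> fst p \<and> P (left le (fst p) (snd p))"
      for p :: "'a set \<times> 'a"
    have step: "\<exists>a. S (B, a)" if "B \<subseteq> A" "P B" for B
      using * that unfolding S_def by auto
    have "\<exists>f. \<forall>n. S (f n) \<and> R (f n) (f (Suc n))"
    proof (rule dependent_nat_choice)
      show "\<exists>x. S x" using step assms by blast
      fix x :: "'a set \<times> 'a" and n :: nat
      assume "S x"
      then have "left le (fst x) (snd x) \<subseteq> A" "P (left le (fst x) (snd x))"
        unfolding S_def by blast+
      then obtain a where "S (left le (fst x) (snd x), a)" using step by blast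
      then show "\<exists>y. S y \<and> R x y" unfolding R_def by (metis fst_conv)
    qed
    then obtain f where f: "\<And>n. S (f n)" "\<And>n. R (f n) (f (Suc n))" by blast
    have mono: "fst (f j) \<subseteq> fst (f i)" if "i \<le> j" for i j
      by (rule lift_Suc_antimono_le[OF _ that]) (use f(2) R_def in auto)
    have "\<forall>i. snd (f i) \<in> A" using f(1) S_def by blast
    then obtain i j where ij: "i < j" "le (snd (f i)) (snd (f j))"
      using assms(1)[unfolded good_on_def, rule_format, of "\<lambda>i. snd (f i)"] by blast
    have "snd (f j) \<in> fst (f (Suc i))" using mono[of "Suc i" j] ij(1) f(1)[of j] S_def by fastforce
    then show False using f(2)[of i] ij(2) R_def by simp
  qed
  then show ?thesis using that by blast
qed

text \<open>The tail of a bad sequence is a bad sequence in the residual at its first term, whose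
  bound is smaller.\<close>

lemma rkle_good_on: "rkle le A c \<Longrightarrow> good_on le A"
proof (induction rule: rkle.induct)
  case (rkleI A d)
  show ?case unfolding good_on_def
  proof (intro allI impI, rule ccontr)
    fix f :: "nat \<Rightarrow> 'a"
    assume f: "\<forall>i. f i \<in> A" and bad: "\<not> (\<exists>i j. i < j \<and> le (f i) (f j))"
    then have "\<forall>i. f (Suc i) \<in> left le A (f 0)" by blast
    moreover have "good_on le (left le A (f 0))" using rkleI f by blast
    ultimately obtain i j where "i < j" "le (f (Suc i)) (f (Suc j))"
      unfolding good_on_def by (meson)
    then show False using bad by (meson Suc_less_eq)
  qed
qed

definition swqo :: "'x itself \<Rightarrow> ('a \<Rightarrow> 'a \<Rightarrow> bool) \<Rightarrow> 'a set \<Rightarrow> bool" where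
  "swqo _ le A \<longleftrightarrow> wqo_on A le \<and> small TYPE('x) A"

lemma swqo_good_on: "swqo TYPE('x) le A \<Longrightarrow> good_on le A"
  by (simp add: swqo_def wqo_on_def good_on_def)

lemma swqo_subset: "swqo TYPE('x) le A \<Longrightarrow> B \<subseteq> A \<Longrightarrow> swqo TYPE('x) le B"
  unfolding swqo_def wqo_on_def using small_subset by (metis (no_types, lifting) subset_iff)

lemma swqo_trans: "swqo TYPE('x) le A \<Longrightarrow> x \<in> A \<Longrightarrow> y \<in> A \<Longrightarrow> z \<in> A \<Longrightarrow> le x y \<Longrightarrow> le y z \<Longrightarrow> le x z"
  unfolding swqo_def wqo_on_def by blast

text \<open>A minimal unranked subset has ranked residuals only. Being small, it has a bound above
  all their ranks, which ranks it after all.\<close>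

lemma swqo_ranked:
  assumes "swqo TYPE('x) le A"
  shows "\<exists>c :: 'x ordinal multiset. rkle le A c"
proof (rule ccontr)
  assume *: "\<not> ?thesis"
  obtain B where B: "B \<subseteq> A" "\<not> (\<exists>c :: 'x ordinal multiset. rkle le B c)"
    "\<And>a. a \<in> B \<Longrightarrow> \<exists>c :: 'x ordinal multiset. rkle le (left le B a) c"
    using good_on_minimal[of le A "\<lambda>B. \<not> (\<exists>c :: 'x ordinal multiset. rkle le B c)"]
      swqo_good_on[OF assms] * by metis
  obtain g :: "_ \<Rightarrow> 'x ordinal multiset" where g: "\<And>a. a \<in> B \<Longrightarrow> rkle le (left le B a) (g a)"
    using B(3) by metis
  obtain b where "\<forall>a\<in>B. g a < {#b#}"
    using small_bounded_mset[of B g] small_subset assms B(1) swqo_def by blast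
  then have "rkle le B {#b#}" using g by (intro rkleI) blast
  then show False using B(2) by blast
qed

definition rk :: "('a \<Rightarrow> 'a \<Rightarrow> bool) \<Rightarrow> 'a set \<Rightarrow> 'x ordinal multiset" where
  "rk le A = (LEAST c. rkle le A c)"

lemma rk_le: "rkle le A c \<Longrightarrow> rk le A \<le> c"
  unfolding rk_def by (rule Least_le)

lemma rkle_rk: "swqo TYPE('x) le A \<Longrightarrow> rkle le A (rk le A :: 'x ordinal multiset)"
  unfolding rk_def by (rule LeastI_ex) (rule swqo_ranked)

lemma rk_mono: "swqo TYPE('x) le A \<Longrightarrow> B \<subseteq> A \<Longrightarrow> rk le B \<le> (rk le A :: 'x ordinal multiset)"
  by (rule rk_le) (meson order_refl rkle_mono rkle_rk)

lemma rk_left: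
  assumes "swqo TYPE('x) le A" "x \<in> A"
  shows "rk le (left le A x) < (rk le A :: 'x ordinal multiset)"
proof -
  obtain c :: "'x ordinal multiset" where "c < rk le A" "rkle le (left le A x) c"
    using rkle_left[OF rkle_rk[OF assms(1)] assms(2)] by blast
  then show ?thesis using le_less_trans[OF rk_le] by blast
qed

lemma less_rk:
  assumes "swqo TYPE('x) le A" "c < (rk le A :: 'x ordinal multiset)"
  obtains x where "x \<in> A" "c \<le> rk le (left le A x)"
proof -
  have "\<exists>x\<in>A. c \<le> rk le (left le A x)"
  proof (rule ccontr)
    assume "\<not> ?thesis"
    then have "\<forall>x\<in>A. \<exists>d<c. rkle le (left le A x) d"
      by (metis (no_types, lifting) assms(1) leI mem_Collect_eq rkle_rk subsetI swqo_subset)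
    then have "rkle le A c" by (rule rkleI)
    then show False using rk_le assms(2) by (metis leD)
  qed
  then show ?thesis using that by blast
qed

lemma rk_Un:
  assumes "swqo TYPE('x) le A" "B \<subseteq> A" "C \<subseteq> A"
  shows "rk le (B \<union> C) \<le> (rk le B + rk le C :: 'x ordinal multiset)"
  by (rule rk_le) (intro rkle_Un rkle_rk swqo_subset[OF assms(1)] assms)

text \<open>Residuals are downward closed. While \<open>c\<close> is below the rank, some residual
  still has rank at least \<open>c\<close>, and its rank is smaller, so the descent stops exactly at
  \<open>c\<close>.\<close>

lemma rk_downset:
  assumes "swqo TYPE('x) le A" "c \<le> (rk le A :: 'x ordinal multiset)"
  obtains D where "D \<subseteq> A" "\<And>x y. x \<in> D \<Longrightarrow> y \<in> A \<Longrightarrow> le y x \<Longrightarrow> y \<in> D" "rk le D = c"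
proof -
  have "\<exists>D\<subseteq>A. (\<forall>x\<in>D. \<forall>y\<in>A. le y x \<longrightarrow> y \<in> D) \<and> rk le D = c"
    if "swqo TYPE('x) le A" "c \<le> s" "s = (rk le A :: 'x ordinal multiset)" for s A
    using that
  proof (induction s arbitrary: A rule: less_induct)
    case (less s)
    show ?case
    proof (cases "c = s")
      case False
      then obtain x where x: "x \<in> A" "c \<le> rk le (left le A x)"
        using less_rk less.prems by (metis order_le_less)
      have sub: "left le A x \<subseteq> A" by auto
      have "rk le (left le A x) < s" using rk_left[OF less.prems(1) x(1)] less.prems by simp
      from less.IH[OF this swqo_subset[OF less.prems(1) sub] x(2) refl]
      obtain D where D: "D \<subseteq> left le A x" "\<forall>y\<in>D. \<forall>z\<in>left le A x. le z y \<longrightarrow> z \<in> D" "rk le D = c"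
        by (elim exE conjE) (rule that)
      have "z \<in> D" if "y \<in> D" "z \<in> A" "le z y" for y z
      proof -
        have "\<not> le x z" using D(1) that x(1) swqo_trans[OF less.prems(1), of x z y] by blast
        then show ?thesis using D that by blast
      qed
      then show ?thesis using D by (intro exI[of _ D]) auto
    qed (use less.prems in blast)
  qed
  from this[OF assms refl] show ?thesis using that by metis
qed

section \<open>Linear extensions that realise the rank\<close>

lemma mset_split_Min:
  fixes M :: "'o::wellorder multiset"
  assumes "M \<noteq> {#}"
  obtains N d where "M = N + {#d#}" "\<And>x. x \<in># N \<Longrightarrow> d \<le> x"
proof -
  have "Min_mset M \<in># M" using assms by simp
  then have "M = (M - {#Min_mset M#}) + {#Min_mset M#}" by simp
  moreover have "Min_mset M \<le> x" if "x \<in># M - {#Min_mset M#}" for x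
    using that by (meson Min_le finite_set_mset in_diffD)
  ultimately show ?thesis using that by blast
qed

text \<open>Since \<open>d\<close> is at most all exponents of \<open>N\<close>, the natural sum \<open>N + {#d#}\<close> is the ordinary
  sum \<open>N + \<omega>\<^sup>d\<close>.\<close>
lemma less_plus_single:
  fixes K N :: "'o::wellorder multiset"
  assumes K: "K < N + {#d#}" and d: "\<And>x. x \<in># N \<Longrightarrow> d \<le> x" and nK: "N \<le> K"
  obtains J where "K = N + J" "J < {#d#}"
proof -
  define I where "I = N \<inter># K"
  define N1 where "N1 = N - I"
  define K1 where "K1 = K - I"
  have N: "N = I + N1" and K': "K = I + K1"
    unfolding N1_def K1_def I_def by (auto simp: multiset_eq_iff)
  have disj: "x \<notin># N1 \<or> x \<notin># K1" for x
    unfolding N1_def K1_def I_def by (auto simp: not_in_iff)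
  have 1: "N1 \<le> K1" using nK N K' by simp
  have 2: "K1 < N1 + {#d#}" using K N K' by (simp add: add.assoc)
  \<comment> \<open>If part of \<open>N\<close> were left over, the largest exponent of
    \<open>K1\<close> would exceed all of \<open>N1\<close> and also \<open>d\<close>, making
    \<open>K1\<close> larger than \<open>N1 + {#d#}\<close>.\<close>
  have "N1 = {#}"
  proof (rule ccontr)
    assume ne: "N1 \<noteq> {#}"
    then have neK: "K1 \<noteq> {#}" using 1 by auto
    have mem: "Max_mset K1 \<in># K1" "Max_mset N1 \<in># N1" using ne neK by simp_all
    have "Max_mset K1 \<noteq> Max_mset N1" using disj[of "Max_mset N1"] mem by auto
    moreover have "\<not> Max_mset K1 < Max_mset N1"
      using leD[OF 1] Max_lt_imp_lt_mset[OF ne] by blast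
    ultimately have mx: "Max_mset N1 < Max_mset K1" by (metis linorder_neqE)
    have "d \<le> Max_mset N1" using d mem(2) N by simp
    then have "\<forall>x\<in>#N1 + {#d#}. x < Max_mset K1"
      using mx le_less_trans[OF Max_ge[OF finite_set_mset[of N1]] mx] by simp
    then have "N1 + {#d#} < K1" using neK
      by (intro ex_gt_imp_less_multiset exI[of _ "Max_mset K1"]) auto
    then show False using 2 by simp
  qed
  then show ?thesis using that[of K1] N K' 2 by simp
qed


text \<open>A monotone map whose values cover everything below \<open>c\<close>. Larger values are
  permitted, which makes such maps easier to glue than linear extensions of exact type
  \<open>c\<close>; \<open>linearization_eq_rk\<close> recovers the latter.\<close>

definition attains :: "('a \<Rightarrow> 'a \<Rightarrow> bool) \<Rightarrow> 'a set \<Rightarrow> 'x ordinal multiset \<Rightarrow> bool" where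
  "attains le A c \<longleftrightarrow>
     (\<exists>f. (\<forall>x\<in>A. \<forall>y\<in>A. le x y \<longrightarrow> f x \<le> f y) \<and> {..<c} \<subseteq> f ` A)"

text \<open>A strictly descending sequence for \<open>L\<close> would be a bad sequence for
  \<open>le\<close>, so every linearization is well founded.\<close>

lemma linearization_collapse:
  assumes Q: "swqo TYPE('x) le A" and L: "linearization A le L"
  obtains F :: "'a \<Rightarrow> 'x ordinal" and a where
    "\<And>x y. x \<in> A \<Longrightarrow> y \<in> A \<Longrightarrow> L x y \<longleftrightarrow> F x \<le> F y" and "F ` A = {..<a}"
proof -
  have tot: "L x y \<or> L y x" if "x \<in> A" "y \<in> A" for x y
    using L that unfolding linearization_def by blast
  have tr: "L x z" if "x \<in> A" "y \<in> A" "z \<in> A" "L x y" "L y z" for x y z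
    using L that unfolding linearization_def by blast
  have ext: "L x y" if "x \<in> A" "y \<in> A" "le x y" for x y
    using L that unfolding linearization_def by blast
  have wf: "wf {(y, x). y \<in> A \<and> x \<in> A \<and> \<not> L x y}"
    unfolding wf_iff_no_infinite_down_chain
  proof (rule notI, erule exE)
    fix f assume f: "\<forall>i. (f (Suc i), f i) \<in> {(y, x). y \<in> A \<and> x \<in> A \<and> \<not> L x y}"
    then have fA: "f i \<in> A" for i by blast
    have desc: "\<not> L (f i) (f j)" if "i < j" for i j
      using that
    proof (induction j)
      case (Suc j)
      have 1: "\<not> L (f j) (f (Suc j))" using f by blast
      show ?case
      proof (cases "i = j")
        case False
        then have "\<not> L (f i) (f j)" using Suc by simp
        moreover have "L (f (Suc j)) (f j)" using 1 tot[OF fA fA] by blast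
        ultimately show ?thesis using tr[OF fA fA fA, of i "Suc j" j] by blast
      qed (use 1 in simp)
    qed simp
    obtain i j where ij: "i < j" "le (f i) (f j)"
      using swqo_good_on[OF Q, unfolded good_on_def, rule_format, of f, OF fA] by (elim exE conjE) (rule that)
    then have "L (f i) (f j)" using ext fA by blast
    then show False using desc ij(1) by blast
  qed
  have small: "small TYPE('x) A" using Q swqo_def by blast
  show ?thesis by (rule collapse[OF small tot tr wf]) (use that in blast)+
qed

text \<open>\<open>A\<close> is exhausted by an increasing chain of downward closed sets
  \<open>D e\<close> of smaller rank. Layers between selected stages have ranks unbounded in
  \<open>{#d#}\<close>; putting the extensions given by \<open>IH\<close> for the layers one after
  another reaches every value.\<close>

lemma attains_indecomposable:
  fixes A :: "'a set"
  assumes Q: "swqo TYPE('x) le A" and rkA: "rk le A = {#d :: 'x ordinal#}"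
    and IH: "\<And>B. B \<subseteq> A \<Longrightarrow> rk le B < {#d#} \<Longrightarrow> attains le B (rk le B :: 'x ordinal multiset)"
  shows "attains le A {#d#}"
proof (cases "\<exists>z. z < d")
  case False
  then have "c = {#}" if "c < {#d#}" for c using that by (metis mset_lt_single_right_iff multiset_nonemptyE)
  moreover have "A \<noteq> {}"
    using rkA rk_le[of le "{}" "{#} :: 'x ordinal multiset"] rkleI[of "{}" "{#}" le] by auto
  ultimately show ?thesis unfolding attains_def by (intro exI[of _ "\<lambda>_. {#}"]) force
next
  case True
  then obtain z where z: "z < d" by blast
  let ?w = "{#d#}"
  let ?rk = "\<lambda>B. rk le B :: 'x ordinal multiset"
  \<comment> \<open>For lack of a successor on multisets, adding a fixed exponent
    \<open>z < d\<close> serves as a strict increase that stays below \<open>?w\<close>.\<close>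
  have suc: "add_mset z c < ?w" "c < add_mset z c" if "c < ?w" for c using that z by auto
  have plus: "b + c < ?w" if "b < ?w" "c < ?w" for b c using that by auto
  have sub: "swqo TYPE('x) le B" if "B \<subseteq> A" for B by (rule swqo_subset[OF Q that])
  \<comment> \<open>Residuals of \<open>A\<close> at points of \<open>B\<close> reach ranks as close
    to \<open>?w\<close> as desired. Minimality of such a \<open>B\<close> is what later makes the
    ranks of the \<open>D e\<close> unbounded.\<close>
  define big where "big B \<longleftrightarrow> (\<forall>c<?w. \<exists>b\<in>B. c \<le> ?rk (left le A b))" for B
  have "big A" unfolding big_def using less_rk[OF Q] rkA by metis
  then obtain B where B: "B \<subseteq> A" "big B" "\<And>a. a \<in> B \<Longrightarrow> \<not> big (left le B a)"
    using good_on_minimal[OF swqo_good_on[OF Q], of big] by metis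
  \<comment> \<open>Points not above any member of \<open>B\<close> whose residual has rank at least
    \<open>e\<close>. Bigness gives such a member \<open>b\<close>, and \<open>D e\<close> lies in
    the residual at \<open>b\<close>, so its rank is below \<open>?w\<close>.\<close>
  define D where "D e = {x \<in> A. \<forall>b\<in>B. e \<le> ?rk (left le A b) \<longrightarrow> \<not> le b x}" for e
  have DA: "D e \<subseteq> A" for e unfolding D_def by blast
  have Dmono: "D e \<subseteq> D e'" if "e \<le> e'" for e e' using that unfolding D_def by fastforce
  have Ddown: "y \<in> D e" if "x \<in> D e" "y \<in> A" "le y x" for x y e
    using that B(1) swqo_trans[OF Q, of _ y x] unfolding D_def by blast
  have Drk: "?rk (D e) < ?w" if e: "e < ?w" for e
  proof -
    obtain b where b: "b \<in> B" "e \<le> ?rk (left le A b)" using B(2) e big_def by blast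
    then have "D e \<subseteq> left le A b" unfolding D_def by blast
    then have "?rk (D e) \<le> ?rk (left le A b)" by (intro rk_mono sub) auto
    also have "\<dots> < ?w" using rk_left[OF Q, of b] b B(1) rkA by auto
    finally show ?thesis .
  qed
  \<comment> \<open>By minimality the members of \<open>B\<close> not above \<open>a\<close> have
    residuals of rank below some \<open>e\<close>. So every member that counts for
    \<open>D e\<close> is above \<open>a\<close>, and the residual of \<open>A\<close> at
    \<open>a\<close> lies inside \<open>D e\<close>.\<close>
  have Dlarge: "\<exists>e<?w. c \<le> ?rk (D e)" if c: "c < ?w" for c
  proof -
    obtain a where a: "a \<in> B" "c \<le> ?rk (left le A a)" using B(2) c big_def by blast
    obtain e where e: "e < ?w" "\<And>b. b \<in> left le B a \<Longrightarrow> \<not> e \<le> ?rk (left le A b)"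
      using B(3)[OF a(1)] unfolding big_def by blast
    have "left le A a \<subseteq> D e"
    proof
      fix x assume x: "x \<in> left le A a"
      have "\<not> le b x" if "b \<in> B" "e \<le> ?rk (left le A b)" for b
        using that e(2)[of b] x a(1) B(1) swqo_trans[OF Q, of a b x] by blast
      then show "x \<in> D e" using x unfolding D_def by blast
    qed
    then have "?rk (left le A a) \<le> ?rk (D e)" by (intro rk_mono sub DA)
    then show ?thesis using a(2) e(1) by (meson order_trans)
  qed
  have Dstep: "\<exists>g<?w. e \<le> g \<and> c \<le> ?rk (D g - D e)" if ec: "e < ?w" "c < ?w" for e c
  proof -
    obtain g0 where g0: "g0 < ?w" "?rk (D e) + c \<le> ?rk (D g0)"
      using Dlarge[OF plus[OF Drk[OF ec(1)] ec(2)]] by blast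
    define g where "g = max g0 e"
    have g: "g < ?w" "e \<le> g" "g0 \<le> g" using g0(1) ec(1) unfolding g_def by (auto simp only: max_less_iff_conj max.cobounded1 max.cobounded2)
    have "?rk (D e) + c \<le> ?rk (D g)"
      using g0(2) rk_mono[OF sub[OF DA] Dmono[OF g(3)]] order_trans by blast
    also have "\<dots> = ?rk (D e \<union> (D g - D e))" using Dmono[OF g(2)] by (simp add: Un_absorb1)
    also have "\<dots> \<le> ?rk (D e) + ?rk (D g - D e)"
      by (rule rk_Un[OF Q]) (use DA in blast)+
    finally show ?thesis using g by (intro exI[of _ g]) simp
  qed
  \<comment> \<open>\<open>T\<close> selects the stages by recursion: \<open>e\<close> is taken if
    the new layer has rank above every stage taken before.\<close>
  obtain T where T: "\<And>e. T e \<longleftrightarrow> e < ?w \<and>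
      (\<forall>e'<e. T e' \<longrightarrow> e' < ?rk (D e - (\<Union>e''\<in>{e''. e'' < e \<and> T e''}. D e'')))"
  proof -
    define H where "H T e \<longleftrightarrow> e < ?w \<and>
      (\<forall>e'<e. T e' \<longrightarrow> e' < ?rk (D e - (\<Union>e''\<in>{e''. e'' < e \<and> T e''}. D e'')))" for T e
    define T where "T = wfrec {(x, y). x < y} H"
    have cutT: "H (cut T {(x, y). x < y} e) e = H T e" for e
    proof -
      have "{e''. e'' < e \<and> cut T {(x, y). x < y} e e''} = {e''. e'' < e \<and> T e''}"
        by (auto simp: cut_def)
      then show ?thesis unfolding H_def by (simp add: cut_def cong: conj_cong)
    qed
    have "T e = H T e" for e
      by (subst T_def, subst wfrec[OF wf]) (simp only: T_def[symmetric] cutT)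
    then show ?thesis using that unfolding H_def by blast
  qed
  define U where "U e = (\<Union>e'\<in>{e'. e' < e \<and> T e'}. D e')" for e
  define E where "E e = D e - U e" for e
  have EA: "E e \<subseteq> A" for e using DA unfolding E_def by blast
  have Tw: "e < ?w" if "T e" for e using T that by blast
  have TE: "e' < ?rk (E e)" if "T e" "T e'" "e' < e" for e e'
    using that T[of e] unfolding E_def U_def by blast
  \<comment> \<open>Were all stages below \<open>v\<close>, a later \<open>g\<close> for which
    \<open>D g - D v\<close> has rank above \<open>v\<close> would qualify as a stage.\<close>
  have Tunb: "\<exists>e. T e \<and> v \<le> e" if v: "v < ?w" for v
  proof (rule ccontr)
    assume *: "\<not> ?thesis"
    obtain g where g: "g < ?w" "v \<le> g" "add_mset z v \<le> ?rk (D g - D v)"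
      using Dstep[OF v suc(1)[OF v]] by blast
    have "U g \<subseteq> D v" using * Dmono unfolding U_def by (auto, meson leI less_imp_le subsetD)
    then have "?rk (D g - D v) \<le> ?rk (E g)" by (intro rk_mono sub EA) (auto simp: E_def)
    then have "v < ?rk (E g)" using g(3) suc(2)[OF v] by (meson less_le_trans)
    then have "T g" using * g(1) unfolding T[of g] E_def U_def by (meson leI less_trans)
    then show False using * g(2) by blast
  qed
  \<comment> \<open>A point \<open>x\<close> in no selected \<open>D e\<close> would confine their
    union to the residual at \<open>x\<close>, of rank below \<open>?w\<close>, although this union
    contains sets \<open>D e\<close> of larger rank.\<close>
  have cover: "\<exists>e. T e \<and> x \<in> D e" if x: "x \<in> A" for x
  proof (rule ccontr)
    assume *: "\<not> ?thesis"
    define X where "X = (\<Union>e\<in>Collect T. D e)"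
    have "X \<subseteq> left le A x" using * DA Ddown x unfolding X_def by blast
    then have "?rk X \<le> ?rk (left le A x)" by (intro rk_mono sub) auto
    also have "\<dots> < ?w" using rk_left[OF Q x] rkA by simp
    finally have X: "?rk X < ?w" .
    obtain e where e: "e < ?w" "add_mset z (?rk X) \<le> ?rk (D e)" using Dlarge[OF suc(1)[OF X]] by blast
    obtain e' where "T e'" "e \<le> e'" using Tunb[OF e(1)] by blast
    then have "D e \<subseteq> X" using Dmono unfolding X_def by blast
    then have "?rk (D e) \<le> ?rk X" by (intro rk_mono sub) (use DA X_def in auto)
    then show False using e(2) suc(2)[OF X] by (meson leD less_le_trans)
  qed
  define l where "l x = (LEAST e. T e \<and> x \<in> D e)" for x
  have l: "T (l x)" "x \<in> D (l x)" if "x \<in> A" for x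
    using LeastI_ex[OF cover[OF that]] unfolding l_def by blast+
  have l_le: "l x \<le> e" if "T e" "x \<in> D e" for x e
    unfolding l_def by (rule Least_le) (use that in blast)
  have lE: "x \<in> E (l x)" if "x \<in> A" for x
    using l[OF that] l_le leD unfolding E_def U_def by blast
  have El: "l x = e" if "T e" "x \<in> E e" for x e
  proof (rule antisym)
    show "l x \<le> e" using that l_le E_def by blast
    have "x \<in> A" using that EA by blast
    show "e \<le> l x"
    proof (rule ccontr)
      assume "\<not> e \<le> l x"
      then have "x \<in> U e" using l[OF \<open>x \<in> A\<close>] unfolding U_def by (intro UN_I[of "l x"]) (simp_all add: not_le)
      then show False using that unfolding E_def by blast
    qed
  qed
  have l_mono: "l y \<le> l x" if "x \<in> A" "y \<in> A" "le y x" for x y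
    using l_le l[OF that(1)] Ddown that by blast
  have "attains le (E e) (?rk (E e))" if "T e" for e
  proof (rule IH[OF EA])
    have "?rk (E e) \<le> ?rk (D e)" by (intro rk_mono sub DA) (auto simp: E_def)
    then show "?rk (E e) < ?w" using Drk[OF Tw[OF that]] by (rule le_less_trans)
  qed
  then have "\<exists>f. T e \<longrightarrow> (\<forall>x\<in>E e. \<forall>y\<in>E e. le x y \<longrightarrow> f x \<le> f y) \<and> {..<?rk (E e)} \<subseteq> f ` E e" for e
    unfolding attains_def by blast
  then obtain f where f: "\<And>e x y. T e \<Longrightarrow> x \<in> E e \<Longrightarrow> y \<in> E e \<Longrightarrow> le x y \<Longrightarrow> f e x \<le> f e y"
      "\<And>e. T e \<Longrightarrow> {..<?rk (E e)} \<subseteq> f e ` E e"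
    by metis
  \<comment> \<open>Lexicographic: by layer first, within a layer by the map that attains its rank.
    Monotone because the sets \<open>D e\<close> are downward closed.\<close>
  define L where "L x y \<longleftrightarrow> l x < l y \<or> l x = l y \<and> f (l x) x \<le> f (l y) y" for x y
  have lin: "linearization A le L"
    unfolding linearization_def
  proof (intro conjI ballI impI)
    fix x y assume xy: "x \<in> A" "y \<in> A" "le x y"
    show "L x y"
    proof (cases "l x = l y")
      case True
      then show ?thesis using f(1)[OF l(1)[OF xy(1)], of x y] lE xy unfolding L_def by metis
    next
      case False
      then show ?thesis using l_mono[OF xy(2,1,3)] unfolding L_def by simp
    qed
  qed (auto simp: L_def)
  obtain F :: "'a \<Rightarrow> 'x ordinal" and a where
    F: "\<And>x y. x \<in> A \<Longrightarrow> y \<in> A \<Longrightarrow> L x y \<longleftrightarrow> F x \<le> F y" "F ` A = {..<a}"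
    by (rule linearization_collapse[OF Q lin], rule that)
  \<comment> \<open>Within a layer all values below \<open>c\<close> occur strictly before
    \<open>x\<close>, so the position of \<open>x\<close> in the whole order is at least
    \<open>c\<close>.\<close>
  have ge: "c \<le> cnf (F x)" if "T e" "x \<in> E e" "f e x = c" "c < ?rk (E e)" for e x c
    using that
  proof (induction c arbitrary: x rule: less_induct)
    case (less c)
    show ?case
    proof (rule ccontr)
      assume "\<not> c \<le> cnf (F x)"
      then have c': "cnf (F x) < c" by simp
      then have "cnf (F x) \<in> f e ` E e" using f(2)[OF less.prems(1)] less.prems(4) by auto
      then obtain y where y: "y \<in> E e" "f e y = cnf (F x)" by auto
      have "cnf (F x) \<le> cnf (F y)"
        by (rule less.IH[OF c' less.prems(1) y]) (use c' less.prems(4) in simp)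
      moreover have "\<not> L x y"
        using El[OF less.prems(1)] y less.prems c' unfolding L_def by simp
      ultimately show False using F(1) EA y(1) less.prems(2) by (auto simp: subset_iff)
    qed
  qed
  have "{..<?w} \<subseteq> (\<lambda>x. cnf (F x)) ` A"
  proof
    fix c assume "c \<in> {..<?w}"
    then have "c < ?w" by simp
    then obtain e1 where e1: "T e1" "c \<le> e1" using Tunb by blast
    obtain e2 where e2: "T e2" "add_mset z e1 \<le> e2" using Tunb suc(1) Tw e1(1) by blast
    have "e1 < ?rk (E e2)"
      using TE[OF e2(1) e1(1)] e2(2) suc(2)[OF Tw[OF e1(1)]] by (meson less_le_trans)
    then have c: "c < ?rk (E e2)" using e1(2) by simp
    then obtain x where x: "x \<in> E e2" "f e2 x = c" using f(2)[OF e2(1)] by blast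
    then have "c \<le> cnf (F x)" using ge e2(1) c by blast
    then obtain b where b: "c = cnf b" "b \<le> F x" using cnf_onto[of c "F x"] by (metis order_le_less)
    have "F x < a" using F(2) x(1) EA by blast
    then have "b \<in> F ` A" using F(2) b(2) by simp
    then show "c \<in> (\<lambda>x. cnf (F x)) ` A" using b(1) by blast
  qed
  moreover have "\<forall>x\<in>A. \<forall>y\<in>A. le x y \<longrightarrow> cnf (F x) \<le> cnf (F y)"
  proof (intro ballI impI)
    fix x y assume xy: "x \<in> A" "y \<in> A" "le x y"
    then have "L x y" using lin unfolding linearization_def by blast
    then show "cnf (F x) \<le> cnf (F y)" using F(1)[OF xy(1,2)] by simp
  qed
  ultimately show ?thesis unfolding attains_def by (intro exI[of _ "\<lambda>x. cnf (F x)"] conjI)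
qed

text \<open>Splitting off the last term of the normal form, \<open>N + {#d#}\<close>, reduces to the
  indecomposable case: a part of rank \<open>N\<close> is put before a part of rank
  \<open>{#d#}\<close>.\<close>

theorem de_Jongh_Parikh:
  assumes "swqo TYPE('x) le A"
  shows "attains le A (rk le A :: 'x ordinal multiset)"
proof -
  have "attains le A s" if "swqo TYPE('x) le A" "s = (rk le A :: 'x ordinal multiset)" for s A
    using that
  proof (induction s arbitrary: A rule: less_induct)
    case (less s)
    note Q = less.prems(1)
    show ?case
    proof (cases "s = {#}")
      case True
      then show ?thesis unfolding attains_def by auto
    next
      case False
      then obtain N d where s: "s = N + {#d#}" and d: "\<And>x. x \<in># N \<Longrightarrow> d \<le> x"
        by (rule mset_split_Min) blast
      show ?thesis
      proof (cases "N = {#}")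
        case True
        show ?thesis
          using attains_indecomposable[OF Q, of d] less s True swqo_subset[OF Q] by auto
      next
        case nN: False
        have lt: "N < s" "{#d#} < s" using s nN by auto
        obtain B where B: "B \<subseteq> A" "\<And>x y. x \<in> B \<Longrightarrow> y \<in> A \<Longrightarrow> le y x \<Longrightarrow> y \<in> B" "rk le B = N"
          using rk_downset[OF Q, of N] lt(1) less.prems(2) by (metis less_imp_le)
        \<comment> \<open>Subadditivity leaves rank at least \<open>{#d#}\<close> for the complement
          of \<open>B\<close>, after cancelling \<open>N\<close>.\<close>
        have "N + {#d#} \<le> N + rk le (A - B)"
          using rk_Un[OF Q B(1), of "A - B"] B(1,3) less.prems(2) s by (simp add: Un_absorb1)
        then have "{#d#} \<le> rk le (A - B)" by simp
        then obtain C where C: "C \<subseteq> A - B" "\<And>x y. x \<in> C \<Longrightarrow> y \<in> A - B \<Longrightarrow> le y x \<Longrightarrow> y \<in> C"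
            "rk le C = {#d#}"
          using rk_downset[OF swqo_subset[OF Q], of "A - B" "{#d#}"] by blast
        obtain f where f: "\<And>x y. x \<in> B \<Longrightarrow> y \<in> B \<Longrightarrow> le x y \<Longrightarrow> f x \<le> f y" "{..<N} \<subseteq> f ` B"
          using less.IH[OF lt(1) swqo_subset[OF Q B(1)] B(3)[symmetric]] unfolding attains_def by blast
        have "C \<subseteq> A" using C(1) by blast
        then obtain g where g: "\<And>x y. x \<in> C \<Longrightarrow> y \<in> C \<Longrightarrow> le x y \<Longrightarrow> g x \<le> g y" "{..<{#d#}} \<subseteq> g ` C"
          using less.IH[OF lt(2) swqo_subset[OF Q] C(3)[symmetric]] unfolding attains_def by blast
        \<comment> \<open>Truncation at \<open>N\<close> and at \<open>{#d#}\<close> keeps the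
          values on \<open>B\<close>, on \<open>C\<close> and on the rest in this order;
          \<open>B\<close> is downward closed in \<open>A\<close>, and \<open>C\<close> in what
          remains.\<close>
        define h where "h x = (if x \<in> B then min (f x) N else if x \<in> C then N + min (g x) {#d#} else s)" for x
        have "h x \<le> h y" if "x \<in> A" "y \<in> A" "le x y" for x y
        proof -
          have "N \<le> N + min (g y) {#d#}" by simp
          then have 1: "min (f x) N \<le> N + min (g y) {#d#}" by (meson min.cobounded2 order_trans)
          have 2: "min (f x) N \<le> s" using lt(1) by (meson less_imp_le min.cobounded2 order_trans)
          have 3: "N + min (g x) {#d#} \<le> s" unfolding s by (rule add_left_mono) (rule min.cobounded2)
          show ?thesis
            using that B(2)[of y x] C(2)[of y x] f(1)[of x y] g(1)[of x y] 1 2 3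
              min.mono[of "f x" "f y" N N] min.mono[of "g x" "g y" "{#d#}" "{#d#}"]
            unfolding h_def by (auto simp del: mset_le_single_right_iff min.bounded_iff)
        qed
        moreover have "c \<in> h ` A" if cs: "c < s" for c
        proof (cases "c < N")
          case True
          then obtain x where "x \<in> B" "f x = c" using f(2) by blast
          then have "x \<in> A" "h x = c" using True B(1) unfolding h_def by auto
          then show ?thesis by blast
        next
          case False
          then obtain j where j: "c = N + j" "j < {#d#}"
            using less_plus_single[of c N d] cs d s by (metis not_le)
          then obtain x where "x \<in> C" "g x = j" using g(2) by blast
          then have "x \<in> A" "h x = c" using j C(1) unfolding h_def by (auto simp: min_def)
          then show ?thesis by blast
        qed
        ultimately show ?thesis unfolding attains_def by (intro exI[of _ h]) auto
      qed
    qed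
  qed
  then show ?thesis using assms by blast
qed

text \<open>No \<open>e d\<close> with d < c is above \<open>e c\<close>, so the residual at
  \<open>e c\<close> contains the image of all ordinals below \<open>c\<close>, and ranks grow at
  least as fast as the ordinals.\<close>

lemma reflecting_le_rk:
  fixes e :: "'x ordinal \<Rightarrow> 'a"
  assumes Q: "swqo TYPE('x) le A" and e: "\<And>c. c < a \<Longrightarrow> e c \<in> A"
    and refl: "\<And>c d. c < a \<Longrightarrow> d < a \<Longrightarrow> le (e c) (e d) \<Longrightarrow> c \<le> d"
  shows "cnf a \<le> rk le A"
proof -
  have "cnf b \<le> rk le (e ` {..<b})" if "b \<le> a" for b
    using that
  proof (induction b rule: less_induct)
    case (less b)
    have sub: "swqo TYPE('x) le (e ` {..<b})"
      by (rule swqo_subset[OF Q]) (use e less.prems in auto)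
    show ?case
    proof (rule cnf_least)
      fix c assume c: "c < b"
      have "\<not> le (e c) (e d)" if "d < c" for d
        using refl[of c d] that c less.prems by (meson leD less_le_trans less_trans)
      then have "e ` {..<c} \<subseteq> left le (e ` {..<b}) (e c)" using less_trans[OF _ c] by blast
      then have "rk le (e ` {..<c}) \<le> (rk le (left le (e ` {..<b}) (e c)) :: 'x ordinal multiset)"
        by (intro rk_mono swqo_subset[OF sub]) auto
      also have "\<dots> < rk le (e ` {..<b})" by (rule rk_left[OF sub]) (use c in blast)
      finally show "cnf c < rk le (e ` {..<b})"
        using less.IH[OF c] c less.prems by (meson le_less_trans less_imp_le order_trans)
    qed
  qed
  from this[of a] have "cnf a \<le> rk le (e ` {..<a})" by simp
  also have "\<dots> \<le> rk le A" by (rule rk_mono[OF Q]) (use e in auto)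
  finally show ?thesis .
qed

lemma linearization_le_rk:
  fixes F :: "'a \<Rightarrow> 'x ordinal"
  assumes Q: "swqo TYPE('x) le A" and L: "linearization A le L"
    and F: "\<And>x y. x \<in> A \<Longrightarrow> y \<in> A \<Longrightarrow> L x y \<longleftrightarrow> F x \<le> F y" "F ` A = {..<a}"
  shows "cnf a \<le> rk le A"
proof -
  have "\<exists>x. x \<in> A \<and> F x = c" if "c < a" for c using F(2) that by (metis imageE lessThan_iff)
  then obtain e where e: "\<And>c. c < a \<Longrightarrow> e c \<in> A \<and> F (e c) = c" by metis
  show ?thesis
  proof (rule reflecting_le_rk[OF Q])
    show "e c \<in> A" if "c < a" for c using e[OF that] by blast
    fix c d assume cd: "c < a" "d < a" "le (e c) (e d)"
    then have "L (e c) (e d)" using L e unfolding linearization_def by blast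
    then show "c \<le> d" using F(1) e cd by simp
  qed
qed

text \<open>The order of the values of \<open>f\<close>, pulled back, is a linearization. Since all
  values below the rank are hit, the position of \<open>x\<close> is at least \<open>f x\<close>, so
  its type cannot be too small.\<close>

lemma linearization_eq_rk:
  assumes Q: "swqo TYPE('x) le A"
  obtains L and F :: "'a \<Rightarrow> 'x ordinal" and a where "linearization A le L"
    "\<And>x y. x \<in> A \<Longrightarrow> y \<in> A \<Longrightarrow> L x y \<longleftrightarrow> F x \<le> F y" "F ` A = {..<a}" "rk le A = cnf a"
proof -
  obtain f :: "'a \<Rightarrow> 'x ordinal multiset" where
    f: "\<forall>x\<in>A. \<forall>y\<in>A. le x y \<longrightarrow> f x \<le> f y" "{..<rk le A} \<subseteq> f ` A"
    using de_Jongh_Parikh[OF Q] unfolding attains_def by (elim exE conjE) (rule that)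
  define L where "L x y \<longleftrightarrow> f x \<le> f y" for x y
  have L: "linearization A le L" unfolding linearization_def L_def using f(1) by auto
  obtain F :: "'a \<Rightarrow> 'x ordinal" and a where
    F: "\<And>x y. x \<in> A \<Longrightarrow> y \<in> A \<Longrightarrow> L x y \<longleftrightarrow> F x \<le> F y" "F ` A = {..<a}"
    by (rule linearization_collapse[OF Q L], rule that)
  have ge: "f x \<le> cnf (F x)" if "x \<in> A" "f x < rk le A" for x
    using that
  proof (induction "f x" arbitrary: x rule: less_induct)
    case less
    show ?case
    proof (rule ccontr)
      assume "\<not> f x \<le> cnf (F x)"
      then have lt: "cnf (F x) < f x" by simp
      then have "cnf (F x) \<in> f ` A" using f(2) less.prems(2) by (meson lessThan_iff less_trans subsetD)
      then obtain y where y: "y \<in> A" "f y = cnf (F x)" by auto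
      then have "f y \<le> cnf (F y)" using less.hyps[of y] lt less.prems by (metis less_trans)
      moreover have "\<not> L x y" unfolding L_def using y lt by simp
      ultimately show False using F(1)[OF less.prems(1) y(1)] y by simp
    qed
  qed
  have "rk le A \<le> cnf a"
  proof (rule ccontr)
    assume "\<not> rk le A \<le> cnf a"
    then have "cnf a \<in> {..<rk le A}" by simp
    then obtain x where x: "x \<in> A" "f x = cnf a" "cnf a < rk le A" using f(2) by fastforce
    then have "a \<le> F x" using ge[of x] by simp
    then show False using F(2) x(1) by (metis imageI leD lessThan_iff)
  qed
  moreover have "cnf a \<le> rk le A" by (rule linearization_le_rk[OF Q L F])
  ultimately show ?thesis using that[OF L F] by simp
qed

section \<open>Ranks and the definition of maximal order type\<close>

lemma lin_type_oseg:
  assumes L: "linearization A le L"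
    and F: "\<And>x y. x \<in> A \<Longrightarrow> y \<in> A \<Longrightarrow> L x y \<longleftrightarrow> F x \<le> F y" "F ` A = {..<a}"
  shows "lin_type A L =o oseg a"
proof -
  define G where "G c = {y \<in> A. F y = c}" for c
  have cls: "lin_cls A L x = G (F x)" if "x \<in> A" for x
    unfolding lin_cls_def G_def using F(1) that by fastforce
  have inj: "inj_on G (Field (oseg a))"
  proof (rule inj_onI)
    fix c d assume "c \<in> Field (oseg a)" "d \<in> Field (oseg a)" "G c = G d"
    moreover from this obtain x where "x \<in> A" "F x = c" using F(2) by (metis Field_oseg imageE)
    ultimately show "c = d" unfolding G_def by auto
  qed
  have "lin_type A L = dir_image (oseg a) G"
  proof (rule set_eqI)
    fix p
    have "p \<in> lin_type A L \<longleftrightarrow> (\<exists>x y. p = (G (F x), G (F y)) \<and> x \<in> A \<and> y \<in> A \<and> F x \<le> F y)"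
      unfolding lin_type_def mem_Collect_eq by (intro iff_exI) (auto simp: F(1) cls)
    also have "\<dots> \<longleftrightarrow> (\<exists>c d. p = (G c, G d) \<and> c \<in> F ` A \<and> d \<in> F ` A \<and> c \<le> d)" by auto
    also have "\<dots> \<longleftrightarrow> p \<in> dir_image (oseg a) G"
      unfolding F(2) dir_image_def oseg_def by (auto, metis le_less_trans)
    finally show "p \<in> lin_type A L \<longleftrightarrow> p \<in> dir_image (oseg a) G" .
  qed
  then show ?thesis using dir_image_ordIso[OF Well_order_oseg inj] ordIso_symmetric by metis
qed

lemma Well_order_Restr_oseg:
  assumes r: "Well_order r" and X: "X \<subseteq> Field r"
    and G: "\<And>x y. x \<in> X \<Longrightarrow> y \<in> X \<Longrightarrow> (x, y) \<in> r \<longleftrightarrow> G x \<le> G y" "G ` X = {..<c}"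
  shows "Restr r X =o oseg c"
proof -
  have wo: "Well_order (Restr r X)" by (rule Well_order_Restr[OF r])
  have F: "Field (Restr r X) = X" using Refl_Field_Restr2[OF _ X] r
    unfolding well_order_on_def linear_order_on_def partial_order_on_def preorder_on_def by blast
  have anti: "antisym r"
    using r unfolding well_order_on_def linear_order_on_def partial_order_on_def by blast
  have "inj_on G X" by (rule inj_onI) (metis G(1) anti antisymD order_refl)
  then show ?thesis by (intro ordIso_osegI[of G] wo) (auto simp: F bij_betw_def G)
qed

lemma underS_oseg:
  assumes r: "Well_order r" and G: "bij_betw G (Field r) {..<a}"
    "\<And>x y. x \<in> Field r \<Longrightarrow> y \<in> Field r \<Longrightarrow> (x, y) \<in> r \<longleftrightarrow> G x \<le> G y" and x: "x \<in> Field r"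
  shows "Restr r (underS r x) =o oseg (G x)"
proof (rule Well_order_Restr_oseg[OF r])
  show sub: "underS r x \<subseteq> Field r" by (auto simp: underS_def Field_def)
  show "(y, z) \<in> r \<longleftrightarrow> G y \<le> G z" if "y \<in> underS r x" "z \<in> underS r x" for y z
    using G(2) sub that by blast
  show "G ` underS r x = {..<G x}"
  proof (intro equalityI subsetI)
    fix c assume "c \<in> G ` underS r x"
    then obtain y where "y \<in> underS r x" "c = G y" by blast
    then show "c \<in> {..<G x}" using G sub x unfolding underS_def bij_betw_def
      by (auto simp: inj_on_def order_le_less subset_iff)
  next
    fix c assume c: "c \<in> {..<G x}"
    moreover have "G x < a" using G(1) x unfolding bij_betw_def by blast
    ultimately have "c \<in> G ` Field r" using G(1) unfolding bij_betw_def by auto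
    then obtain y where y: "y \<in> Field r" "c = G y" by blast
    then have "y \<in> underS r x" using c G(2)[OF y(1) x] unfolding underS_def by auto
    then show "c \<in> G ` underS r x" using y by blast
  qed
qed

lemma underS_Restr_ordLess:
  assumes r: "Well_order r" and x: "x \<in> Field r"
  shows "Restr r (underS r x) <o r"
proof -
  have "wo_rel r" using r by (simp add: wo_rel_def)
  then have "wo_rel.ofilter r (underS r x)" by (rule wo_rel.underS_ofilter)
  moreover have "underS r x \<subset> Field r" using x by (auto simp: underS_def Field_def)
  ultimately show ?thesis using ofilter_ordLess[OF r] by blast
qed

text \<open>One inequality comes from a linearization whose type is the rank; for the other, each
  ordinal below \<open>a\<close> is exceeded by the type of some linearization, which the rank
  bounds.\<close>

lemma max_order_type_rk:
  fixes a :: "'x ordinal"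
  assumes Q: "swqo TYPE('x) le A" and m: "is_max_order_type A le r" and r: "r =o oseg a"
  shows "rk le A = cnf a"
proof (rule antisym)
  obtain L and F :: "'a \<Rightarrow> 'x ordinal" and b where L: "linearization A le L"
    "\<And>x y. x \<in> A \<Longrightarrow> y \<in> A \<Longrightarrow> L x y \<longleftrightarrow> F x \<le> F y" "F ` A = {..<b}" "rk le A = cnf b"
    by (rule linearization_eq_rk[OF Q], rule that)
  have "lin_type A L \<le>o r" using m L(1) unfolding is_max_order_type_def by blast
  then have "oseg b \<le>o oseg a"
    using r lin_type_oseg[OF L(1-3)] ordIso_symmetric ordIso_ordLeq_trans ordLeq_ordIso_trans by blast
  then show "rk le A \<le> cnf a" using L(4) by (simp add: oseg_le_iff)
  obtain G where G: "bij_betw G (Field r) {..<a}"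
    "\<And>x y. x \<in> Field r \<Longrightarrow> y \<in> Field r \<Longrightarrow> (x, y) \<in> r \<longleftrightarrow> G x \<le> G y"
    by (rule ordIso_osegE[OF r], rule that)
  show "cnf a \<le> rk le A"
  proof (rule cnf_least)
    fix c assume "c < a"
    then obtain x where x: "x \<in> Field r" "G x = c" using G(1) by (metis bij_betw_def imageE lessThan_iff)
    obtain L where L: "linearization A le L" "Restr r (underS r x) <o lin_type A L"
      using m x(1) unfolding is_max_order_type_def by blast
    obtain F :: "'a \<Rightarrow> 'x ordinal" and b where
      F: "\<And>x y. x \<in> A \<Longrightarrow> y \<in> A \<Longrightarrow> L x y \<longleftrightarrow> F x \<le> F y" "F ` A = {..<b}"
      by (rule linearization_collapse[OF Q L(1)], rule that)
    have "Restr r (underS r x) =o oseg c" using underS_oseg[OF _ G x(1)] m x(2) unfolding is_max_order_type_def by blast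
    then have "oseg c <o oseg b"
      using L(2) lin_type_oseg[OF L(1) F] ordIso_symmetric ordIso_ordLess_trans ordLess_ordIso_trans by blast
    then have "c < b" by (simp add: oseg_less_iff)
    then show "cnf c < rk le A" using linearization_le_rk[OF Q L(1) F] by (meson cnf_strict less_le_trans)
  qed
qed

text \<open>The supremum is attained, so the single linearization of
  \<open>linearization_eq_rk\<close> serves for every proper initial segment.\<close>

lemma rk_max_order_type:
  fixes a :: "'x ordinal"
  assumes Q: "swqo TYPE('x) le A" and r: "Well_order r" "r =o oseg a" and rk: "rk le A = cnf a"
  shows "is_max_order_type A le r"
  unfolding is_max_order_type_def
proof (intro conjI allI impI ballI r(1))
  fix L assume L: "linearization A le L"
  obtain F :: "'a \<Rightarrow> 'x ordinal" and b where
    F: "\<And>x y. x \<in> A \<Longrightarrow> y \<in> A \<Longrightarrow> L x y \<longleftrightarrow> F x \<le> F y" "F ` A = {..<b}"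
    by (rule linearization_collapse[OF Q L], rule that)
  have "b \<le> a" using linearization_le_rk[OF Q L F] rk by simp
  then have "oseg b \<le>o oseg a" by (simp add: oseg_le_iff)
  then show "lin_type A L \<le>o r"
    using r(2) lin_type_oseg[OF L F] ordIso_symmetric ordIso_ordLeq_trans ordLeq_ordIso_trans by blast
next
  fix x assume x: "x \<in> Field r"
  obtain L and F :: "'a \<Rightarrow> 'x ordinal" and b where L: "linearization A le L"
    "\<And>x y. x \<in> A \<Longrightarrow> y \<in> A \<Longrightarrow> L x y \<longleftrightarrow> F x \<le> F y" "F ` A = {..<b}" "rk le A = cnf b"
    by (rule linearization_eq_rk[OF Q], rule that)
  then have "a = b" using rk by simp
  then have "r =o lin_type A L"
    using r(2) lin_type_oseg[OF L(1-3)] ordIso_symmetric ordIso_transitive by blast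
  moreover have "Restr r (underS r x) <o r" using underS_Restr_ordLess[OF r(1)] x by blast
  ultimately show "\<exists>L. linearization A le L \<and> Restr r (underS r x) <o lin_type A L"
    using L(1) ordLess_ordIso_trans by blast
qed


subsection \<open>Upper bound for trees\<close>

inductive_simps tree_le_simps [simp]:
  "tree_le le (Leaf x) (Leaf y)"
  "tree_le le (Leaf x) (Node ts)"
  "tree_le le (Node ss) (Leaf y)"
  "tree_le le (Node ss) (Node ts)"

inductive_simps ftrees_simps [simp]:
  "Leaf x \<in> ftrees A"
  "Node ts \<in> ftrees A"

lemma tree_le_refl: "(\<And>x. x \<in> A \<Longrightarrow> le x x) \<Longrightarrow> t \<in> ftrees A \<Longrightarrow> tree_le le t t"
  by (rotate_tac, induction rule: ftrees.induct) auto

lemma tree_le_trans: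
  assumes tr: "\<And>x y z. x \<in> A \<Longrightarrow> y \<in> A \<Longrightarrow> z \<in> A \<Longrightarrow> le x y \<Longrightarrow> le y z \<Longrightarrow> le x z"
  shows "u \<in> ftrees A \<Longrightarrow> s \<in> ftrees A \<Longrightarrow> t \<in> ftrees A \<Longrightarrow>
    tree_le le s t \<Longrightarrow> tree_le le t u \<Longrightarrow> tree_le le s u"
proof (induction u arbitrary: s t rule: ftrees.induct)
  case (leaf x)
  then obtain y z where "t = Leaf y" "s = Leaf z" by (cases s; cases t) auto
  then show ?case using leaf tr[of z y x] by simp
next
  case (node us)
  show ?case
  proof (cases t)
    case (Leaf y)
    then obtain x where s: "s = Leaf x" using node.prems by (cases s) auto
    obtain u where "u |\<in>| us" "tree_le le (Leaf y) u" using node.prems(4) Leaf by auto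
    then show ?thesis using node.IH[of u "Leaf x" "Leaf y"] node.prems s Leaf by auto
  next
    case t: (Node ts)
    show ?thesis
    proof (cases s)
      case (Leaf x)
      then obtain t' where t': "t' |\<in>| ts" "tree_le le (Leaf x) t'" using t node.prems by auto
      then obtain u where "u |\<in>| us" "tree_le le t' u" using t node.prems by auto
      then show ?thesis using node.IH[of u "Leaf x" t'] t' t Leaf node.prems by auto
    next
      case (Node ss)
      have "\<exists>u. u |\<in>| us \<and> tree_le le s' u" if s': "s' |\<in>| ss" for s'
      proof -
        have "\<exists>t'. t' |\<in>| ts \<and> tree_le le s' t'" using t Node s' node.prems(3) by simp
        then obtain t' where t': "t' |\<in>| ts" "tree_le le s' t'" by blast
        then have "\<exists>u. u |\<in>| us \<and> tree_le le t' u" using t node.prems(4) by simp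
        then obtain u where "u |\<in>| us" "tree_le le t' u" by blast
        then show ?thesis using node.IH[of u s' t'] t' t Node s' node.prems by auto
      qed
      then show ?thesis using Node by simp
    qed
  qed
qed

primrec height :: "'a ftree \<Rightarrow> nat" where
  "height (Leaf x) = 0"
| "height (Node ts) = Suc (Max (insert 0 (fset (height |`| ts))))"

lemma height_child: "t |\<in>| ts \<Longrightarrow> height t < height (Node ts)"
  by (simp add: less_Suc_eq_le)

lemma height_Node: "ts \<noteq> {||} \<Longrightarrow> \<exists>t. t |\<in>| ts \<and> height (Node ts) = Suc (height t)"
proof -
  assume "ts \<noteq> {||}"
  then have ne: "height ` fset ts \<noteq> {}" by auto
  then have "Max (insert 0 (height ` fset ts)) = Max (height ` fset ts)"
    by (subst Max_insert) auto
  moreover have "Max (height ` fset ts) \<in> height ` fset ts" by (rule Max_in) (use ne in auto)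
  ultimately show ?thesis by auto
qed

lemma tree_le_height: "tree_le le s t \<Longrightarrow> height s \<le> height t"
proof (induction rule: tree_le.induct)
  case (node_node ss ts)
  have "height s \<le> Max (insert 0 (height ` fset ts))" if s: "s |\<in>| ss" for s
  proof -
    obtain t where "t |\<in>| ts" "height s \<le> height t" using node_node[OF s] by blast
    then show ?thesis by (meson Max_ge finite_fset finite_imageI finite_insert imageI insertI2 order_trans)
  qed
  then show ?case by simp
qed auto

lemma rkle_image:
  assumes "rkle le A c" "\<And>x y. x \<in> A \<Longrightarrow> y \<in> A \<Longrightarrow> le x y \<Longrightarrow> le' (f x) (f y)"
  shows "rkle le' (f ` A) c"
  using assms
proof (induction c arbitrary: A rule: less_induct)
  case (less c)
  show ?case
  proof (rule rkleI, rule ballI)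
    fix y assume "y \<in> f ` A"
    then obtain x where x: "x \<in> A" "y = f x" by blast
    obtain c' where c': "c' < c" "rkle le (left le A x) c'"
      using rkle_left[OF less.prems(1) x(1)] by blast
    have "rkle le' (f ` left le A x) c'" using less.IH[OF c'] less.prems(2) by simp
    moreover have "left le' (f ` A) y \<subseteq> f ` left le A x" using less.prems(2) x by blast
    ultimately show "\<exists>c'<c. rkle le' (left le' (f ` A) y) c'" using c'(1) rkle_mono by blast
  qed
qed

text \<open>Everything in the residual at \<open>x\<close> has a smaller value than
  \<open>h x\<close>, so \<open>h\<close> itself supplies the bounds.\<close>

lemma rkle_map:
  assumes "\<And>x. x \<in> A \<Longrightarrow> h x < d" "\<And>x y. x \<in> A \<Longrightarrow> y \<in> A \<Longrightarrow> h x \<le> h y \<Longrightarrow> le x y"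
  shows "rkle le A d"
  using assms
proof (induction d arbitrary: A rule: less_induct)
  case (less d)
  show ?case
  proof (rule rkleI, rule ballI)
    fix x assume x: "x \<in> A"
    have "h y < h x" if "y \<in> left le A x" for y
      using that x less.prems(2)[of x y] by force
    then have "rkle le (left le A x) (h x)"
      by (intro less.IH less.prems(1)[OF x]) (use less.prems(2) in auto)
    then show "\<exists>c<d. rkle le (left le A x) c" using less.prems(1)[OF x] by blast
  qed
qed

text \<open>The residual at \<open>Node us\<close> is covered by finitely many families, one for
  each \<open>u\<close> in \<open>us\<close>, built over a residual of \<open>X\<close>. By
  induction each lies below \<open>{#c#}\<close>, and so does their natural sum.\<close>

lemma rkle_Nodes:
  assumes "rkle (tree_le le) X (cnf c)"
  shows "rkle (tree_le le) {Node us | us. fset us \<subseteq> X} {#c#}"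
  using assms
proof (induction c arbitrary: X rule: less_induct)
  case (less c)
  show ?case
  proof (rule rkleI, rule ballI)
    fix t assume "t \<in> {Node us | us. fset us \<subseteq> X}"
    then obtain us where us: "t = Node us" "fset us \<subseteq> X" by blast
    let ?B = "\<lambda>u. {Node vs | vs. fset vs \<subseteq> left (tree_le le) X u}"
    have "\<exists>d<{#c#}. rkle (tree_le le) (?B u) d" if u: "u \<in> fset us" for u
    proof -
      have "u \<in> X" using u us(2) by blast
      then obtain d where d: "d < cnf c" "rkle (tree_le le) (left (tree_le le) X u) d"
        using rkle_left[OF less.prems] by blast
      then obtain c' where "c' < c" "d = cnf c'" using cnf_onto by blast
      then show ?thesis using less.IH[of c' "left (tree_le le) X u"] d(2)
        by (intro exI[of _ "{#c'#}"] conjI) (simp, blast)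
    qed
    then obtain d where d: "d < {#c#}" "rkle (tree_le le) (\<Union>u\<in>fset us. ?B u) d"
      using rkle_finite_UN[of "fset us" c "tree_le le" ?B] by auto
    have "left (tree_le le) {Node us | us. fset us \<subseteq> X} t \<subseteq> (\<Union>u\<in>fset us. ?B u)"
      unfolding us(1) by auto blast
    then show "\<exists>d<{#c#}. rkle (tree_le le) (left (tree_le le) {Node us | us. fset us \<subseteq> X} t) d"
      using rkle_mono[OF d(2) _ order_refl] d(1) by blast
  qed
qed

lemma not_Leaf_le: "s \<in> ftrees A \<Longrightarrow> \<not> tree_le le (Leaf q) s \<Longrightarrow> s \<in> ftrees (left le A q)"
  by (induction rule: ftrees.induct) auto

text \<open>Residuals of nodes cost one exponential, c to \<open>\<omega>\<^sup>c\<close>, over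
  residuals of their children. Under an epsilon number \<open>b\<close> this stays below
  \<open>b\<close>, so an induction on the tree closes.\<close>

lemma rkle_ftrees_step:
  fixes a b :: "'x ordinal"
  assumes b: "eps b" and A: "rkle le A (cnf a)" and ab: "a < b"
    and left: "\<And>q. q \<in> A \<Longrightarrow> \<exists>c<{#b#}. rkle (tree_le le) (ftrees (left le A q)) c"
  shows "rkle (tree_le le) (ftrees A) {#b#}"
proof (rule rkleI, rule ballI)
  let ?T = "tree_le le"
  fix t assume "t \<in> ftrees A"
  then show "\<exists>c<{#b#}. rkle ?T (left ?T (ftrees A) t) c"
  proof (induction rule: ftrees.induct)
    case (leaf q)
    have "left ?T (ftrees A) (Leaf q) \<subseteq> ftrees (left le A q)"
      by (rule subsetI) (simp add: not_Leaf_le)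
    then show ?case using left[OF leaf] rkle_mono[OF _ _ order_refl] by blast
  next
    case (node ts)
    let ?B = "\<lambda>u. {Node vs | vs. fset vs \<subseteq> left ?T (ftrees A) u}"
    have "\<exists>d<{#b#}. rkle ?T (?B u) d" if u: "u \<in> fset ts" for u
    proof -
      obtain d where d: "d < {#b#}" "rkle ?T (left ?T (ftrees A) u) d" using node u by blast
      then obtain c where "c < b" "d = cnf c" using eps_onto[OF b] by blast
      then show ?thesis using rkle_Nodes[of le "left ?T (ftrees A) u" c] d(2)
        by (intro exI[of _ "{#c#}"] conjI) (simp, blast)
    qed
    then obtain d where d: "d < {#b#}" "rkle ?T (\<Union>u\<in>fset ts. ?B u) d"
      using rkle_finite_UN[of "fset ts" b ?T ?B] by auto
    \<comment> \<open>The leaves form a copy of \<open>A\<close> in every residual of a node; it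
      stays below \<open>b\<close> by \<open>a < b\<close>, the condition that leads to the bar on
      epsilon.\<close>
    have "rkle ?T (Leaf ` A) (cnf a)" by (rule rkle_image[OF A]) auto
    then have "rkle ?T (Leaf ` A \<union> (\<Union>u\<in>fset ts. ?B u)) (cnf a + d)" by (rule rkle_Un[OF _ d(2)])
    moreover have "left ?T (ftrees A) (Node ts) \<subseteq> Leaf ` A \<union> (\<Union>u\<in>fset ts. ?B u)"
    proof
      fix s assume "s \<in> left ?T (ftrees A) (Node ts)"
      then show "s \<in> Leaf ` A \<union> (\<Union>u\<in>fset ts. ?B u)" 
      proof (cases s)
        case (Node vs)
        then have "\<not> tree_le le (Node ts) (Node vs)" "\<forall>v. v |\<in>| vs \<longrightarrow> v \<in> ftrees A"
          using \<open>s \<in> _\<close> by auto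
        then obtain u where "u |\<in>| ts" "\<forall>v. v |\<in>| vs \<longrightarrow> \<not> tree_le le u v" by auto
        then have "s \<in> ?B u" "u \<in> fset ts" using \<open>\<forall>v. v |\<in>| vs \<longrightarrow> v \<in> ftrees A\<close> Node by auto
        then show ?thesis by blast
      qed auto
    qed
    ultimately have "rkle ?T (left ?T (ftrees A) (Node ts)) (cnf a + d)" using rkle_mono by blast
    moreover have "cnf a < {#b#}" using ab cnf_le_single by (metis le_less_trans mset_lt_single_iff)
    then have "cnf a + d < {#b#}" using d(1) by auto
    ultimately show ?case by blast
  qed
qed

text \<open>With all labels equivalent, a highest child of \<open>t\<close> dominates every child of
  \<open>s\<close>; so height decides, which explains g(1) = \<omega>.\<close>

lemma height_le_imp_tree_le:
  assumes eq: "\<And>x y. x \<in> A \<Longrightarrow> y \<in> A \<Longrightarrow> le x y"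
  shows "s \<in> ftrees A \<Longrightarrow> t \<in> ftrees A \<Longrightarrow> height s \<le> height t \<Longrightarrow> tree_le le s t"
proof (induction s arbitrary: t rule: ftrees.induct)
  case (leaf x)
  from leaf(2) show ?case
  proof (induction rule: ftrees.induct)
    case (node ts)
    then obtain t where "t |\<in>| ts" by auto
    then show ?case using node by auto
  qed (use leaf eq in auto)
next
  case (node ss)
  then obtain ts where t: "t = Node ts" by (cases t) auto
  then obtain u where u: "u |\<in>| ts" "height t = Suc (height u)"
    using node.prems(1) height_Node[of ts] by (metis ftrees_simps(2))
  have "tree_le le s u" if s: "s |\<in>| ss" for s
  proof (rule node.IH[OF s])
    show "u \<in> ftrees A" using u(1) t node.prems by auto
    show "height s \<le> height u" using height_child[OF s] u(2) node.prems(2) by linarith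
  qed
  then show ?case using u(1) t by auto
qed

lemma eps_two:
  assumes "eps (b :: 'x ordinal)"
  obtains z c where "z < c" "c < b"
proof -
  have "\<exists>z. z < b"
  proof (rule ccontr)
    assume "\<not> ?thesis"
    then have "cnf b \<le> {#}" by (intro cnf_least) blast
    then show False using assms unfolding eps_def by simp
  qed
  then obtain z where z: "z < b" by blast
  have "{#} < {#b#}" "{#z#} < {#b#}" using z by simp_all
  then obtain c0 c1 where c: "c0 < b" "cnf c0 = {#}" "c1 < b" "cnf c1 = {#z#}"
    using eps_onto[OF assms] by metis
  then have "cnf c0 < cnf c1" by simp
  then have "c0 < c1" by simp
  then show ?thesis using c that by blast
qed

text \<open>The recursion over residuals of Q, with its solution left open as an increasing choice
  \<open>h\<close> of epsilon numbers above their arguments. Ranks below two need a separate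
  bound.\<close>

lemma rkle_ftrees:
  fixes a b :: "'x ordinal"
  assumes "rkle le A (cnf a)" "eps b" "a < b"
    and "\<And>c. c < a \<Longrightarrow> \<exists>x y. x < y \<and> y < c \<Longrightarrow> eps (h c) \<and> c < h c \<and> h c < b"
    and "\<And>c d. c < d \<Longrightarrow> d < a \<Longrightarrow> \<exists>x y. x < y \<and> y < c \<Longrightarrow> h c < h d"
  shows "rkle (tree_le le) (ftrees A) {#b#}"
  using assms
proof (induction a arbitrary: A b rule: less_induct)
  case (less a)
  show ?case
  proof (rule rkle_ftrees_step[OF less.prems(2,1,3)])
    fix q assume "q \<in> A"
    then obtain d where "d < cnf a" "rkle le (left le A q) d"
      using rkle_left[OF less.prems(1)] by blast
    then obtain c where c: "c < a" "rkle le (left le A q) (cnf c)" using cnf_onto by blast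
    show "\<exists>d<{#b#}. rkle (tree_le le) (ftrees (left le A q)) d"
    proof (cases "\<exists>x y. x < y \<and> y < c")
      case True
      have h: "eps (h c)" "c < h c" "h c < b" using less.prems(4)[OF c(1) True] by auto
      have "rkle (tree_le le) (ftrees (left le A q)) {#h c#}"
        by (rule less.IH[OF c(1) c(2) h(1,2)])
          (use less.prems(4,5) c(1) in \<open>meson less_trans\<close>)+
      then show ?thesis using h(3) by (intro exI[of _ "{#h c#}"]) simp
    next
      case False
      \<comment> \<open>Here \<open>c\<close> is at most one. A failing pair would give two
        successive residuals with ranks descending below \<open>c\<close>.\<close>
      have eq: "le x y" if xy: "x \<in> left le A q" "y \<in> left le A q" for x y
      proof (rule ccontr)
        assume "\<not> le x y"
        obtain d1 where d1: "d1 < cnf c" "rkle le (left le (left le A q) x) d1"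
          using rkle_left[OF c(2) xy(1)] by blast
        have "y \<in> left le (left le A q) x" using xy \<open>\<not> le x y\<close> by blast
        then obtain d2 where d2: "d2 < d1" using rkle_left[OF d1(2)] by blast
        obtain e1 where e1: "e1 < c" "d1 = cnf e1" using cnf_onto[OF d1(1)] by blast
        then obtain e2 where "e2 < e1" using cnf_onto[of d2 e1] d2 by blast
        then show False using False e1(1) by blast
      qed
      obtain z d where zd: "z < d" "d < b" by (rule eps_two[OF less.prems(2)], rule that)
      \<comment> \<open>Height n is measured by the multiple n of \<open>\<omega>\<^sup>z\<close>,
        which stays below \<open>{#d#}\<close> because \<open>z < d\<close>.\<close>
      have "rkle (tree_le le) (ftrees (left le A q)) {#d#}"
      proof (rule rkle_map[where h = "\<lambda>t. replicate_mset (height t) z"])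
        show "replicate_mset (height t) z < {#d#}" for t :: "'a ftree" using zd(1) by auto
        fix s t assume st: "s \<in> ftrees (left le A q)" "t \<in> ftrees (left le A q)"
          "replicate_mset (height s) z \<le> replicate_mset (height t) z"
        have "height s \<le> height t"
        proof (rule ccontr)
          assume "\<not> height s \<le> height t"
          then have "replicate_mset (height t) z \<subset># replicate_mset (height s) z"
            by (auto simp: subset_mset.less_le replicate_mset_eq_iff subseteq_mset_def)
          then show False using subset_imp_less_mset st(3) by (metis leD)
        qed
        then show "tree_le le s t" by (intro height_le_imp_tree_le[of "left le A q" le] st eq)
      qed
      then show ?thesis using zd(2) by (intro exI[of _ "{#d#}"]) simp
    qed
  qed
qed

subsection \<open>Lower bound for trees\<close>

lemma less_mset_maxdiff:
  fixes M N :: "'o::linorder multiset"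
  assumes "M < N"
  obtains x where "count M x < count N x" "\<And>y. x < y \<Longrightarrow> count M y = count N y"
proof -
  let ?S = "{x. count M x \<noteq> count N x}"
  have "?S \<subseteq> set_mset M \<union> set_mset N" by (auto simp: not_in_iff)
  then have fin: "finite ?S" by (rule finite_subset) simp
  have "M \<noteq> N" using assms by blast
  then have ne: "?S \<noteq> {}" by (auto simp: multiset_eq_iff)
  define x where "x = Max ?S"
  have x: "count M x \<noteq> count N x" using Max_in[OF fin ne] unfolding x_def by simp
  have above: "count M y = count N y" if "x < y" for y
    using Max_ge[OF fin, of y] that unfolding x_def by fastforce
  have "\<not> count N x < count M x"
    using assms above unfolding less_multiset\<^sub>H\<^sub>O by (metis less_irrefl)
  then show ?thesis using x above that by (metis linorder_neqE)
qed

primrec stem :: "'a \<Rightarrow> nat \<Rightarrow> 'a ftree" where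
  "stem q 0 = Leaf q"
| "stem q (Suc n) = Node {|stem q n|}"

lemma height_stem [simp]: "height (stem q n) = n" by (induction n) auto

lemma set_stem [simp]: "set_ftree (stem q n) = {q}" by (induction n) auto

lemma stem_ftrees: "q \<in> A \<Longrightarrow> stem q n \<in> ftrees A" by (induction n) auto

lemma tree_le_leaves: "tree_le le s t \<Longrightarrow> x \<in> set_ftree s \<Longrightarrow> \<exists>y\<in>set_ftree t. le x y"
proof (induction rule: tree_le.induct)
  case (node_node ss ts)
  then show ?case by fastforce
qed auto

abbreviation upper_part :: "'o::linorder multiset \<Rightarrow> 'o \<Rightarrow> 'o multiset" where
  "upper_part M x \<equiv> {#y \<in># M. x \<le> y#}"

text \<open>The size term records multiplicities, as \<open>cnf_tree\<close> has one child for each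
  distinct exponent. The \<open>Max\<close> term makes it useless to fit a stem into a tree
  \<open>e y\<close> in place of the stem beside it.\<close>

definition stem_height :: "('o::linorder \<Rightarrow> 'a ftree) \<Rightarrow> 'o multiset \<Rightarrow> 'o \<Rightarrow> nat" where
  "stem_height e M x = Max ((\<lambda>y. height (e y)) ` set_mset (upper_part M x)) + size (upper_part M x)"

definition cnf_tree :: "'a \<Rightarrow> ('o::linorder \<Rightarrow> 'a ftree) \<Rightarrow> 'o multiset \<Rightarrow> 'a ftree" where
  "cnf_tree q e M = Node (Abs_fset ((\<lambda>x. Node {|e x, stem q (stem_height e M x)|}) ` set_mset M))"

lemma cnf_tree_children [simp]:
  "fset (Abs_fset ((\<lambda>x. Node {|e x, stem q (stem_height e M x)|}) ` set_mset M))
    = (\<lambda>x. Node {|e x, stem q (stem_height e M x)|}) ` set_mset M"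
  by (rule Abs_fset_inverse) simp

lemma cnf_tree_cong:
  assumes "\<And>x. x \<in># M \<Longrightarrow> e x = e' x"
  shows "cnf_tree q e M = cnf_tree q e' M"
proof -
  have "stem_height e M x = stem_height e' M x" for x
    unfolding stem_height_def using assms by (metis (no_types, lifting) filter_mset_eq_conv image_cong mem_Collect_eq set_mset_filter)
  then show ?thesis unfolding cnf_tree_def using assms by (metis (no_types, lifting) image_cong)
qed

text \<open>The stems separate normal forms: at the largest exponent \<open>x\<close> where \<open>M\<close> exceeds \<open>N\<close>, the stem
  of \<open>M\<close> is longer than every stem of \<open>N\<close> at an exponent \<open>\<ge> x\<close>, because both forms agree
  above \<open>x\<close>.\<close>
lemma cnf_tree_le_imp:
  assumes le: "tree_le le (cnf_tree q e M) (cnf_tree q e N)"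
    and refl: "\<And>x y. x \<in># M \<Longrightarrow> y \<in># N \<Longrightarrow> tree_le le (e x) (e y) \<Longrightarrow> x \<le> y"
    and leaf: "\<And>x. x \<in># M \<Longrightarrow> \<exists>l\<in>set_ftree (e x). \<not> le l q"
  shows "M \<le> N"
proof (rule ccontr)
  assume "\<not> M \<le> N"
  then have "N < M" by simp
  then obtain x where x: "count N x < count M x" "\<And>y. x < y \<Longrightarrow> count N y = count M y"
    by (rule less_mset_maxdiff) blast
  then have xM: "x \<in># M" by (metis count_greater_zero_iff gr_zeroI not_less_zero)
  let ?k = "stem_height e M x"
  obtain y where y: "y \<in># N"
    "tree_le le (Node {|e x, stem q ?k|}) (Node {|e y, stem q (stem_height e N y)|})"
    using le xM unfolding cnf_tree_def by auto
  let ?k' = "stem_height e N y"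
  \<comment> \<open>All leaves of a stem are \<open>q\<close>, while \<open>e x\<close> has a leaf
    that is not below \<open>q\<close>; so \<open>e x\<close> has to go into the other component
    \<open>e y\<close>.\<close>
  have "\<not> tree_le le (e x) (stem q ?k')" using tree_le_leaves leaf[OF xM] by fastforce
  then have "tree_le le (e x) (e y)" using y(2) by auto
  then have xy: "x \<le> y" using refl xM y(1) by blast
  have fin: "finite ((\<lambda>z. height (e z)) ` set_mset (upper_part K w))" for K w by simp
  have "height (e y) \<le> Max ((\<lambda>z. height (e z)) ` set_mset (upper_part N y))"
    by (rule Max_ge[OF fin]) (use y(1) in auto)
  \<comment> \<open>The stem may go into either component of the pair, but both have height at most
    \<open>?k'\<close>.\<close>
  moreover have "?k \<le> height (e y) \<or> ?k \<le> ?k'"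
  proof -
    have "tree_le le (stem q ?k) (e y) \<or> tree_le le (stem q ?k) (stem q ?k')" using y(2) by auto
    then show ?thesis using tree_le_height by (metis height_stem)
  qed
  ultimately have kk: "?k \<le> ?k'" unfolding stem_height_def[of e N y] by linarith
  have sub: "upper_part N y \<subseteq># upper_part N x"
    using xy by (auto simp: subseteq_mset_def)
  have sub2: "upper_part N x \<subset># upper_part M x"
  proof (rule subset_mset.le_neq_trans)
    show "upper_part N x \<subseteq># upper_part M x"
      using x by (auto simp: subseteq_mset_def order_le_less)
    show "upper_part N x \<noteq> upper_part M x"
      using x(1) by (metis (mono_tags, lifting) count_filter_mset less_irrefl order_refl)
  qed
  have "size (upper_part N y) < size (upper_part M x)"
    using size_mset_mono[OF sub] mset_subset_size[OF sub2] by linarith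
  moreover have "Max ((\<lambda>z. height (e z)) ` set_mset (upper_part N y))
      \<le> Max ((\<lambda>z. height (e z)) ` set_mset (upper_part M x))"
  proof (rule Max_mono[OF _ _ fin])
    have "set_mset (upper_part N y) \<subseteq> set_mset (upper_part M x)"
      using sub sub2 by (meson order_trans set_mset_mono subset_mset.less_imp_le)
    then show "(\<lambda>z. height (e z)) ` set_mset (upper_part N y) \<subseteq> (\<lambda>z. height (e z)) ` set_mset (upper_part M x)"
      by blast
    show "(\<lambda>z. height (e z)) ` set_mset (upper_part N y) \<noteq> {}" using y(1) by auto
  qed
  ultimately show False using kk unfolding stem_height_def by linarith
qed

text \<open>\<open>J\<close> contains the ordinals represented by leaves and \<open>j\<close> their
  labels; label \<open>z\<close> is kept for stems. \<open>C\<close> has at most one element, the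
  least ordinal outside \<open>J\<close>, which is represented by a node over one leaf. All others
  follow their normal form.\<close>

lemma le_rk_ftrees:
  fixes a b :: "'x ordinal" and J C :: "'x ordinal set"
  assumes T: "swqo TYPE('x) (tree_le le) (ftrees Q)"
    and q: "\<And>c. c < a \<Longrightarrow> q c \<in> Q" "\<And>c d. c < a \<Longrightarrow> d < a \<Longrightarrow> le (q c) (q d) \<Longrightarrow> c \<le> d"
    and j: "\<And>x. x \<in> J \<Longrightarrow> z < j x \<and> j x < a" "\<And>x y. x \<in> J \<Longrightarrow> y \<in> J \<Longrightarrow> j x \<le> j y \<Longrightarrow> x \<le> y"
    and J0: "x0 \<in> J" "\<And>x. x0 \<le> x"
    and C: "\<And>c x. c \<in> C \<Longrightarrow> x < c \<Longrightarrow> x \<in> J" "\<And>c. c \<in> C \<Longrightarrow> c \<notin> J"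
    and eps: "\<And>x. x < b \<Longrightarrow> eps x \<Longrightarrow> x \<in> J \<union> C"
  shows "cnf b \<le> rk (tree_le le) (ftrees Q)"
proof -
  define H where "H e x = (if x \<in> J then Leaf (q (j x)) else if x \<in> C then Node {|Leaf (q (j x0))|}
    else cnf_tree (q z) e (cnf x))" for e x
  define e where "e = wfrec {(x, y). x < y} H"
  \<comment> \<open>Epsilon numbers below \<open>b\<close> are in \<open>J\<close> or
    \<open>C\<close>, so the recursion through exponents is only used where it descends.\<close>
  have small: "y < x" if "x < b" "x \<notin> J" "x \<notin> C" "y \<in># cnf x" for x y
    using not_eps_cnf[of x y] eps that by blast
  have e: "e x = H e x" if "x < b" for x
  proof -
    have "e x = H (cut e {(x, y). x < y} x) x"
      unfolding e_def by (subst wfrec[OF wf]) simp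
    also have "\<dots> = H e x"
    proof (cases "x \<in> J \<or> x \<in> C")
      case False
      then have "cnf_tree (q z) (cut e {(x, y). x < y} x) (cnf x) = cnf_tree (q z) e (cnf x)"
        by (intro cnf_tree_cong) (use small[OF that] in \<open>auto simp: cut_def\<close>)
      then show ?thesis unfolding H_def by simp
    qed (auto simp: H_def)
    finally show ?thesis .
  qed
  have eJ: "e x = Leaf (q (j x))" if "x < b" "x \<in> J" for x using e[OF that(1)] that by (simp add: H_def)
  have eC: "e x = Node {|Leaf (q (j x0))|}" if "x < b" "x \<in> C" for x
    using e[OF that(1)] that C(2) by (auto simp: H_def)
  have eN: "e x = cnf_tree (q z) e (cnf x)" if "x < b" "x \<notin> J" "x \<notin> C" for x
    using e[OF that(1)] that by (simp add: H_def)
  \<comment> \<open>The ordinal zero is in \<open>J\<close>, so \<open>cnf_tree\<close> is never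
    asked for a node without children.\<close>
  have ne: "cnf x \<noteq> {#}" if "x \<notin> J" for x
  proof -
    have "x0 < x" using J0 that by (metis order_le_less)
    then show ?thesis using cnf_strict by fastforce
  qed
  have za: "z < a" using j(1)[OF J0(1)] by (meson less_trans)
  have tree: "e x \<in> ftrees Q" if "x < b" for x
    using that
  proof (induction x rule: less_induct)
    case (less x)
    consider "x \<in> J" | "x \<in> C" | "x \<notin> J" "x \<notin> C" by blast
    then show ?case
    proof cases
      case 1
      then show ?thesis using eJ less.prems q j by simp
    next
      case 2
      then show ?thesis using eC less.prems q j J0 by simp
    next
      case 3
      have IH: "e y \<in> ftrees Q" if "y \<in># cnf x" for y
        using less.IH[of y] small[OF less.prems 3 that] less_trans[OF _ less.prems] by blast
      let ?ch = "Abs_fset ((\<lambda>y. Node {|e y, stem (q z) (stem_height e (cnf x) y)|}) ` set_mset (cnf x))"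
      have "fset ?ch \<noteq> {}" unfolding cnf_tree_children using ne[OF 3(1)] by simp
      then have "?ch \<noteq> {||}" by (metis bot_fset.rep_eq)
      then show ?thesis unfolding eN[OF less.prems 3] cnf_tree_def
        using IH stem_ftrees[OF q(1)[OF za]] by auto
    qed
  qed
  \<comment> \<open>The first half bounds labels in \<open>e x\<close> by \<open>x\<close>, which
    settles comparisons with a leaf on the left. The second half gives a leaf that is not below the
    stem label, as \<open>cnf_tree_le_imp\<close> requires.\<close>
  have leaves: "(\<forall>l\<in>set_ftree (e x). l = q z \<or> (\<exists>y\<in>J. y \<le> x \<and> l = q (j y))) \<and>
      (\<exists>y\<in>J. q (j y) \<in> set_ftree (e x))" if "x < b" for x
    using that
  proof (induction x rule: less_induct)
    case (less x)
    consider "x \<in> J" | "x \<in> C" | "x \<notin> J" "x \<notin> C" by blast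
    then show ?case
    proof cases
      case 1
      then show ?thesis using eJ less.prems by auto
    next
      case 2
      then show ?thesis using eC less.prems J0 by auto
    next
      case 3
      have IH: "(\<forall>l\<in>set_ftree (e y). l = q z \<or> (\<exists>w\<in>J. w \<le> y \<and> l = q (j w))) \<and>
          (\<exists>w\<in>J. q (j w) \<in> set_ftree (e y))" "y < x" if "y \<in># cnf x" for y
        using less.IH[of y] small[OF less.prems 3 that] less_trans[OF _ less.prems] by blast+
      have set: "set_ftree (e x) = (\<Union>y\<in>set_mset (cnf x). set_ftree (e y) \<union> {q z})"
        unfolding eN[OF less.prems 3] cnf_tree_def by simp
      obtain y where y: "y \<in># cnf x" using ne[OF 3(1)] by (meson multiset_nonemptyE)
      show ?thesis
      proof
        show "\<exists>y\<in>J. q (j y) \<in> set_ftree (e x)" using IH(1)[OF y] y unfolding set by blast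
        show "\<forall>l\<in>set_ftree (e x). l = q z \<or> (\<exists>y\<in>J. y \<le> x \<and> l = q (j y))"
        proof
          fix l assume "l \<in> set_ftree (e x)"
          then obtain y where y: "y \<in># cnf x" "l \<in> set_ftree (e y) \<or> l = q z" unfolding set by blast
          then show "l = q z \<or> (\<exists>y\<in>J. y \<le> x \<and> l = q (j y))"
            using IH[OF y(1)] by (meson less_imp_le order_trans)
        qed
      qed
    qed
  qed
  have leaf: "\<exists>l\<in>set_ftree (e x). \<not> le l (q z)" if x: "x < b" for x
  proof -
    obtain y where y: "y \<in> J" "q (j y) \<in> set_ftree (e x)" using leaves[OF x] by blast
    then have "\<not> le (q (j y)) (q z)" using q(2)[of "j y" z] j(1)[of y] za by (meson leD)
    then show ?thesis using y by blast
  qed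
  have "x \<le> y" if "x < b" "y < b" "tree_le le (e x) (e y)" for x y
    using that
  proof (induction x arbitrary: y rule: less_induct)
    case (less x)
    consider "x \<in> J" | "x \<in> C" | "x \<notin> J" "x \<notin> C" by blast
    then show ?case
    proof cases
      case 1
      then have "e x = Leaf (q (j x))" using eJ less.prems by blast
      then obtain l where l: "l \<in> set_ftree (e y)" "le (q (j x)) l"
        using tree_le_leaves[OF less.prems(3), of "q (j x)"] by auto
      have "l \<noteq> q z"
      proof
        assume "l = q z"
        then have "j x \<le> z" using q(2)[of "j x" z] l(2) za j(1)[OF 1] by blast
        then show False using j(1)[OF 1] by (meson leD)
      qed
      then obtain w where w: "w \<in> J" "w \<le> y" "l = q (j w)" using leaves[OF less.prems(2)] l(1) by blast
      then have "j x \<le> j w" using q(2)[of "j x" "j w"] l(2) j(1) 1 by blast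
      then have "x \<le> w" using j(2) 1 w(1) by blast
      then show ?thesis using w(2) by simp
    next
      case 2
      have "y \<notin> J"
      proof
        assume "y \<in> J"
        then show False using eJ[OF less.prems(2)] eC[OF less.prems(1) 2] less.prems(3) by simp
      qed
      \<comment> \<open>Everything below a member of \<open>C\<close> is in \<open>J\<close>, so
        \<open>y\<close> outside \<open>J\<close> is at least \<open>x\<close>.\<close>
      then show ?thesis using C(1)[OF 2, of y] by fastforce
    next
      case 3
      note ex = eN[OF less.prems(1) 3]
      obtain w where w: "w \<in># cnf x" using ne[OF 3(1)] by (meson multiset_nonemptyE)
      have "y \<notin> J"
      proof
        assume "y \<in> J"
        then show False using eJ[OF less.prems(2)] ex less.prems(3) unfolding cnf_tree_def by simp
      qed
      moreover have "y \<notin> C"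
      proof
        assume "y \<in> C"
        then show False using eC[OF less.prems(2)] ex less.prems(3) w unfolding cnf_tree_def by auto
      qed
      ultimately have ey: "e y = cnf_tree (q z) e (cnf y)" and
        sy: "\<And>w. w \<in># cnf y \<Longrightarrow> w < y" using eN small less.prems(2) by blast+
      have "cnf x \<le> cnf y"
      proof (rule cnf_tree_le_imp)
        show "tree_le le (cnf_tree (q z) e (cnf x)) (cnf_tree (q z) e (cnf y))"
          using less.prems(3) ex ey by simp
        fix u assume u: "u \<in># cnf x"
        then have ux: "u < x" using small[OF less.prems(1) 3] by blast
        then have ub: "u < b" using less.prems(1) by simp
        then show "\<exists>l\<in>set_ftree (e u). \<not> le l (q z)" by (rule leaf)
        fix v assume "v \<in># cnf y" "tree_le le (e u) (e v)"
        then show "u \<le> v" using less.IH[OF ux ub, of v] sy[of v] less_trans[OF _ less.prems(2)] by blast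
      qed
      then show ?thesis by simp
    qed
  qed
  then show ?thesis by (intro reflecting_le_rk[OF T, of b e] tree)
qed

subsection \<open>Epsilon numbers\<close>

definition osuc :: "'x ordinal \<Rightarrow> 'x ordinal" where
  "osuc x = (LEAST y. x < y)"

lemma ordinal_gt_ex: "\<exists>y. x < (y :: 'x ordinal)"
  using small_bounded[of "{()}" "\<lambda>_. x"] by (auto simp: small_def inj_on_def)

lemma less_osuc [simp]: "x < osuc x"
  unfolding osuc_def by (rule LeastI_ex) (rule ordinal_gt_ex)

lemma le_osuc [simp]: "x \<le> osuc x"
  by (rule less_imp_le) simp

lemma osuc_le_iff [simp]: "osuc x \<le> y \<longleftrightarrow> x < y"
  by (metis Least_le less_le_trans less_osuc osuc_def)

lemma less_osuc_iff [simp]: "y < osuc x \<longleftrightarrow> y \<le> x"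
  by (metis not_le osuc_le_iff)

lemma osuc_less_iff [simp]: "osuc x < osuc y \<longleftrightarrow> x < y"
  by (metis less_osuc_iff osuc_le_iff)

text \<open>Epsilon numbers are limits: adding a further exponent to \<open>cnf x\<close> already
  exceeds it and stays below \<open>c\<close>.\<close>

lemma eps_osuc:
  assumes "eps c" "x < c"
  shows "osuc x < c"
proof -
  obtain z where z: "z < c" using assms by blast
  have "cnf x < {#c#}" using assms by (metis cnf_le_single le_less_trans mset_lt_single_iff)
  then have "add_mset z (cnf x) < {#c#}" using z by simp
  then obtain y where y: "y < c" "add_mset z (cnf x) = cnf y" using eps_onto[OF assms(1)] by blast
  have "cnf x < cnf y" unfolding y(2)[symmetric] by simp
  then show ?thesis using y(1) by (metis cnf_less_iff le_less_trans osuc_le_iff)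
qed

section \<open>Solving the rank recursion with epsilon numbers\<close>

definition ge_two :: "'x ordinal \<Rightarrow> bool" where
  "ge_two c \<longleftrightarrow> (\<exists>x y. x < y \<and> y < c)"

lemma ge_two_mono: "ge_two c \<Longrightarrow> c \<le> d \<Longrightarrow> ge_two d"
  unfolding ge_two_def by (meson less_le_trans)

lemma eps_ge_two: "eps c \<Longrightarrow> ge_two c"
  unfolding ge_two_def by (rule eps_two) blast+

lemma ge_two_osuc_osuc: "ge_two (osuc (osuc x))"
  unfolding ge_two_def by (meson less_osuc)

text \<open>\<open>en c\<close> is \<epsilon> with index -2 + c for c from two up to
  \<open>a\<close>: it is increasing and leaves out no epsilon number below
  \<open>en a\<close>.\<close>

definition eps_enum :: "'x ordinal \<Rightarrow> ('x ordinal \<Rightarrow> 'x ordinal) \<Rightarrow> bool" where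
  "eps_enum a en \<longleftrightarrow> ge_two a \<and> (\<forall>c. ge_two c \<and> c \<le> a \<longrightarrow> eps (en c)) \<and>
     (\<forall>c d. ge_two c \<and> c < d \<and> d \<le> a \<longrightarrow> en c < en d) \<and>
     (\<forall>e. eps e \<and> e < en a \<longrightarrow> (\<exists>c. ge_two c \<and> c < a \<and> en c = e))"

text \<open>The exceptional case of the bar. A fixed point c is an epsilon number, so -2 + c = c,
  and the index shift does not affect the condition.\<close>

definition fixed_near :: "('x ordinal \<Rightarrow> 'x ordinal) \<Rightarrow> 'x ordinal \<Rightarrow> bool" where
  "fixed_near en a \<longleftrightarrow> (\<exists>c. ge_two c \<and> c \<le> a \<and> en c = c \<and> finite {c..<a})"

text \<open>Says b = g(a) for a \<ge> 2. In the exceptional case \<open>b\<close> is the epsilon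
  number following \<open>en a\<close>, described from below so that \<open>en\<close> can end at
  \<open>a\<close>.\<close>

definition ebar_ord :: "'x ordinal \<Rightarrow> 'x ordinal \<Rightarrow> bool" where
  "ebar_ord a b \<longleftrightarrow> eps b \<and> (\<exists>en. eps_enum a en \<and>
     (if fixed_near en a then en a < b \<and> (\<forall>e. eps e \<and> e < b \<longrightarrow> e \<le> en a) else b = en a))"

lemma eps_enum_ge:
  assumes en: "eps_enum a en" and c: "ge_two c" "c \<le> a"
  shows "c \<le> en c"
  using c
proof (induction c rule: less_induct)
  case (less c)
  have e: "ge_two (en c)" using en less.prems eps_ge_two unfolding eps_enum_def by blast
  show ?case
  proof (rule ccontr)
    assume "\<not> c \<le> en c"
    then have lt: "en c < c" by simp
    then have "en c \<le> en (en c)" using less.IH[OF lt e] less.prems by simp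
    moreover have "en (en c) < en c" using en e lt less.prems unfolding eps_enum_def by blast
    ultimately show False by simp
  qed
qed

text \<open>Exceptional points come in runs closed under successor, so the shift by one, once begun,
  persists along the run.\<close>

lemma fixed_near_osuc:
  assumes "fixed_near en c"
  shows "fixed_near en (osuc c)"
proof -
  obtain d where d: "ge_two d" "d \<le> c" "en d = d" "finite {d..<c}"
    using assms unfolding fixed_near_def by blast
  have "{d..<osuc c} = insert c {d..<c}" using d(2) by auto
  then have "finite {d..<osuc c}" using d(4) by simp
  then show ?thesis using d unfolding fixed_near_def by (metis less_osuc less_imp_le order_trans)
qed

text \<open>Shows that g solves the recursion of \<open>rkle_ftrees\<close>: its values at smaller
  arguments are increasing, exceed their arguments and stay below \<open>b\<close>.\<close>

lemma rkle_ftrees_ebar: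
  assumes A: "rkle le A (cnf a)" and ab: "ebar_ord a b"
  shows "rkle (tree_le le) (ftrees A) {#b#}"
proof -
  obtain en where b: "eps b" and en: "eps_enum a en"
    and cases: "if fixed_near en a then en a < b \<and> (\<forall>e. eps e \<and> e < b \<longrightarrow> e \<le> en a) else b = en a"
    using ab unfolding ebar_ord_def by blast
  have eps: "eps (en c)" if "ge_two c" "c \<le> a" for c using en that unfolding eps_enum_def by blast
  have mono: "en c < en d" if "ge_two c" "c < d" "d \<le> a" for c d
    using en that unfolding eps_enum_def by blast
  have tw: "ge_two a" using en unfolding eps_enum_def by blast
  have ge: "c \<le> en c" if "ge_two c" "c \<le> a" for c by (rule eps_enum_ge[OF en that])
  \<comment> \<open>\<open>h\<close> is g below \<open>a\<close>; on a run after a fixed point the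
    next epsilon number is taken, as \<open>en c\<close> may equal \<open>c\<close>.\<close>
  define h where "h c = (if fixed_near en c then en (osuc c) else en c)" for c
  have hgt: "c < h c" if "c < a" "ge_two c" for c
  proof (cases "fixed_near en c")
    case True
    have "en c < en (osuc c)" by (rule mono) (use that in auto)
    moreover have "c \<le> en c" using ge that by simp
    ultimately show ?thesis unfolding h_def using True by simp
  next
    case False
    then have "en c \<noteq> c" using that unfolding fixed_near_def by auto
    moreover have "c \<le> en c" using ge that by simp
    ultimately show ?thesis unfolding h_def using False by simp
  qed
  have heps: "eps (h c)" if "c < a" "ge_two c" for c
    unfolding h_def using eps[of c] eps[of "osuc c"] that ge_two_mono[of c "osuc c"] by (simp add: less_imp_le)
  have hmono: "h c < h d" if cd: "c < d" "d < a" "ge_two c" for c d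
  proof -
    have twd: "ge_two d" using cd ge_two_mono by (meson less_imp_le)
    have d: "en d \<le> h d" unfolding h_def using mono[OF twd, of "osuc d"] cd by auto
    show ?thesis
    proof (cases "fixed_near en c")
      case True
      show ?thesis
      proof (cases "osuc c = d")
        case eq: True
        then have "h d = en (osuc d)" unfolding h_def using fixed_near_osuc[OF True] by simp
        moreover have "en d < en (osuc d)" using mono[OF twd] cd by simp
        ultimately show ?thesis unfolding h_def using True eq by simp
      next
        case False
        then have "osuc c < d" using cd(1) by (metis osuc_le_iff order_le_less)
        then have "en (osuc c) < en d"
          using mono[of "osuc c" d] cd ge_two_mono[OF cd(3), of "osuc c"] by (simp add: less_imp_le)
        then show ?thesis using d True unfolding h_def[of c] by simp
      qed
    next
      case False
      then show ?thesis using less_le_trans[OF mono[OF cd(3,1) less_imp_le[OF cd(2)]] d]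
        unfolding h_def[of c] by simp
    qed
  qed
  have hb: "h c < b" if c: "c < a" "ge_two c" for c
  proof (cases "fixed_near en a")
    case True
    have "h c \<le> en a"
    proof (cases "osuc c = a")
      case False
      then have "osuc c < a" using c by (metis osuc_le_iff order_le_less)
      then show ?thesis unfolding h_def
        using mono[of "osuc c" a] mono[of c a] c ge_two_mono[OF c(2), of "osuc c"] by auto
    qed (use mono[of c a] c in \<open>auto simp: h_def\<close>)
    moreover have "en a < b" using cases True by simp
    ultimately show ?thesis by (rule le_less_trans)
  next
    case False
    then have b: "b = en a" using cases by simp
    show ?thesis
    proof (cases "fixed_near en c")
      case True
      \<comment> \<open>The shifted value reaches \<open>en a\<close> only if \<open>a\<close> is
        the successor of \<open>c\<close>, but then \<open>a\<close> would be exceptional as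
        well.\<close>
      then have "osuc c \<noteq> a" using fixed_near_osuc False by blast
      then have "osuc c < a" using c by (metis osuc_le_iff order_le_less)
      then show ?thesis unfolding h_def b using True mono[of "osuc c" a] ge_two_mono[OF c(2), of "osuc c"] by simp
    next
      case nf: False
      then show ?thesis unfolding h_def b using mono[of c a] c by simp
    qed
  qed
  have "a < b"
  proof (cases "fixed_near en a")
    case True
    then have "en a < b" using cases by simp
    then show ?thesis using ge[OF tw order_refl] le_less_trans by blast
  next
    case False
    then have "en a \<noteq> a" using tw unfolding fixed_near_def by auto
    then show ?thesis using cases False ge[OF tw order_refl] by (simp add: order_le_less)
  qed
  then show ?thesis
    by (rule rkle_ftrees[OF A b, where h = h])
      (use hgt heps hmono hb in \<open>auto simp: ge_two_def\<close>)
qed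

text \<open>The absence of bad sequences of trees is read off the rank bound, in place of a minimal
  bad sequence argument.\<close>

lemma wqo_ftrees:
  assumes "wqo_on Q le" "rkle (tree_le le) (ftrees Q) c"
  shows "wqo_on (ftrees Q) (tree_le le)"
proof -
  have r: "le x x" if "x \<in> Q" for x using assms(1) that unfolding wqo_on_def by blast
  have t: "le x z" if "x \<in> Q" "y \<in> Q" "z \<in> Q" "le x y" "le y z" for x y z
    using assms(1) that unfolding wqo_on_def by blast
  show ?thesis unfolding wqo_on_def
  proof (intro conjI ballI impI)
    show "tree_le le s s" if "s \<in> ftrees Q" for s using tree_le_refl[OF r that] .
    show "tree_le le s w" if "s \<in> ftrees Q" "u \<in> ftrees Q" "w \<in> ftrees Q"
      "tree_le le s u" "tree_le le u w" for s u w
      using tree_le_trans[OF t that(3,1,2,4,5)] .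
    show "\<forall>f :: nat \<Rightarrow> 'a ftree. (\<forall>i. f i \<in> ftrees Q) \<longrightarrow> (\<exists>i j. i < j \<and> tree_le le (f i) (f j))"
      using rkle_good_on[OF assms(2)] unfolding good_on_def .
  qed
qed

lemma reflecting_ex:
  fixes a :: "'x ordinal"
  assumes Q: "swqo TYPE('x) le Q" and rk: "rk le Q = cnf a"
  obtains q where "\<And>c. c < a \<Longrightarrow> q c \<in> Q" "\<And>c d. c < a \<Longrightarrow> d < a \<Longrightarrow> le (q c) (q d) \<Longrightarrow> c \<le> d"
proof -
  obtain L and F :: "'a \<Rightarrow> 'x ordinal" and a' where L: "linearization Q le L"
    "\<And>x y. x \<in> Q \<Longrightarrow> y \<in> Q \<Longrightarrow> L x y \<longleftrightarrow> F x \<le> F y" "F ` Q = {..<a'}" "rk le Q = cnf a'"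
    by (rule linearization_eq_rk[OF Q], rule that)
  then have "a' = a" using rk by simp
  then have "\<exists>x. x \<in> Q \<and> F x = c" if "c < a" for c using L(3) that by (metis imageE lessThan_iff)
  then obtain q where q: "\<And>c. c < a \<Longrightarrow> q c \<in> Q \<and> F (q c) = c" by metis
  have "c \<le> d" if cd: "c < a" "d < a" "le (q c) (q d)" for c d
  proof -
    have "L (q c) (q d)" using L(1) q cd unfolding linearization_def by blast
    then show ?thesis using L(2)[of "q c" "q d"] q cd by simp
  qed
  then show ?thesis using q that by blast
qed

text \<open>The lower bound has to provide trees for the epsilon numbers below \<open>b\<close>, the
  ordinals that normal forms do not reduce to smaller ones. The labels are distributed differently
  in the two cases of the bar.\<close>

lemma rk_ftrees_ebar:
  fixes a b :: "'x ordinal"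
  assumes Q: "swqo TYPE('x) le Q" and rk: "rk le Q = cnf a" and ab: "ebar_ord a b"
    and T: "swqo TYPE('x) (tree_le le) (ftrees Q)"
  shows "rk (tree_le le) (ftrees Q) = cnf b"
proof (rule antisym)
  have b: "eps b" using ab unfolding ebar_ord_def by blast
  show "rk (tree_le le) (ftrees Q) \<le> cnf b"
    using rk_le[OF rkle_ftrees_ebar[OF _ ab]] rkle_rk[OF Q] rk b unfolding eps_def by metis
  obtain q where q: "\<And>c. c < a \<Longrightarrow> q c \<in> Q" "\<And>c d. c < a \<Longrightarrow> d < a \<Longrightarrow> le (q c) (q d) \<Longrightarrow> c \<le> d"
    by (rule reflecting_ex[OF Q rk], rule that)
  obtain en where en: "eps_enum a en"
    and cases: "if fixed_near en a then en a < b \<and> (\<forall>e. eps e \<and> e < b \<longrightarrow> e \<le> en a) else b = en a"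
    using ab unfolding ebar_ord_def by blast
  have epsen: "eps (en c)" if "ge_two c" "c \<le> a" for c using en that unfolding eps_enum_def by blast
  have mono: "en c < en d" if "ge_two c" "c < d" "d \<le> a" for c d
    using en that unfolding eps_enum_def by blast
  have onto: "\<exists>c. ge_two c \<and> c < a \<and> en c = e" if "eps e" "e < en a" for e
    using en that unfolding eps_enum_def by blast
  have tw: "ge_two a" using en unfolding eps_enum_def by blast
  define z :: "'x ordinal" where "z = (LEAST x. True)"
  have z: "z \<le> x" for x unfolding z_def by (rule Least_le) simp
  have zs: "osuc z < a"
  proof -
    obtain x y where "x < y" "y < a" using tw unfolding ge_two_def by blast
    then show ?thesis using z[of x] by (meson le_less_trans osuc_le_iff)
  qed
  have tw_gt: "osuc z < c" if c: "ge_two c" for c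
  proof -
    obtain x y where "x < y" "y < c" using c unfolding ge_two_def by blast
    then show ?thesis using z[of x] by (meson le_less_trans osuc_le_iff)
  qed
  show "cnf b \<le> rk (tree_le le) (ftrees Q)"
  proof (cases "fixed_near en a")
    case False
    then have b: "b = en a" using cases by simp
    \<comment> \<open>Label zero, \<open>z\<close>, is for stems, label one for the ordinal zero,
      and label c \<ge> 2 for the epsilon number \<open>en c\<close>: this is where two is
      subtracted.\<close>
    define J where "J = insert z {e. eps e \<and> e < b}"
    obtain k where k: "\<And>e. eps e \<Longrightarrow> e < b \<Longrightarrow> ge_two (k e) \<and> k e < a \<and> en (k e) = e"
      using onto unfolding b by metis
    have nz: "\<not> eps z"
    proof
      assume "eps z"
      then have "osuc z < z" using tw_gt eps_ge_two by blast
      then show False by (metis less_asym less_osuc)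
    qed
    define j where "j x = (if x = z then osuc z else k x)" for x
    show ?thesis
    proof (rule le_rk_ftrees[OF T q, where J = J and C = "{}" and z = z and ?x0.0 = z and j = j])
      fix x assume x: "x \<in> J"
      show "z < j x \<and> j x < a"
      proof (cases "x = z")
        case False
        then have "ge_two (k x)" "k x < a" using x k unfolding J_def by auto
        moreover have "z < k x" using tw_gt[OF \<open>ge_two (k x)\<close>] by (meson less_osuc less_trans)
        ultimately show ?thesis unfolding j_def using False by simp
      qed (use zs in \<open>simp add: j_def\<close>)
      fix y assume y: "y \<in> J" "j x \<le> j y"
      show "x \<le> y"
      proof (cases "x = z \<or> y = z")
        case True
        have "x = z" if "y = z"
        proof (rule ccontr)
          assume "x \<noteq> z"
          then have "osuc z < k x" using x k tw_gt unfolding J_def by auto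
          then show False using y(2) that \<open>x \<noteq> z\<close> unfolding j_def by (simp add: leD)
        qed
        then show ?thesis using True z by auto
      next
        case False
        then have "k x \<le> k y" using y unfolding j_def by simp
        then have "en (k x) \<le> en (k y)" using mono[of "k x" "k y"] x y k False unfolding J_def
          by (metis (no_types, lifting) insertE less_imp_le mem_Collect_eq order_le_less)
        then show ?thesis using x y k False unfolding J_def by auto
      qed
    qed (auto simp: J_def z)
  next
    case True
    then have b: "en a < b" "\<And>e. eps e \<Longrightarrow> e < b \<Longrightarrow> e \<le> en a" using cases by auto
    obtain c where c: "ge_two c" "c \<le> a" "en c = c" "finite {c..<a}"
      using True unfolding fixed_near_def by blast
    have epsc: "eps c" using epsen[of c] c by simp
    \<comment> \<open>As \<open>c\<close> itself receives no leaf, label \<open>w\<close> from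
      \<open>c\<close> on can serve the later number \<open>en (osuc w)\<close>. This gains one
      epsilon number, the step from \<open>en a\<close> to \<open>b\<close>.\<close>
    have "\<exists>w. c \<le> w \<and> w < a \<and> en (osuc w) = e" if e: "eps e" "e < b" "c < e" for e
    proof -
      have "e \<le> en a" using b(2) e by blast
      then obtain y where y: "ge_two y" "y \<le> a" "en y = e"
        using onto[of e] e tw by (metis order_le_less)
      have "c < y"
      proof (rule ccontr)
        assume "\<not> c < y"
        then have "en y \<le> en c" using mono[of y c] y c by (metis linorder_not_le not_less_iff_gr_or_eq order_le_less)
        then show False using y c e by (simp add: leD)
      qed
      \<comment> \<open>The predecessor of \<open>y\<close>; it exists because the interval from
        \<open>c\<close> to \<open>y\<close> is finite.\<close>
      define w where "w = Max {c..<y}"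
      have fin: "finite {c..<y}" by (rule finite_subset[OF _ c(4)]) (use y in auto)
      have ne: "{c..<y} \<noteq> {}" using \<open>c < y\<close> by auto
      have w: "c \<le> w" "w < y" using Max_in[OF fin ne] unfolding w_def by auto
      have "osuc w = y"
      proof (rule antisym)
        show "osuc w \<le> y" using w by simp
        show "y \<le> osuc w"
        proof (rule ccontr)
          assume "\<not> y \<le> osuc w"
          then have "osuc w \<in> {c..<y}" using w by (simp add: order_le_less_trans less_imp_le)
          then have "osuc w \<le> w" using Max_ge[OF fin] unfolding w_def by blast
          then show False by simp
        qed
      qed
      then show ?thesis using w y by (metis less_le_trans)
    qed
    then obtain k where k: "\<And>e. eps e \<Longrightarrow> e < b \<Longrightarrow> c < e \<Longrightarrow> c \<le> k e \<and> k e < a \<and> en (osuc (k e)) = e"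
      by metis
    \<comment> \<open>There are labels enough for all ordinals below \<open>c\<close> to be leaves;
      \<open>c\<close> is left over and is passed to \<open>C\<close>.\<close>
    define J where "J = {..<c} \<union> {e. eps e \<and> c < e \<and> e < b}"
    \<comment> \<open>The successor frees the least label for stems and stays below the limit
      \<open>c\<close>.\<close>
    define j where "j x = (if x < c then osuc x else k x)" for x
    have zc: "z < c" using tw_gt[OF c(1)] by (meson less_osuc less_trans)
    show ?thesis
    proof (rule le_rk_ftrees[OF T q, where J = J and C = "{c}" and z = z and ?x0.0 = z and j = j])
      fix x assume x: "x \<in> J"
      show "z < j x \<and> j x < a"
      proof (cases "x < c")
        case True
        then have "osuc x < a" using eps_osuc[OF epsc] c(2) by (meson less_le_trans)
        then show ?thesis unfolding j_def using True z[of x] by simp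
      next
        case False
        then have "c \<le> k x" "k x < a" using x k unfolding J_def by auto
        then show ?thesis unfolding j_def using False zc by simp
      qed
      fix y assume y: "y \<in> J" "j x \<le> j y"
      consider "x < c" "y < c" | "x < c" "\<not> y < c" | "\<not> x < c" "y < c" | "\<not> x < c" "\<not> y < c" by blast
      then show "x \<le> y"
      proof cases
        case 1
        then show ?thesis using y unfolding j_def by (simp add: leI)
      next
        case 3
        then have "c \<le> k x" using x k unfolding J_def by auto
        moreover have "osuc y < c" using eps_osuc[OF epsc 3(2)] .
        ultimately show ?thesis using y 3 unfolding j_def by simp
      next
        case 4
        then have kxy: "k x \<le> k y" using y unfolding j_def by simp
        have kx: "c \<le> k x" "k x < a" "en (osuc (k x)) = x" and ky: "k y < a" "en (osuc (k y)) = y"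
          using x y k 4 unfolding J_def by auto
        show ?thesis
        proof (cases "k x = k y")
          case False
          then have "osuc (k x) < osuc (k y)" using kxy by simp
          then have "en (osuc (k x)) < en (osuc (k y))"
            using mono ky(1) ge_two_mono[OF c(1), of "osuc (k x)"] kx(1)
            by (metis less_imp_le less_osuc order_trans osuc_le_iff)
          then show ?thesis unfolding kx(3) ky(2) by simp
        next
          case True
          then have "x = y" using kx(3) ky(2) by metis
          then show ?thesis by simp
        qed
      qed auto
    next
      fix x assume "x < b" "eps x"
      then show "x \<in> J \<union> {c}" unfolding J_def by auto
    next
      show "z \<in> J" unfolding J_def using zc by simp
      show "z \<le> x" for x by (rule z)
      show "x \<in> J" if "d \<in> {c}" "x < d" for d x using that unfolding J_def by simp
      show "d \<notin> J" if "d \<in> {c}" for d using that unfolding J_def by simp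
    qed
  qed
qed

section \<open>Relational epsilon numbers in terms of ordinals\<close>

definition mset_fun :: "'b set \<Rightarrow> ('b \<Rightarrow> 'o) \<Rightarrow> 'o multiset \<Rightarrow> 'b \<Rightarrow> nat" where
  "mset_fun A G M x = (if x \<in> A then count M (G x) else 0)"

text \<open>Reads a normal form as its coefficient function: \<open>rel_max\<close> picks the
  largest exponent of difference, which is where the multiset order decides.\<close>

lemma
  fixes G :: "'b \<Rightarrow> 'o::linorder"
  assumes r: "Well_order r" and G: "inj_on G (Field r)"
    "\<And>x y. x \<in> Field r \<Longrightarrow> y \<in> Field r \<Longrightarrow> (x, y) \<in> r \<longleftrightarrow> G x \<le> G y"
  shows mset_fun_bij: "bij_betw (mset_fun (Field r) G) {M. set_mset M \<subseteq> G ` Field r} (fsupp r)"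
    and mset_fun_omega_pow: "\<And>M N. set_mset M \<subseteq> G ` Field r \<Longrightarrow> set_mset N \<subseteq> G ` Field r \<Longrightarrow>
      (mset_fun (Field r) G M, mset_fun (Field r) G N) \<in> omega_pow r \<longleftrightarrow> M \<le> N"
proof -
  let ?P = "mset_fun (Field r) G"
  note inj = G(1)
  have fs: "?P M \<in> fsupp r" if "set_mset M \<subseteq> G ` Field r" for M
  proof -
    have "G ` {x. ?P M x \<noteq> 0} \<subseteq> set_mset M" by (auto simp: mset_fun_def split: if_splits)
    moreover have "inj_on G {x. ?P M x \<noteq> 0}"
      by (rule inj_on_subset[OF inj]) (auto simp: mset_fun_def split: if_splits)
    ultimately have "finite {x. ?P M x \<noteq> 0}" by (meson finite_imageD finite_set_mset finite_subset)
    then show ?thesis by (auto simp: fsupp_def mset_fun_def)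
  qed
  have cnt: "count M (G x) = ?P M x" if "x \<in> Field r" for M x using that by (simp add: mset_fun_def)
  have injP: "M = N" if "set_mset M \<subseteq> G ` Field r" "set_mset N \<subseteq> G ` Field r" "?P M = ?P N" for M N
  proof (rule multiset_eqI)
    fix c
    show "count M c = count N c"
    proof (cases "c \<in> G ` Field r")
      case True
      then obtain x where "x \<in> Field r" "c = G x" by blast
      then show ?thesis using cnt that(3) by metis
    next
      case False
      then have "c \<notin># M" "c \<notin># N" using that(1,2) by auto
      then show ?thesis by (simp add: not_in_iff)
    qed
  qed
  have surj: "\<exists>M. set_mset M \<subseteq> G ` Field r \<and> f = ?P M" if f: "f \<in> fsupp r" for f
  proof -
    let ?g = "\<lambda>c. if c \<in> G ` Field r then f (inv_into (Field r) G c) else 0"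
    have "{c. 0 < ?g c} \<subseteq> G ` {x. f x \<noteq> 0}"
    proof
      fix c assume "c \<in> {c. 0 < ?g c}"
      then have c: "c \<in> G ` Field r" "f (inv_into (Field r) G c) \<noteq> 0" by (auto split: if_splits)
      then have "G (inv_into (Field r) G c) = c" by (simp add: f_inv_into_f)
      moreover have "inv_into (Field r) G c \<in> {x. f x \<noteq> 0}" using c(2) by simp
      ultimately show "c \<in> G ` {x. f x \<noteq> 0}" by (metis imageI)
    qed
    moreover have "finite {x. f x \<noteq> 0}" using f by (simp add: fsupp_def)
    ultimately have fin: "finite {c. 0 < ?g c}" by (meson finite_imageI finite_subset)
    define M where "M = Abs_multiset ?g"
    have M: "count M = ?g" unfolding M_def by (rule count_Abs_multiset[OF fin])
    have "set_mset M \<subseteq> G ` Field r" by (auto simp: M not_in_iff[symmetric] count_greater_zero_iff[symmetric] split: if_splits)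
    moreover have "f = ?P M"
    proof
      fix x
      show "f x = ?P M x"
      proof (cases "x \<in> Field r")
        case True
        then show ?thesis using inj by (simp add: mset_fun_def M inv_into_f_f)
      next
        case False
        then show ?thesis using f by (simp add: mset_fun_def fsupp_def)
      qed
    qed
    ultimately show ?thesis by blast
  qed
  show "bij_betw ?P {M. set_mset M \<subseteq> G ` Field r} (fsupp r)"
    unfolding bij_betw_def
  proof
    show "inj_on ?P {M. set_mset M \<subseteq> G ` Field r}" by (rule inj_onI) (use injP in auto)
    show "?P ` {M. set_mset M \<subseteq> G ` Field r} = fsupp r"
    proof (intro equalityI subsetI)
      fix f assume "f \<in> fsupp r"
      then obtain M where "set_mset M \<subseteq> G ` Field r" "f = ?P M" using surj by metis
      then show "f \<in> ?P ` {M. set_mset M \<subseteq> G ` Field r}" by (intro image_eqI[of f ?P M]) simp_all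
    qed (use fs in auto)
  qed
  have anti: "antisym r"
    using r unfolding well_order_on_def linear_order_on_def partial_order_on_def by blast
  have less: "?P M (rel_max r {x. ?P M x \<noteq> ?P N x}) < ?P N (rel_max r {x. ?P M x \<noteq> ?P N x})"
    if MN: "M < N" "set_mset N \<subseteq> G ` Field r" for M N
  proof -
    obtain c where c: "count M c < count N c" "\<And>d. c < d \<Longrightarrow> count M d = count N d"
      by (rule less_mset_maxdiff[OF MN(1)], rule that)
    then have "c \<in># N" by (metis count_greater_zero_iff gr_zeroI not_less_zero)
    then obtain u where u: "u \<in> Field r" "c = G u" using MN(2) by blast
    have "rel_max r {x. ?P M x \<noteq> ?P N x} = u"
      unfolding rel_max_def
    proof (rule the_equality)
      have "(y, u) \<in> r" if y: "?P M y \<noteq> ?P N y" for y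
      proof -
        have yF: "y \<in> Field r" using y by (auto simp: mset_fun_def split: if_splits)
        then have "count M (G y) \<noteq> count N (G y)" using y cnt by simp
        then have "\<not> c < G y" using c(2) by blast
        then show ?thesis using G(2)[OF yF u(1)] u(2) by simp
      qed
      then show *: "u \<in> {x. ?P M x \<noteq> ?P N x} \<and> (\<forall>y\<in>{x. ?P M x \<noteq> ?P N x}. (y, u) \<in> r)"
        using c(1) u cnt by auto
      fix m assume "m \<in> {x. ?P M x \<noteq> ?P N x} \<and> (\<forall>y\<in>{x. ?P M x \<noteq> ?P N x}. (y, m) \<in> r)"
      then show "m = u" using * antisymD[OF anti] by blast
    qed
    then show ?thesis using c(1) u cnt by simp
  qed
  show "(?P M, ?P N) \<in> omega_pow r \<longleftrightarrow> M \<le> N" if MN: "set_mset M \<subseteq> G ` Field r" "set_mset N \<subseteq> G ` Field r" for M N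
  proof
    assume "M \<le> N"
    then show "(?P M, ?P N) \<in> omega_pow r"
      using fs MN less[of M N] unfolding omega_pow_def by (auto simp: order_le_less)
  next
    assume op: "(?P M, ?P N) \<in> omega_pow r"
    show "M \<le> N"
    proof (rule ccontr)
      assume "\<not> M \<le> N"
      then have lt: "N < M" by simp
      have eq: "{x. ?P M x \<noteq> ?P N x} = {x. ?P N x \<noteq> ?P M x}" by auto
      have "?P M \<noteq> ?P N" using injP[OF MN] lt by blast
      then have "?P M (rel_max r {x. ?P M x \<noteq> ?P N x}) < ?P N (rel_max r {x. ?P M x \<noteq> ?P N x})"
        using op unfolding omega_pow_def by auto
      then show False using less[OF lt MN(1)] unfolding eq by simp
    qed
  qed
qed

lemma Field_omega_pow: "Field (omega_pow r) = fsupp r"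
  unfolding omega_pow_def Field_def by auto

definition oiso :: "('x ordinal \<Rightarrow> 'x ordinal) \<Rightarrow> 'x ordinal set \<Rightarrow> 'x ordinal set \<Rightarrow> bool" where
  "oiso f A B \<longleftrightarrow> bij_betw f A B \<and> (\<forall>x\<in>A. \<forall>y\<in>A. x \<le> y \<longleftrightarrow> f x \<le> f y)"

lemma oiso_mem: "oiso f A B \<Longrightarrow> x \<in> A \<Longrightarrow> f x \<in> B"
  unfolding oiso_def bij_betw_def by blast

lemma oiso_less: "oiso f A B \<Longrightarrow> x \<in> A \<Longrightarrow> y \<in> A \<Longrightarrow> x < y \<longleftrightarrow> f x < f y"
  unfolding oiso_def by (metis not_le)

lemma oiso_onto: "oiso f A B \<Longrightarrow> y \<in> B \<Longrightarrow> \<exists>x\<in>A. f x = y"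
  unfolding oiso_def bij_betw_def by blast

lemma oiso_inv:
  assumes "oiso f A B"
  shows "oiso (inv_into A f) B A"
  unfolding oiso_def
proof (intro conjI ballI)
  have f: "bij_betw f A B" using assms oiso_def by blast
  then show b: "bij_betw (inv_into A f) B A" by (rule bij_betw_inv_into)
  fix x y assume "x \<in> B" "y \<in> B"
  moreover from this have "inv_into A f x \<in> A" "inv_into A f y \<in> A"
    using b unfolding bij_betw_def by auto
  moreover have "f (inv_into A f x) = x" "f (inv_into A f y) = y"
    using f \<open>x \<in> B\<close> \<open>y \<in> B\<close> by (auto simp: bij_betw_def f_inv_into_f)
  ultimately show "x \<le> y \<longleftrightarrow> inv_into A f x \<le> inv_into A f y"
    using assms unfolding oiso_def by metis
qed

lemma oiso_comp: "oiso f A B \<Longrightarrow> oiso g B C \<Longrightarrow> oiso (g \<circ> f) A C"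
  unfolding oiso_def bij_betw_def by (auto simp: image_comp intro: comp_inj_on)

text \<open>If \<open>a\<close> is not epsilon, \<open>cnf a\<close> is below \<open>{#a#}\<close>,
  and an isomorphism from \<open>omega_pow r\<close> would map the ordinals up to and including
  \<open>a\<close> increasingly into those below \<open>a\<close>. If it is, \<open>cnf\<close>
  provides the isomorphism.\<close>

lemma is_eps_point_iff:
  fixes a :: "'x ordinal"
  assumes r: "r =o oseg a"
  shows "is_eps_point r \<longleftrightarrow> eps a"
proof -
  have wo: "Well_order r" using r unfolding ordIso_def by blast
  obtain G where G: "bij_betw G (Field r) {..<a}"
    "\<And>x y. x \<in> Field r \<Longrightarrow> y \<in> Field r \<Longrightarrow> (x, y) \<in> r \<longleftrightarrow> G x \<le> G y"
    by (rule ordIso_osegE[OF r], rule that)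
  let ?P = "mset_fun (Field r) G"
  have inj: "inj_on G (Field r)" and im: "G ` Field r = {..<a}" using G(1) by (auto simp: bij_betw_def)
  have sub: "set_mset M \<subseteq> G ` Field r \<longleftrightarrow> M < {#a#}" for M unfolding im by auto
  have bij: "bij_betw ?P {M. M < {#a#}} (fsupp r)" using mset_fun_bij[OF wo inj G(2)] unfolding sub by simp
  have op: "(?P M, ?P N) \<in> omega_pow r \<longleftrightarrow> M \<le> N" if "M < {#a#}" "N < {#a#}" for M N
    by (rule mset_fun_omega_pow[OF wo inj G(2)]) (simp_all only: sub that)
  show ?thesis
  proof
    assume "is_eps_point r"
    then obtain f where f: "iso (omega_pow r) r f" unfolding is_eps_point_def ordIso_def by blast
    then have fb: "bij_betw f (fsupp r) (Field r)" and
      fo: "\<And>u v. u \<in> fsupp r \<Longrightarrow> v \<in> fsupp r \<Longrightarrow> (u, v) \<in> omega_pow r \<longleftrightarrow> (f u, f v) \<in> r"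
      unfolding iso_iff2 Field_omega_pow by blast+
    define g where "g M = G (f (?P M))" for M
    have Pm: "?P M \<in> fsupp r" if "M < {#a#}" for M using bij that unfolding bij_betw_def by blast
    have gm: "f (?P M) \<in> Field r" "g M < a" if "M < {#a#}" for M
      using Pm[OF that] fb G(1) unfolding bij_betw_def g_def by blast+
    have gle: "M \<le> N \<longleftrightarrow> g M \<le> g N" if "M < {#a#}" "N < {#a#}" for M N
      using op[OF that] fo[OF Pm Pm, OF that] G(2)[OF gm(1) gm(1), OF that] unfolding g_def by blast
    show "eps a"
    proof (rule ccontr)
      assume "\<not> eps a"
      then have lt: "cnf a < {#a#}" using cnf_le_single unfolding eps_def by (metis order_le_less)
      then have cl: "cnf c < {#a#}" if "c \<le> a" for c
        using that by (meson cnf_le_iff le_less_trans)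
      have mono: "g (cnf x) < g (cnf y)" if "x < y" "y \<le> a" for x y
        using gle[OF cl cl, of y x] that by (metis cnf_le_iff leD leI less_imp_le order_trans)
      have "g (cnf a) < a" using gm(2)[OF lt] .
      moreover from this have "g (cnf a) \<le> g (cnf (g (cnf a)))"
        by (intro strict_mono_ge[of a "\<lambda>x. g (cnf x)"]) (use mono in auto)
      ultimately show False using mono[of "g (cnf a)" a] by (simp add: leD)
    qed
  next
    assume a: "eps a"
    define f where "f c = ?P (cnf c)" for c
    have imc: "cnf ` {..<a} = {M. M < {#a#}}"
    proof -
      have "cnf c < {#a#}" if "c < a" for c
        using that cnf_strict[of c a] a unfolding eps_def by simp
      then show ?thesis using eps_onto[OF a] by fast
    qed
    have fb: "bij_betw f {..<a} (fsupp r)"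
    proof -
      have "bij_betw cnf {..<a} {M. M < {#a#}}"
        unfolding bij_betw_def using imc by (auto simp: inj_on_def)
      then have "bij_betw (?P \<circ> cnf) {..<a} (fsupp r)" using bij bij_betw_trans by blast
      then show ?thesis unfolding f_def comp_def .
    qed
    have "omega_pow r = dir_image (oseg a) f"
    proof (rule set_eqI, clarify)
      fix u v
      have iff: "(f c, f d) \<in> omega_pow r \<longleftrightarrow> c \<le> d" if "c < a" "d < a" for c d
        using op[of "cnf c" "cnf d"] imc that unfolding f_def by (metis cnf_le_iff imageI lessThan_iff mem_Collect_eq)
      have "u \<in> f ` {..<a} \<and> v \<in> f ` {..<a}" if "(u, v) \<in> omega_pow r"
        using that fb unfolding omega_pow_def bij_betw_def by blast
      then have "(u, v) \<in> omega_pow r \<longleftrightarrow> (\<exists>c<a. \<exists>d<a. u = f c \<and> v = f d \<and> c \<le> d)"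
        using iff by auto
      also have "\<dots> \<longleftrightarrow> (u, v) \<in> dir_image (oseg a) f"
        unfolding dir_image_def oseg_def using le_less_trans by blast
      finally show "(u, v) \<in> omega_pow r \<longleftrightarrow> (u, v) \<in> dir_image (oseg a) f" .
    qed
    moreover have "inj_on f (Field (oseg a))" using fb by (simp add: bij_betw_def)
    ultimately have "oseg a =o omega_pow r" using dir_image_ordIso[OF Well_order_oseg] by metis
    then show "is_eps_point r" unfolding is_eps_point_def
      using wo r by (meson ordIso_symmetric ordIso_transitive)
  qed
qed

lemma eps_below_oseg:
  fixes a :: "'x ordinal"
  assumes r: "Well_order r" and G: "bij_betw G (Field r) {..<a}"
    "\<And>x y. x \<in> Field r \<Longrightarrow> y \<in> Field r \<Longrightarrow> (x, y) \<in> r \<longleftrightarrow> G x \<le> G y"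
  shows "eps_below r = {x \<in> Field r. eps (G x)}" "G ` eps_below r = {e. e < a \<and> eps e}"
proof -
  show eb: "eps_below r = {x \<in> Field r. eps (G x)}"
    unfolding eps_below_def using is_eps_point_iff[OF underS_oseg[OF r G]] by blast
  show "G ` eps_below r = {e. e < a \<and> eps e}"
  proof (intro equalityI subsetI)
    fix e assume "e \<in> {e. e < a \<and> eps e}"
    moreover from this have "e \<in> G ` Field r" using G(1) by (auto simp: bij_betw_def)
    ultimately show "e \<in> G ` eps_below r" unfolding eb by blast
  qed (use eb G(1) in \<open>auto simp: bij_betw_def\<close>)
qed

abbreviation from_two :: "'x ordinal \<Rightarrow> 'x ordinal set" where
  "from_two c \<equiv> {x. x < c \<and> ge_two x}"

text \<open>The law -2 + c = c for epsilon numbers: taking two successors embeds a limit into its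
  part from two on. Either side may be the one known to be epsilon.\<close>

lemma from_two_type:
  assumes F: "oiso F (from_two c) {..<d}" and e: "eps c \<or> eps d"
  shows "d = c"
proof (rule antisym)
  show "d \<le> c"
  proof (rule strict_mono_le)
    show "inv_into (from_two c) F x < c" if "x < d" for x
      using oiso_mem[OF oiso_inv[OF F]] that by auto
    show "inv_into (from_two c) F x < inv_into (from_two c) F y" if "x < y" "y < d" for x y
      using oiso_less[OF oiso_inv[OF F], of x y] that by simp
  qed
  show "c \<le> d"
  proof (cases "eps c")
    case True
    have mem: "osuc (osuc x) \<in> from_two c" if "x < c" for x
      using eps_osuc[OF True] that ge_two_osuc_osuc by blast
    show ?thesis
    proof (rule strict_mono_le)
      show "F (osuc (osuc x)) < d" if "x < c" for x using oiso_mem[OF F mem[OF that]] by simp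
      show "F (osuc (osuc x)) < F (osuc (osuc y))" if "x < y" "y < c" for x y
        using oiso_less[OF F mem mem, of x y] that by simp
    qed
  next
    case False
    then have d: "eps d" using e by blast
    show ?thesis
    proof (rule ccontr)
      assume "\<not> c \<le> d"
      then have dc: "d < c" by simp
      have mem: "osuc (osuc x) \<in> from_two c" "osuc (osuc x) < d" if "x < d" for x
        using eps_osuc[OF d eps_osuc[OF d that]] ge_two_osuc_osuc less_trans[OF _ dc] by blast+
      have dmem: "d \<in> from_two c" using dc eps_ge_two[OF d] by blast
      then have y: "F d < d" using oiso_mem[OF F] by blast
      \<comment> \<open>An increasing map on \<open>d\<close> does not decrease arguments; yet two
        successors of \<open>F d\<close> are still below \<open>d\<close>, so \<open>F\<close> sends
        them below \<open>F d\<close>.\<close>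
      have "F d \<le> F (osuc (osuc (F d)))"
      proof (rule strict_mono_ge[of d "\<lambda>x. F (osuc (osuc x))"])
        show "F (osuc (osuc x)) < F (osuc (osuc y))" if "x < y" "y < d" for x y
          using oiso_less[OF F mem(1) mem(1), of x y] that by simp
      qed (rule y)
      moreover have "F (osuc (osuc (F d))) < F d"
        using oiso_less[OF F mem(1)[OF y] dmem] mem(2)[OF y] by blast
      ultimately show False by simp
    qed
  qed
qed

lemma from_two_shift:
  fixes c :: "'x ordinal"
  assumes "eps c"
  obtains F where "oiso F (from_two c) {..<c}"
proof -
  have sm: "small TYPE('x) (from_two c)" by (rule small_subset[OF small_lessThan[of c]]) auto
  have w: "wf {(y, x). y \<in> from_two c \<and> x \<in> from_two c \<and> \<not> x \<le> y}"
    by (rule wf_subset[OF wf]) auto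
  obtain F :: "'x ordinal \<Rightarrow> 'x ordinal" and d where
    F: "\<And>x y. x \<in> from_two c \<Longrightarrow> y \<in> from_two c \<Longrightarrow> x \<le> y \<longleftrightarrow> F x \<le> F y" "F ` from_two c = {..<d}"
    by (rule collapse[OF sm _ _ w]) (auto intro: that)
  have "inj_on F (from_two c)" by (rule inj_onI, rule antisym) (simp_all only: F(1) order_refl)
  then have "oiso F (from_two c) {..<d}" unfolding oiso_def bij_betw_def using F by blast
  then show ?thesis using that from_two_type assms by blast
qed

lemma Field_Restr_Well_order: "Well_order r \<Longrightarrow> X \<subseteq> Field r \<Longrightarrow> Field (Restr r X) = X"
  by (rule Refl_Field_Restr2)
    (auto simp: well_order_on_def linear_order_on_def partial_order_on_def preorder_on_def)

lemma Restr_order_iso: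
  fixes G :: "'b \<Rightarrow> 'x ordinal" and H :: "'c \<Rightarrow> 'x ordinal"
  assumes r: "Well_order r" "inj_on G (Field r)"
    "\<And>x y. x \<in> Field r \<Longrightarrow> y \<in> Field r \<Longrightarrow> (x, y) \<in> r \<longleftrightarrow> G x \<le> G y"
    and s: "Well_order s" "inj_on H (Field s)"
    "\<And>x y. x \<in> Field s \<Longrightarrow> y \<in> Field s \<Longrightarrow> (x, y) \<in> s \<longleftrightarrow> H x \<le> H y"
    and X: "X \<subseteq> Field r" and Y: "Y \<subseteq> Field s" and iso: "Restr s Y =o Restr r X"
  obtains k where "oiso k (G ` X) (H ` Y)"
proof -
  obtain f where "iso (Restr s Y) (Restr r X) f" using iso unfolding ordIso_def by blast
  then have f: "bij_betw f Y X" and fo: "\<And>x y. x \<in> Y \<Longrightarrow> y \<in> Y \<Longrightarrow> (x, y) \<in> s \<longleftrightarrow> (f x, f y) \<in> r"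
    unfolding iso_iff2 Field_Restr_Well_order[OF r(1) X] Field_Restr_Well_order[OF s(1) Y]
    by (auto simp: bij_betw_def)
  define k where "k = (\<lambda>c. G (f (inv_into Y H c)))"
  have injY: "inj_on H Y" and injX: "inj_on G X" using inj_on_subset r(2) s(2) X Y by blast+
  have kH: "k (H y) = G (f y)" if "y \<in> Y" for y unfolding k_def using inv_into_f_f[OF injY that] by simp
  have fX: "f y \<in> X" if "y \<in> Y" for y using f that unfolding bij_betw_def by blast
  have "oiso k (H ` Y) (G ` X)"
    unfolding oiso_def bij_betw_def
  proof (intro conjI ballI)
    show "inj_on k (H ` Y)"
    proof (rule inj_onI)
      fix x y assume "x \<in> H ` Y" "y \<in> H ` Y" "k x = k y"
      then obtain x' y' where x': "x' \<in> Y" "x = H x'" and y': "y' \<in> Y" "y = H y'"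
        and eq: "G (f x') = G (f y')" using kH by auto
      then have "f x' = f y'" using inj_onD[OF injX eq] fX by blast
      then show "x = y" using f x' y' unfolding bij_betw_def by (auto dest: inj_onD)
    qed
    have "k ` H ` Y = (\<lambda>y. G (f y)) ` Y" unfolding image_image using kH by (rule image_cong[OF refl])
    also have "\<dots> = G ` X" using f unfolding bij_betw_def by (metis image_image)
    finally show "k ` H ` Y = G ` X" .
    fix x y assume "x \<in> H ` Y" "y \<in> H ` Y"
    then obtain x' y' where x': "x' \<in> Y" "x = H x'" and y': "y' \<in> Y" "y = H y'" by blast
    then show "x \<le> y \<longleftrightarrow> k x \<le> k y"
      using kH fo s(3)[of x' y'] r(3)[of "f x'" "f y'"] fX X Y by (metis subsetD)
  qed
  then show ?thesis using oiso_inv that by blast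
qed

text \<open>The type of \<open>C\<close> is -2 + c = c. The shift \<open>F\<close> is applied twice:
  to the elements of \<open>C\<close>, and to the indices of the enumeration
  \<open>en\<close>.\<close>

lemma is_eps_selfI:
  fixes c :: "'x ordinal"
  assumes r: "Well_order r" "inj_on G (Field r)"
    "\<And>x y. x \<in> Field r \<Longrightarrow> y \<in> Field r \<Longrightarrow> (x, y) \<in> r \<longleftrightarrow> G x \<le> G y"
    and C: "C \<subseteq> Field r" "G ` C = from_two c" and c: "eps c"
    and en: "oiso en (from_two c) {e. e < c \<and> eps e}"
  shows "is_eps (Restr r C) (Restr r C)"
proof -
  obtain F where F: "oiso F (from_two c) {..<c}" using from_two_shift[OF c] by blast
  let ?d = "Restr r C"
  have wo: "Well_order ?d" by (rule Well_order_Restr[OF r(1)])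
  have Fd: "Field ?d = C" by (rule Field_Restr_Well_order[OF r(1) C(1)])
  define S where "S x = F (G x)" for x
  have Sim: "S ` C = {..<c}" using F C(2) unfolding S_def oiso_def bij_betw_def by (metis image_image)
  have So: "(x, y) \<in> ?d \<longleftrightarrow> S x \<le> S y" if "x \<in> C" "y \<in> C" for x y
  proof -
    have "G x \<in> from_two c" "G y \<in> from_two c" using that C(2) by blast+
    then have "G x \<le> G y \<longleftrightarrow> S x \<le> S y" using F unfolding S_def oiso_def by blast
    moreover have "(x, y) \<in> ?d \<longleftrightarrow> G x \<le> G y" using r(3)[of x y] that C(1) by auto
    ultimately show ?thesis by blast
  qed
  have "inj_on (F \<circ> G) C"
    by (rule comp_inj_on[OF inj_on_subset[OF r(2) C(1)]]) (use F C(2) in \<open>auto simp: oiso_def bij_betw_def\<close>)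
  then have injS: "inj_on S C" unfolding S_def comp_def .
  have bij: "bij_betw S (Field ?d) {..<c}" unfolding Fd bij_betw_def using injS Sim by blast
  have dc: "?d =o oseg c" by (rule ordIso_osegI[OF bij wo]) (use So Fd in auto)
  have eb: "eps_below ?d = {x \<in> C. eps (S x)}" "S ` eps_below ?d = {e. e < c \<and> eps e}"
    using eps_below_oseg[OF wo bij] So Fd by auto
  have K: "oiso (F \<circ> inv_into (from_two c) en) {e. e < c \<and> eps e} {..<c}"
    by (rule oiso_comp[OF oiso_inv[OF en] F])
  let ?K = "F \<circ> inv_into (from_two c) en"
  have "Restr ?d (eps_below ?d) =o oseg c"
  proof (rule Well_order_Restr_oseg[OF wo, where G = "\<lambda>x. ?K (S x)"])
    show "eps_below ?d \<subseteq> Field ?d" unfolding eb Fd by blast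
    show "(\<lambda>x. ?K (S x)) ` eps_below ?d = {..<c}"
      using K eb(2) unfolding oiso_def bij_betw_def by (metis image_image)
    fix x y assume xy: "x \<in> eps_below ?d" "y \<in> eps_below ?d"
    then have "S x \<in> {e. e < c \<and> eps e}" "S y \<in> {e. e < c \<and> eps e}" using eb(2) by blast+
    then have "S x \<le> S y \<longleftrightarrow> ?K (S x) \<le> ?K (S y)" using K unfolding oiso_def by blast
    then show "(x, y) \<in> ?d \<longleftrightarrow> ?K (S x) \<le> ?K (S y)" using So xy eb(1) by blast
  qed
  then have "Restr ?d (eps_below ?d) =o ?d" using dc by (meson ordIso_symmetric ordIso_transitive)
  moreover have "is_eps_point ?d" using is_eps_point_iff[OF dc] c by blast
  ultimately show ?thesis unfolding is_eps_def by blast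
qed

text \<open>The type of \<open>C\<close> is taken from any isomorphism \<open>S\<close> with an
  ordinal and equals \<open>c\<close> by \<open>from_two_type\<close>, since it is an epsilon
  number.\<close>

lemma is_eps_selfD:
  fixes c :: "'x ordinal"
  assumes r: "Well_order r" "inj_on G (Field r)"
    "\<And>x y. x \<in> Field r \<Longrightarrow> y \<in> Field r \<Longrightarrow> (x, y) \<in> r \<longleftrightarrow> G x \<le> G y"
    and C: "C \<subseteq> Field r" "G ` C = from_two c" and e: "is_eps (Restr r C) (Restr r C)"
  shows "eps c" and "\<exists>k. oiso k {..<c} {e. e < c \<and> eps e}"
proof -
  let ?d = "Restr r C"
  have wo: "Well_order ?d" by (rule Well_order_Restr[OF r(1)])
  have Fd: "Field ?d = C" by (rule Field_Restr_Well_order[OF r(1) C(1)])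
  have "small TYPE('x) C"
  proof -
    obtain f :: "'x ordinal \<Rightarrow> 'x + nat" where f: "inj_on f {..<c}" using small_lessThan small_def by blast
    have "inj_on (f \<circ> G) C"
      by (rule comp_inj_on[OF inj_on_subset[OF r(2) C(1)] inj_on_subset[OF f]]) (use C(2) in auto)
    then show ?thesis unfolding small_def by blast
  qed
  then obtain d :: "'x ordinal" where d: "?d =o oseg d" using Well_order_oseg_ex[OF wo] Fd by metis
  obtain S where S: "bij_betw S (Field ?d) {..<d}"
    "\<And>x y. x \<in> Field ?d \<Longrightarrow> y \<in> Field ?d \<Longrightarrow> (x, y) \<in> ?d \<longleftrightarrow> S x \<le> S y"
    by (rule ordIso_osegE[OF d], rule that)
  have injS: "inj_on S (Field ?d)" using S(1) bij_betw_def by blast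
  have ed: "eps d" using e is_eps_point_iff[OF d] unfolding is_eps_def by blast
  have "Restr ?d C = ?d" by blast
  then obtain k where "oiso k (G ` C) (S ` C)"
    using Restr_order_iso[OF r wo injS S(2) C(1), of C] ordIso_reflexive[OF wo] unfolding Fd by (metis order_refl)
  moreover have "S ` C = {..<d}" using S(1) Fd by (simp add: bij_betw_def)
  ultimately have "oiso k (from_two c) {..<d}" using C(2) by simp
  then have dc: "d = c" using from_two_type ed by blast
  then show "eps c" using ed by simp
  have sub: "eps_below ?d \<subseteq> Field ?d" unfolding eps_below_def by blast
  have "Restr ?d (eps_below ?d) =o Restr ?d (Field ?d)"
    using e Restr_Field[of ?d] unfolding is_eps_def by simp
  then obtain k where "oiso k (S ` Field ?d) (S ` eps_below ?d)"
    using Restr_order_iso[OF wo injS S(2) wo injS S(2) order_refl sub] by blast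
  then show "\<exists>k. oiso k {..<c} {e. e < c \<and> eps e}"
    using eps_below_oseg(2)[OF wo S] S(1) unfolding dc bij_betw_def by auto
qed


lemma eps_enum_oiso:
  assumes en: "eps_enum a en" and c: "ge_two c" "c \<le> a"
  shows "oiso en (from_two c) {e. e < en c \<and> eps e}"
proof -
  have mono: "en x < en y" if "ge_two x" "x < y" "y \<le> a" for x y
    using en that unfolding eps_enum_def by blast
  have le: "en x \<le> en y" if "ge_two x" "x \<le> y" "y \<le> a" for x y
    using mono[OF that(1) _ that(3)] that(2) by (metis order_le_less)
  have iff: "x \<le> y \<longleftrightarrow> en x \<le> en y" if "x \<in> from_two c" "y \<in> from_two c" for x y
  proof -
    have "x \<le> a" "y \<le> a" using that c(2) by (auto intro: less_imp_le less_le_trans)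
    then show ?thesis using le[of x y] mono[of y x] that by (metis leD leI mem_Collect_eq)
  qed
  have "inj_on en (from_two c)" by (rule inj_onI, rule antisym) (simp_all only: iff order_refl)
  moreover have "en ` from_two c = {e. e < en c \<and> eps e}"
  proof (intro equalityI subsetI)
    fix e assume "e \<in> en ` from_two c"
    then obtain x where "x < c" "ge_two x" "e = en x" by blast
    then show "e \<in> {e. e < en c \<and> eps e}"
      using mono[of x c] c en unfolding eps_enum_def by (auto intro: less_imp_le less_le_trans)
  next
    fix e assume e: "e \<in> {e. e < en c \<and> eps e}"
    then have "e < en a" using le[OF c order_refl] by (auto intro: less_le_trans)
    then obtain x where x: "ge_two x" "x < a" "en x = e" using en e unfolding eps_enum_def by blast
    have "\<not> c \<le> x" using le[OF c(1) _ less_imp_le[OF x(2)]] x e by auto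
    then show "e \<in> en ` from_two c" using x by auto
  qed
  ultimately show ?thesis unfolding oiso_def bij_betw_def using iff by blast
qed

text \<open>Turns what \<open>is_eps\<close> provides, an isomorphism onto the epsilon numbers below
  \<open>d\<close>, into an enumeration that ends in \<open>d\<close>.\<close>

lemma eps_enum_extend:
  assumes a: "ge_two a" and k: "oiso k (from_two a) {e. e < d \<and> eps e}" and d: "eps d"
  shows "eps_enum a (k(a := d))"
proof -
  let ?en = "k(a := d)"
  have ka: "?en c = k c" if "c < a" for c using that by auto
  have kk: "eps (?en c)" "?en c < d" if "c < a" "ge_two c" for c
    using oiso_mem[OF k, of c] that ka by auto
  show ?thesis
    unfolding eps_enum_def
  proof (intro conjI allI impI a)
    fix c assume "ge_two c \<and> c \<le> a"
    then show "eps (?en c)" using kk(1)[of c] d by (cases "c = a") auto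
  next
    fix c e assume ce: "ge_two c \<and> c < e \<and> e \<le> a"
    show "?en c < ?en e"
    proof (cases "e = a")
      case True
      then show ?thesis using kk(2)[of c] ce by simp
    next
      case False
      then have "e < a" "c < a" using ce by auto
      then show ?thesis using oiso_less[OF k, of c e] ce ka ge_two_mono[of c e] by auto
    qed
  next
    fix e assume "eps e \<and> e < ?en a"
    then have "e \<in> {e. e < d \<and> eps e}" by simp
    then show "\<exists>c. ge_two c \<and> c < a \<and> ?en c = e" using oiso_onto[OF k] ka by blast
  qed
qed

text \<open>For x < c the epsilon numbers below \<open>en x\<close> have a type of at most
  \<open>x\<close>, so \<open>en x\<close> cannot exceed the \<open>c\<close> many below
  \<open>c\<close>. Hence \<open>c\<close> is not a value of \<open>en\<close> at any smaller index,
  and it must be the value at \<open>c\<close>.\<close>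

lemma eps_enum_fixed:
  assumes en: "eps_enum a en" and c: "eps c" "c \<le> a" and k: "oiso k {..<c} {e. e < c \<and> eps e}"
  shows "en c = c"
proof -
  have tw: "ge_two c" using eps_ge_two c(1) .
  have lt: "en x < c" if x: "x < c" "ge_two x" for x
  proof (rule ccontr)
    assume "\<not> en x < c"
    then have ge: "c \<le> en x" by simp
    have xa: "x \<le> a" using x c(2) by simp
    let ?i = "inv_into (from_two x) en"
    have oi: "oiso ?i {e. e < en x \<and> eps e} (from_two x)"
      by (rule oiso_inv[OF eps_enum_oiso[OF en x(2) xa]])
    have km: "k y \<in> {e. e < en x \<and> eps e}" if "y < c" for y
      using oiso_mem[OF k, of y] that ge by (auto intro: less_le_trans)
    have "c \<le> x"
    proof (rule strict_mono_le)
      show "?i (k y) < x" if "y < c" for y using oiso_mem[OF oi km[OF that]] by simp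
      show "?i (k y) < ?i (k w)" if "y < w" "w < c" for y w
        using oiso_less[OF k, of y w] oiso_less[OF oi km km, of y w] that by auto
    qed
    then show False using x by simp
  qed
  have "c \<le> en c" by (rule eps_enum_ge[OF en tw c(2)])
  moreover have "\<not> c < en c"
  proof
    assume "c < en c"
    then have "c \<in> {e. e < en c \<and> eps e}" using c(1) by simp
    then obtain x where "x \<in> from_two c" "en x = c" using oiso_onto[OF eps_enum_oiso[OF en tw c(2)]] by blast
    then show False using lt[of x] by simp
  qed
  ultimately show ?thesis by simp
qed

text \<open>Translates \<open>is_g\<close> clause by clause along isomorphisms \<open>G\<close> and
  \<open>H\<close>; the segments C in \<open>ebar_case\<close> become intervals from two to some c
  \<le> a.\<close>

lemma is_g_ebar_ord:
  fixes a b :: "'x ordinal"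
  assumes g: "is_g r s" and r: "r =o oseg a" and s: "s =o oseg b"
  shows "card (Field r) = 1 \<and> s =o natLeq \<or> ebar_ord a b"
proof (cases "card (Field r) = 1 \<and> s =o natLeq")
  case False
  have wr: "Well_order r" using g unfolding is_g_def by blast
  have ws: "Well_order s" using s unfolding ordIso_def by blast
  obtain a0 a1 where a01: "a0 \<in> Field r" "a1 \<in> Field r" "a0 \<noteq> a1"
    "\<And>x. x \<in> Field r \<Longrightarrow> (a0, x) \<in> r" "\<And>x. x \<in> Field r \<Longrightarrow> x \<noteq> a0 \<Longrightarrow> (a1, x) \<in> r"
    "is_ebar (Restr r (Field r - {a0, a1})) s"
    using g False unfolding is_g_def by blast
  obtain G where G: "bij_betw G (Field r) {..<a}"
    "\<And>x y. x \<in> Field r \<Longrightarrow> y \<in> Field r \<Longrightarrow> (x, y) \<in> r \<longleftrightarrow> G x \<le> G y"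
    by (rule ordIso_osegE[OF r], rule that)
  obtain H where H: "bij_betw H (Field s) {..<b}"
    "\<And>x y. x \<in> Field s \<Longrightarrow> y \<in> Field s \<Longrightarrow> (x, y) \<in> s \<longleftrightarrow> H x \<le> H y"
    by (rule ordIso_osegE[OF s], rule that)
  have injG: "inj_on G (Field r)" and injH: "inj_on H (Field s)" using G(1) H(1) by (simp_all add: bij_betw_def)
  have imG: "G ` Field r = {..<a}" using G(1) by (simp add: bij_betw_def)
  define X where "X = Field r - {a0, a1}"
  have XF: "X \<subseteq> Field r" unfolding X_def by blast
  have G01: "G a0 < G a1" using G(2)[OF a01(1,2)] a01(4)[OF a01(2)] inj_onD[OF injG _ a01(1,2)] a01(3)
    by (metis order_le_less)
  have low: "G a0 \<le> c" if "c < a" for c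
  proof -
    have "c \<in> G ` Field r" using that imG by simp
    then show ?thesis using a01(4) G(2)[OF a01(1)] by blast
  qed
  have low1: "G a1 \<le> c" if "c < a" "G a0 < c" for c
  proof -
    have "c \<in> G ` Field r" using that imG by simp
    then obtain x where x: "x \<in> Field r" "c = G x" by blast
    then have "x \<noteq> a0" using that by auto
    then show ?thesis using a01(5)[OF x(1)] G(2)[OF a01(2) x(1)] x(2) by blast
  qed
  have a1a: "G a1 < a" using imG a01(2) by blast
  \<comment> \<open>The two least elements become zero and one under \<open>G\<close>, so the
    interval from two to \<open>a\<close> remains.\<close>
  have GX: "G ` X = from_two a"
  proof (intro equalityI subsetI)
    fix c assume "c \<in> G ` X"
    then obtain x where x: "x \<in> Field r" "x \<noteq> a0" "x \<noteq> a1" "c = G x" unfolding X_def by blast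
    have "G a1 \<le> G x" using a01(5)[OF x(1,2)] G(2)[OF a01(2) x(1)] by blast
    moreover have "G a1 \<noteq> G x" using inj_onD[OF injG _ a01(2) x(1)] x(3) by auto
    ultimately have "G a1 < c" using x(4) by simp
    moreover have "c < a" using x imG by blast
    ultimately show "c \<in> from_two a" using G01 unfolding ge_two_def by blast
  next
    fix c assume c: "c \<in> from_two a"
    then obtain p q where pq: "p < q" "q < c" unfolding ge_two_def by blast
    have "q < a" using pq(2) c by auto
    then have "p < a" using pq(1) by simp
    then have p: "G a0 < q" using le_less_trans[OF low pq(1)] by blast
    then have "G a1 \<le> q" using low1 \<open>q < a\<close> by blast
    then have ne: "c \<noteq> G a0" "c \<noteq> G a1" using pq p by auto
    obtain x where "x \<in> Field r" "c = G x" using c imG by (metis (mono_tags, lifting) imageE lessThan_iff mem_Collect_eq)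
    then show "c \<in> G ` X" using ne unfolding X_def by blast
  qed
  have twa: "ge_two a" using G01 a1a unfolding ge_two_def by blast
  have FX: "Field (Restr r X) = X" by (rule Field_Restr_Well_order[OF wr XF])
  have RR: "Restr (Restr r X) C = Restr r C" if "C \<subseteq> X" for C using that by blast
  have eb: "eps_below s = {x \<in> Field s. eps (H x)}" "H ` eps_below s = {e. e < b \<and> eps e}"
    using eps_below_oseg[OF ws H] by blast+
  have ebF: "eps_below s \<subseteq> Field s" unfolding eb by blast
  have epsb: "eps b"
    using a01(6) is_eps_point_iff[OF s] unfolding is_ebar_def is_eps_succ_def is_eps_def
    by (meson)
  have GC: "G ` {x \<in> X. G x < c} = from_two c" if "c \<le> a" for c
  proof (intro equalityI subsetI)
    fix x assume x: "x \<in> from_two c"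
    then have "x \<in> G ` X" unfolding GX using that by auto
    then show "x \<in> G ` {x \<in> X. G x < c}" using x by blast
  next
    fix x assume "x \<in> G ` {x \<in> X. G x < c}"
    then show "x \<in> from_two c" using GX by blast
  qed
  have underS: "underS (Restr r X) u = {x \<in> X. G x < G u}" if u: "u \<in> X" for u
  proof -
    have "y \<in> underS (Restr r X) u \<longleftrightarrow> y \<in> {x \<in> X. G x < G u}" for y
    proof (cases "y \<in> X")
      case True
      then have "(y, u) \<in> r \<longleftrightarrow> G y \<le> G u" "y = u \<longleftrightarrow> G y = G u"
        using G(2)[of y u] inj_onD[OF injG, of y u] u XF by blast+
      then show ?thesis unfolding underS_def using True u by auto
    qed (auto simp: underS_def)
    then show ?thesis by blast
  qed
  show ?thesis
  proof (cases "ebar_case (Restr r X)")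
    case nb: False
    then have "Restr s (eps_below s) =o Restr r X"
      using a01(6) unfolding is_ebar_def is_eps_def X_def by simp
    then obtain k where k: "oiso k (from_two a) {e. e < b \<and> eps e}"
      using Restr_order_iso[OF wr injG G(2) ws injH H(2) XF ebF] unfolding GX eb(2) by blast
    define en where "en = k(a := b)"
    have en: "eps_enum a en" unfolding en_def by (rule eps_enum_extend[OF twa k epsb])
    \<comment> \<open>A fixed point \<open>c\<close> near \<open>a\<close> would cut out a segment
      \<open>C\<close> witnessing \<open>ebar_case\<close>.\<close>
    have "\<not> fixed_near en a"
    proof
      assume "fixed_near en a"
      then obtain c where c: "ge_two c" "c \<le> a" "en c = c" "finite {c..<a}" unfolding fixed_near_def by blast
      have epsc: "eps c" using en c unfolding eps_enum_def by metis
      define C where "C = {x \<in> X. G x < c}"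
      have CX: "C \<subseteq> X" unfolding C_def by blast
      note GC = GC[OF c(2), folded C_def]
      have "finite (X - C)"
      proof (rule finite_imageD)
        have "G x \<in> {c..<a}" if "x \<in> X - C" for x
        proof -
          have "G x \<in> G ` X" using that by blast
          then have "G x < a" unfolding GX by simp
          moreover have "c \<le> G x" using that unfolding C_def by (auto simp: not_less)
          ultimately show ?thesis by simp
        qed
        then have "G ` (X - C) \<subseteq> {c..<a}" by blast
        then show "finite (G ` (X - C))" using c(4) finite_subset by blast
        show "inj_on G (X - C)" by (rule inj_on_subset[OF injG]) (use XF in blast)
      qed
      moreover have "C = X \<or> (\<exists>x\<in>X. C = underS (Restr r X) x)"
      proof (cases "c = a")
        case True
        then show ?thesis using GX unfolding C_def by blast
      next
        case False
        then have "c \<in> G ` X" unfolding GX using c by auto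
        then obtain u where u: "u \<in> X" "c = G u" by blast
        have "C = underS (Restr r X) u" unfolding C_def underS[OF u(1)] u(2) ..
        then show ?thesis using u(1) by blast
      qed
      moreover have "is_eps (Restr (Restr r X) C) (Restr (Restr r X) C)"
        unfolding RR[OF CX]
      proof (rule is_eps_selfI[OF wr injG G(2) _ GC epsc])
        show "C \<subseteq> Field r" using CX XF by blast
        show "oiso en (from_two c) {e. e < c \<and> eps e}"
          using eps_enum_oiso[OF en c(1,2)] unfolding c(3) .
      qed
      ultimately show False using nb unfolding ebar_case_def FX by blast
    qed
    moreover have "en a = b" by (simp add: en_def)
    ultimately have "ebar_ord a b"
      unfolding ebar_ord_def by (intro conjI exI[of _ en] epsb en) simp
    then show ?thesis ..
  next
    case True
    then have "is_eps_succ (Restr r X) s" using a01(6) unfolding is_ebar_def X_def by simp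
    then obtain m where m: "m \<in> eps_below s" "\<And>y. y \<in> eps_below s \<Longrightarrow> (y, m) \<in> s"
      "Restr s (eps_below s - {m}) =o Restr r X" unfolding is_eps_succ_def by blast
    have mF: "m \<in> Field s" using m(1) ebF by blast
    have im: "H ` (eps_below s - {m}) = {e. e < b \<and> eps e} - {H m}"
    proof -
      have "H ` (eps_below s - {m}) = H ` eps_below s - H ` {m}"
        by (rule inj_on_image_set_diff[OF injH]) (use ebF mF in auto)
      then show ?thesis unfolding eb(2) by simp
    qed
    have top: "e \<le> H m" if "eps e" "e < b" for e
    proof -
      have "e \<in> H ` eps_below s" using that eb(2) by simp
      then show ?thesis using m(2) H(2) mF ebF by blast
    qed
    have Hm: "eps (H m)" "H m < b" using m(1) eb(2) by blast+
    \<comment> \<open>\<open>m\<close> is the greatest epsilon number below \<open>b\<close>.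
      Without it those below \<open>H m\<close> remain, so the enumeration ends in
      \<open>H m\<close> and \<open>b\<close> comes next.\<close>
    have "{e. e < b \<and> eps e} - {H m} = {e. e < H m \<and> eps e}"
      using Hm(2) top by (auto simp: order_le_less)
    then obtain k where k: "oiso k (from_two a) {e. e < H m \<and> eps e}"
      using Restr_order_iso[OF wr injG G(2) ws injH H(2) XF _ m(3)] ebF unfolding GX im by auto
    define en where "en = k(a := H m)"
    have en: "eps_enum a en" unfolding en_def by (rule eps_enum_extend[OF twa k Hm(1)])
    obtain C where C: "C = X \<or> (\<exists>x\<in>X. C = underS (Restr r X) x)" "finite (X - C)"
      "is_eps (Restr (Restr r X) C) (Restr (Restr r X) C)"
      using True unfolding ebar_case_def FX by blast
    obtain c where c: "c \<le> a" "C = {x \<in> X. G x < c}" "c = a \<or> c \<in> G ` X"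
    proof (cases "C = X")
      case True
      then show ?thesis using that[of a] GX by blast
    next
      case False
      then obtain u where u: "u \<in> X" "C = underS (Restr r X) u" using C(1) by blast
      have "C = {x \<in> X. G x < G u}" unfolding u(2) by (rule underS[OF u(1)])
      moreover have "G u \<in> G ` X" using u(1) by blast
      moreover from this have "G u \<le> a" unfolding GX by (simp add: less_imp_le)
      ultimately show ?thesis using that[of "G u"] by blast
    qed
    have CX: "C \<subseteq> X" unfolding c(2) by blast
    note GC = GC[OF c(1), folded c(2)]
    have CF: "C \<subseteq> Field r" using CX XF by blast
    have e: "is_eps (Restr r C) (Restr r C)" using C(3) unfolding RR[OF CX] .
    have epsc: "eps c" by (rule is_eps_selfD(1)[OF wr injG G(2) CF GC e])
    obtain \<kappa> where "oiso \<kappa> {..<c} {e. e < c \<and> eps e}"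
      using is_eps_selfD(2)[OF wr injG G(2) CF GC e] by blast
    then have enc: "en c = c" by (rule eps_enum_fixed[OF en epsc c(1)])
    have "{c..<a} \<subseteq> G ` (X - C)"
    proof
      fix x assume x: "x \<in> {c..<a}"
      then have "x \<in> G ` X" unfolding GX using ge_two_mono[OF eps_ge_two[OF epsc]] by auto
      then show "x \<in> G ` (X - C)" using x unfolding c(2) by auto
    qed
    then have "finite {c..<a}" using C(2) by (meson finite_imageI finite_subset)
    then have "fixed_near en a" unfolding fixed_near_def using eps_ge_two[OF epsc] c(1) enc by blast
    moreover have "en a = H m" by (simp add: en_def)
    ultimately have "ebar_ord a b"
      unfolding ebar_ord_def by (intro conjI exI[of _ en] epsb en) (simp add: Hm(2) top)
    then show ?thesis ..
  qed
qed simp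

text \<open>Height maps the trees into \<omega> and determines them up to equivalence; stems realise
  every height.\<close>

lemma rk_ftrees_one_class:
  fixes b :: "'x ordinal"
  assumes Q: "wqo_on Q le" "q \<in> Q" and eq: "\<And>x y. x \<in> Q \<Longrightarrow> y \<in> Q \<Longrightarrow> le x y"
    and b: "natLeq =o oseg b" and sm: "small TYPE('x) (ftrees Q)"
  shows "swqo TYPE('x) (tree_le le) (ftrees Q) \<and> rk (tree_le le) (ftrees Q) = cnf b"
proof -
  obtain N where N': "bij_betw N (Field natLeq) {..<b}"
    "\<And>x y. x \<in> Field natLeq \<Longrightarrow> y \<in> Field natLeq \<Longrightarrow> (x, y) \<in> natLeq \<longleftrightarrow> N x \<le> N y"
    by (rule ordIso_osegE[OF b], rule that)
  have N: "bij_betw N UNIV {..<b}" "\<And>x y. x \<le> y \<longleftrightarrow> N x \<le> N y"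
    using N' unfolding Field_natLeq by (auto simp: natLeq_def)
  have Nb: "N n < b" for n using N(1) unfolding bij_betw_def by blast
  have T: "rkle (tree_le le) (ftrees Q) (cnf b)"
  proof (rule rkle_map[where h = "\<lambda>t. cnf (N (height t))"])
    fix s t assume "s \<in> ftrees Q" "t \<in> ftrees Q" "cnf (N (height s)) \<le> cnf (N (height t))"
    then show "tree_le le s t" using height_le_imp_tree_le[OF eq] N(2) by simp
  qed (simp add: Nb)
  then have sw: "swqo TYPE('x) (tree_le le) (ftrees Q)"
    unfolding swqo_def using wqo_ftrees[OF Q(1)] sm by blast
  moreover have "cnf b \<le> rk (tree_le le) (ftrees Q)"
  proof (rule reflecting_le_rk[OF sw])
    let ?i = "inv_into UNIV N"
    show "stem q (?i c) \<in> ftrees Q" for c by (rule stem_ftrees[OF Q(2)])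
    fix c d assume cd: "c < b" "d < b" "tree_le le (stem q (?i c)) (stem q (?i d))"
    then have "?i c \<le> ?i d" using tree_le_height by fastforce
    then have "N (?i c) \<le> N (?i d)" using N(2) by blast
    then show "c \<le> d" using N(1) cd(1,2) by (simp add: bij_betw_def f_inv_into_f)
  qed
  ultimately show ?thesis using rk_le[OF T] by (simp add: antisym)
qed

section \<open>The maximal order type of the trees\<close>

lemma smallI: "inj_on f A \<Longrightarrow> small TYPE('x) A" for f :: "'a \<Rightarrow> 'x"
  unfolding small_def by (rule exI[of _ "Inl \<circ> f"]) (auto intro: comp_inj_on)

theorem max_order_type_ftrees:
  fixes Q :: "'a set" and le :: "'a \<Rightarrow> 'a \<Rightarrow> bool" and r :: "'b rel" and s :: "'c rel"
  assumes Q: "wqo_on Q le" "Q \<noteq> {}" and r: "is_max_order_type Q le r" and g: "is_g r s"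
  shows "is_max_order_type (ftrees Q) (tree_le le) s"
proof -
  \<comment> \<open>This sum type is large enough for trees, labels and both given well-orders at
    once.\<close>
  have smT: "small TYPE('a ftree + 'b + 'c) A" for A :: "'a ftree set"
    by (rule smallI[of Inl]) simp
  have smQ: "small TYPE('a ftree + 'b + 'c) Q"
    by (rule smallI[of "Inl \<circ> Leaf"]) (auto simp: inj_on_def)
  have smr: "small TYPE('a ftree + 'b + 'c) (Field r)"
    by (rule smallI[of "Inr \<circ> Inl"]) (auto simp: inj_on_def)
  have sms: "small TYPE('a ftree + 'b + 'c) (Field s)"
    by (rule smallI[of "Inr \<circ> Inr"]) (auto simp: inj_on_def)
  have wr: "Well_order r" using g unfolding is_g_def by blast
  have ws: "Well_order s"
    using g unfolding is_g_def is_ebar_def is_eps_def is_eps_succ_def is_eps_point_def ordIso_def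
    by (smt (verit) case_prodD mem_Collect_eq)
  obtain a :: "('a ftree + 'b + 'c) ordinal" where a: "r =o oseg a"
    by (rule Well_order_oseg_ex[OF wr smr])
  obtain b :: "('a ftree + 'b + 'c) ordinal" where b: "s =o oseg b"
    by (rule Well_order_oseg_ex[OF ws sms])
  have sQ: "swqo TYPE('a ftree + 'b + 'c) le Q" using Q smQ unfolding swqo_def by blast
  have rkQ: "rk le Q = cnf a" by (rule max_order_type_rk[OF sQ r a])
  have "swqo TYPE('a ftree + 'b + 'c) (tree_le le) (ftrees Q) \<and> rk (tree_le le) (ftrees Q) = cnf b"
    using is_g_ebar_ord[OF g a b]
  proof
    assume ab: "ebar_ord a b"
    have "rkle (tree_le le) (ftrees Q) {#b#}"
      by (rule rkle_ftrees_ebar[OF _ ab]) (use rkle_rk[OF sQ] rkQ in simp)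
    then have sT: "swqo TYPE('a ftree + 'b + 'c) (tree_le le) (ftrees Q)"
      using wqo_ftrees[OF Q(1)] smT unfolding swqo_def by blast
    then show ?thesis using rk_ftrees_ebar[OF sQ rkQ ab] by blast
  next
    assume c1: "card (Field r) = 1 \<and> s =o natLeq"
    obtain G where G: "bij_betw G (Field r) {..<a}" by (rule ordIso_osegE[OF a])
    then have "card {..<a} = 1" using c1 bij_betw_same_card by metis
    then obtain z where z: "{..<a} = {z}" by (meson card_1_singletonE)
    \<comment> \<open>Maximal order type one leaves no room for the descending ranks of two
      successive residuals, so all labels are equivalent.\<close>
    have "le x y" if xy: "x \<in> Q" "y \<in> Q" for x y
    proof (rule ccontr)
      assume "\<not> le x y"
      have "rk le (left le Q x) < cnf a" using rk_left[OF sQ xy(1)] rkQ by simp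
      then obtain c where c: "c < a" "rk le (left le Q x) = cnf c" using cnf_onto by blast
      have sub: "swqo TYPE('a ftree + 'b + 'c) le (left le Q x)" by (rule swqo_subset[OF sQ]) auto
      have y: "y \<in> left le Q x" using xy \<open>\<not> le x y\<close> by blast
      have "rk le (left le (left le Q x) y) < cnf c" using rk_left[OF sub y] unfolding c(2) .
      from cnf_onto[OF this] obtain d where d: "d < c" by (elim exE conjE) (rule that)
      then have "c \<in> {..<a}" "d \<in> {..<a}" using c(1) by auto
      then have "c = d" unfolding z by simp
      then show False using d by simp
    qed
    moreover have "natLeq =o oseg b" using c1 b ordIso_symmetric ordIso_transitive by blast
    moreover obtain q where "q \<in> Q" using Q(2) by blast
    ultimately show ?thesis using rk_ftrees_one_class[OF Q(1) _ _ _ smT] by blast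
  qed
  then show ?thesis using rk_max_order_type[OF _ ws b] by blast
qed

subsection \<open>Indecomposable sequences and trees\<close>

text \<open>\<open>seq_emb\<close> for positions of arbitrary types and subsets of them, so that
  blocks and tails can be compared without restricting the relations.\<close>

definition emb :: "('a \<Rightarrow> 'a \<Rightarrow> bool) \<Rightarrow> ('i \<Rightarrow> 'i \<Rightarrow> bool) \<Rightarrow> ('i \<Rightarrow> 'a) \<Rightarrow> 'i set \<Rightarrow>
    ('j \<Rightarrow> 'j \<Rightarrow> bool) \<Rightarrow> ('j \<Rightarrow> 'a) \<Rightarrow> 'j set \<Rightarrow> bool" where
  "emb le lt l P lt' l' P' \<longleftrightarrow> (\<exists>f. (\<forall>i\<in>P. f i \<in> P' \<and> le (l i) (l' (f i))) \<and>
     (\<forall>i\<in>P. \<forall>j\<in>P. lt i j \<longrightarrow> lt' (f i) (f j)))"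

lemma emb_trans:
  assumes "emb le lt1 l1 P1 lt2 l2 P2" "emb le lt2 l2 P2 lt3 l3 P3"
    and tr: "\<And>x y z. x \<in> Q \<Longrightarrow> y \<in> Q \<Longrightarrow> z \<in> Q \<Longrightarrow> le x y \<Longrightarrow> le y z \<Longrightarrow> le x z"
    and Q: "l1 ` P1 \<subseteq> Q" "l2 ` P2 \<subseteq> Q" "l3 ` P3 \<subseteq> Q"
  shows "emb le lt1 l1 P1 lt3 l3 P3"
proof -
  obtain f where f: "\<And>i. i \<in> P1 \<Longrightarrow> f i \<in> P2 \<and> le (l1 i) (l2 (f i))"
    "\<And>i j. i \<in> P1 \<Longrightarrow> j \<in> P1 \<Longrightarrow> lt1 i j \<Longrightarrow> lt2 (f i) (f j)"
    using assms(1) unfolding emb_def by blast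
  obtain g where g: "\<And>i. i \<in> P2 \<Longrightarrow> g i \<in> P3 \<and> le (l2 i) (l3 (g i))"
    "\<And>i j. i \<in> P2 \<Longrightarrow> j \<in> P2 \<Longrightarrow> lt2 i j \<Longrightarrow> lt3 (g i) (g j)"
    using assms(2) unfolding emb_def by blast
  have "g (f i) \<in> P3 \<and> le (l1 i) (l3 (g (f i)))" if i: "i \<in> P1" for i
  proof -
    have "l1 i \<in> Q" "l2 (f i) \<in> Q" "l3 (g (f i)) \<in> Q" using f(1)[OF i] g(1)[of "f i"] i Q by blast+
    then show ?thesis using f(1)[OF i] g(1)[of "f i"] tr by blast
  qed
  moreover have "lt3 (g (f i)) (g (f j))" if "i \<in> P1" "j \<in> P1" "lt1 i j" for i j
    using that f g by blast
  ultimately show ?thesis unfolding emb_def by (intro exI[of _ "\<lambda>i. g (f i)"]) blast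
qed

lemma emb_subset:
  assumes "P \<subseteq> P'" "\<And>i. i \<in> P \<Longrightarrow> le (l i) (l i)"
  shows "emb le lt l P lt l P'"
  unfolding emb_def using assms by (intro exI[of _ "\<lambda>i. i"]) auto

lemma emb_mono: "emb le lt l P lt' l' P' \<Longrightarrow> P' \<subseteq> P'' \<Longrightarrow> emb le lt l P lt' l' P''"
  unfolding emb_def by blast

text \<open>\<open>rep lt l t P\<close>: the positions \<open>P\<close>, ordered by \<open>lt\<close> and labelled by \<open>l\<close>, spell out the tree
  \<open>t\<close>. For a node they fall into \<open>\<omega>\<close> consecutive blocks, numbered by \<open>h\<close> (with gaps), each
  spelling a child, such that every child recurs infinitely often.\<close>
inductive rep :: "('i \<Rightarrow> 'i \<Rightarrow> bool) \<Rightarrow> ('i \<Rightarrow> 'a) \<Rightarrow> 'a ftree \<Rightarrow> 'i set \<Rightarrow> bool"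
  for lt :: "'i \<Rightarrow> 'i \<Rightarrow> bool" and l :: "'i \<Rightarrow> 'a" where
  rep_Leaf: "rep lt l (Leaf (l p)) {p}"
| rep_Node: "ts \<noteq> {||} \<Longrightarrow> (\<And>p. p \<in> P \<Longrightarrow> rep lt l (tt (h p)) {q \<in> P. h q = h p}) \<Longrightarrow>
    (\<And>p. p \<in> P \<Longrightarrow> tt (h p) |\<in>| ts) \<Longrightarrow>
    (\<And>t n. t |\<in>| ts \<Longrightarrow> \<exists>p\<in>P. (n :: nat) \<le> h p \<and> tt (h p) = t) \<Longrightarrow>
    (\<And>p q. p \<in> P \<Longrightarrow> q \<in> P \<Longrightarrow> h p < h q \<Longrightarrow> lt p q) \<Longrightarrow> rep lt l (Node ts) P"

lemma rep_LeafE: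
  assumes "rep lt l (Leaf x) P"
  obtains p where "P = {p}" "l p = x"
  using assms by (cases rule: rep.cases) auto

lemma rep_NodeE:
  assumes "rep lt l (Node ts) P"
  obtains tt h where "ts \<noteq> {||}" "\<And>p. p \<in> P \<Longrightarrow> rep lt l (tt (h p)) {q \<in> P. h q = h p}"
    "\<And>p. p \<in> P \<Longrightarrow> tt (h p) |\<in>| ts"
    "\<And>t n. t |\<in>| ts \<Longrightarrow> \<exists>p\<in>P. (n :: nat) \<le> h p \<and> tt (h p) = t"
    "\<And>p q. p \<in> P \<Longrightarrow> q \<in> P \<Longrightarrow> h p < h q \<Longrightarrow> lt p q"
  using assms by (cases rule: rep.cases) auto

lemma rep_nonempty: "rep lt l t P \<Longrightarrow> P \<noteq> {}"
  by (induction rule: rep.induct) (use all_not_fin_conv in fastforce)+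

lemma rep_labels: "rep lt l t P \<Longrightarrow> p \<in> P \<Longrightarrow> l p \<in> set_ftree t"
proof (induction arbitrary: p rule: rep.induct)
  case (rep_Node ts P tt h)
  have "l p \<in> set_ftree (tt (h p))" by (rule rep_Node.IH[OF rep_Node.prems]) (use rep_Node.prems in simp)
  then show ?case using rep_Node.hyps(3)[OF rep_Node.prems] by auto
qed simp

lemma rep_ftrees: "rep lt l t P \<Longrightarrow> l ` P \<subseteq> Q \<Longrightarrow> t \<in> ftrees Q"
proof (induction rule: rep.induct)
  case (rep_Node ts P tt h)
  have "t \<in> ftrees Q" if t: "t |\<in>| ts" for t
  proof -
    obtain p where p: "p \<in> P" "tt (h p) = t" using rep_Node.hyps(4)[OF t] by blast
    have "l ` {q \<in> P. h q = h p} \<subseteq> Q" using rep_Node.prems by blast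
    then show ?thesis using rep_Node.IH[OF p(1)] p(2) by simp
  qed
  then show ?case using rep_Node.hyps(1) by simp
qed simp

lemma Leaf_le_imp_label: "rep lt l t P \<Longrightarrow> tree_le le (Leaf x) t \<Longrightarrow> \<exists>p\<in>P. le x (l p)"
proof (induction rule: rep.induct)
  case (rep_Node ts P tt h)
  then obtain t where t: "t |\<in>| ts" "tree_le le (Leaf x) t" by auto
  then obtain p where p: "p \<in> P" "tt (h p) = t" using rep_Node.hyps(4) by blast
  then have "\<exists>q\<in>{q \<in> P. h q = h p}. le x (l q)" using rep_Node.IH[OF p(1)] t(2) by simp
  then show ?case by blast
qed simp

lemma label_imp_Leaf_le: "rep lt l t P \<Longrightarrow> p \<in> P \<Longrightarrow> le x (l p) \<Longrightarrow> tree_le le (Leaf x) t"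
proof (induction arbitrary: p rule: rep.induct)
  case (rep_Node ts P tt h)
  have "tree_le le (Leaf x) (tt (h p))"
    by (rule rep_Node.IH[OF rep_Node.prems(1), of p]) (use rep_Node.prems in auto)
  then show ?case using rep_Node.hyps(3)[OF rep_Node.prems(1)] by auto
qed simp

text \<open>Blocks are embedded one by one: since children recur, a block dominating the next one is
  always available beyond those already used. Asymmetry rules out that \<open>lt\<close> leads back
  to an earlier block.\<close>

lemma tree_le_imp_emb:
  assumes asym: "\<And>p q. lt p q \<Longrightarrow> \<not> lt q p"
  shows "rep lt l t P \<Longrightarrow> rep lt' l' t' P' \<Longrightarrow> tree_le le t t' \<Longrightarrow> emb le lt l P lt' l' P'"
proof (induction arbitrary: t' P' rule: rep.induct)
  case (rep_Leaf p)
  then obtain p' where "p' \<in> P'" "le (l p) (l' p')" using Leaf_le_imp_label by metis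
  then show ?case unfolding emb_def using asym by (intro exI[of _ "\<lambda>_. p'"]) auto
next
  case (rep_Node ts P tt h)
  obtain ts' where t': "t' = Node ts'" using rep_Node.prems(2) by (cases t') auto
  obtain tt' h' where ts': "ts' \<noteq> {||}"
    and rep': "\<And>p. p \<in> P' \<Longrightarrow> rep lt' l' (tt' (h' p)) {q \<in> P'. h' q = h' p}"
    and "\<And>p. p \<in> P' \<Longrightarrow> tt' (h' p) |\<in>| ts'"
    and inf': "\<And>t n. t |\<in>| ts' \<Longrightarrow> \<exists>p\<in>P'. (n :: nat) \<le> h' p \<and> tt' (h' p) = t"
    and lt': "\<And>p q. p \<in> P' \<Longrightarrow> q \<in> P' \<Longrightarrow> h' p < h' q \<Longrightarrow> lt' p q"
    by (rule rep_NodeE[OF rep_Node.prems(1)[unfolded t']], rule that)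
  \<comment> \<open>Numbers \<open>n\<close> of no block impose no condition, which deals with the
    gaps in \<open>h\<close>.\<close>
  define S where "S n x \<longleftrightarrow> x \<in> P' \<and> ((\<exists>p\<in>P. h p = n) \<longrightarrow> tree_le le (tt n) (tt' (h' x)))" for n x
  have ex: "\<exists>x. S n x \<and> m \<le> h' x" for n m
  proof (cases "\<exists>p\<in>P. h p = n")
    case True
    then have "tt n |\<in>| ts" using rep_Node.hyps(3) by blast
    then obtain t where "t |\<in>| ts'" "tree_le le (tt n) t" using rep_Node.prems(2) t' by auto
    moreover from this obtain x where "x \<in> P'" "m \<le> h' x" "tt' (h' x) = t" using inf' by blast
    ultimately show ?thesis unfolding S_def by auto
  next
    case False
    obtain t where "t |\<in>| ts'" using ts' by auto
    then obtain x where "x \<in> P'" "m \<le> h' x" using inf' by blast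
    then show ?thesis unfolding S_def using False by blast
  qed
  have "\<exists>w. \<forall>n. S n (w n) \<and> h' (w n) < h' (w (Suc n))"
  proof (rule dependent_nat_choice)
    show "\<exists>x. S 0 x" using ex by blast
    fix x n
    show "\<exists>y. S (Suc n) y \<and> h' x < h' y" using ex[of "Suc n" "Suc (h' x)"] by (auto simp: Suc_le_eq)
  qed
  then obtain w where w: "\<And>n. S n (w n)" "\<And>n. h' (w n) < h' (w (Suc n))" by blast
  have wmono: "h' (w i) < h' (w j)" if "i < j" for i j
    using lift_Suc_mono_less[of "\<lambda>n. h' (w n)"] w(2) that by blast
  have wP: "w n \<in> P'" for n using w(1) S_def by blast
  let ?B = "\<lambda>i. {q \<in> P. h q = i}" and ?B' = "\<lambda>i. {q \<in> P'. h' q = h' (w i)}"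
  define emb_block where "emb_block i f \<longleftrightarrow> (\<forall>p\<in>?B i. f p \<in> ?B' i \<and> le (l p) (l' (f p))) \<and>
      (\<forall>p\<in>?B i. \<forall>q\<in>?B i. lt p q \<longrightarrow> lt' (f p) (f q))" for i f
  have "\<exists>f. emb_block i f" if p: "p \<in> P" "h p = i" for i p
  proof -
    have "tree_le le (tt i) (tt' (h' (w i)))" using w(1)[of i] p unfolding S_def by blast
    then have "emb le lt l (?B i) lt' l' (?B' i)" using rep_Node.IH[OF p(1) rep'[OF wP]] p(2) by simp
    then show ?thesis unfolding emb_def emb_block_def .
  qed
  note ex_block = this
  define F where "F i = (SOME f. emb_block i f)" for i
  have F: "emb_block (h p) (F (h p))" if "p \<in> P" for p
    unfolding F_def by (rule someI_ex[OF ex_block[OF that refl]])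
  have f1: "F (h p) p \<in> P'" "h' (F (h p) p) = h' (w (h p))" "le (l p) (l' (F (h p) p))" if "p \<in> P" for p
    using F[OF that] that unfolding emb_block_def by blast+
  have f2: "lt' (F (h p) p) (F (h q) q)" if pq: "p \<in> P" "q \<in> P" "lt p q" for p q
  proof -
    have "\<not> h q < h p" using rep_Node.hyps(5)[OF pq(2,1)] asym[OF pq(3)] by blast
    then consider "h p = h q" | "h p < h q" by linarith
    then show ?thesis
    proof cases
      case 1
      then show ?thesis using F[OF pq(2)] pq unfolding emb_block_def by auto
    next
      case 2
      then show ?thesis using lt' f1 pq wmono by simp
    qed
  qed
  show ?case unfolding emb_def using f1 f2 by (intro exI[of _ "\<lambda>p. F (h p) p"]) blast
qed

text \<open>Dropping the blocks up to that of \<open>x\<close> leaves the recurrence of all children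
  intact. This is the source of indecomposability.\<close>

lemma rep_tail:
  assumes "rep lt l t P" "x \<in> P"
  obtains P' where "P' \<subseteq> {y \<in> P. y = x \<or> lt x y}" "rep lt l t P'"
proof (cases t)
  case (Leaf y)
  then have "P \<subseteq> {y \<in> P. y = x \<or> lt x y}" using assms by (auto elim: rep_LeafE)
  then show ?thesis using that assms(1) by blast
next
  case (Node ts)
  obtain tt h where ts: "ts \<noteq> {||}" "\<And>p. p \<in> P \<Longrightarrow> rep lt l (tt (h p)) {q \<in> P. h q = h p}"
    "\<And>p. p \<in> P \<Longrightarrow> tt (h p) |\<in>| ts"
    "\<And>t n. t |\<in>| ts \<Longrightarrow> \<exists>p\<in>P. (n :: nat) \<le> h p \<and> tt (h p) = t"
    "\<And>p q. p \<in> P \<Longrightarrow> q \<in> P \<Longrightarrow> h p < h q \<Longrightarrow> lt p q"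
    by (rule rep_NodeE[OF assms(1)[unfolded Node]], rule that)
  let ?P = "{p \<in> P. h x < h p}"
  have "rep lt l (Node ts) ?P"
  proof (rule rep_Node[where tt = tt and h = h, OF ts(1)])
    fix p assume p: "p \<in> ?P"
    then have "{q \<in> ?P. h q = h p} = {q \<in> P. h q = h p}" by auto
    then show "rep lt l (tt (h p)) {q \<in> ?P. h q = h p}" using ts(2)[of p] p by simp
  next
    fix t n assume "t |\<in>| ts"
    then obtain p where "p \<in> P" "max n (Suc (h x)) \<le> h p" "tt (h p) = t" using ts(4) by blast
    then show "\<exists>p\<in>?P. n \<le> h p \<and> tt (h p) = t" by auto
  qed (use ts(3,5) in auto)
  moreover have "?P \<subseteq> {y \<in> P. y = x \<or> lt x y}" using ts(5)[OF assms(2)] by blast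
  ultimately show ?thesis using that Node by blast
qed

text \<open>The image of one block may meet several blocks of \<open>P'\<close>, but finitely many,
  as a position in a later block bounds them. A tail of the block falls into the last one, and by
  \<open>rep_tail\<close> this tail still spells the whole child.\<close>

lemma emb_imp_tree_le:
  assumes asym: "\<And>p q. lt p q \<Longrightarrow> \<not> lt q p" and asym': "\<And>p q. lt' p q \<Longrightarrow> \<not> lt' q p"
    and refl: "\<And>x. x \<in> Q \<Longrightarrow> le x x"
    and tr: "\<And>x y z. x \<in> Q \<Longrightarrow> y \<in> Q \<Longrightarrow> z \<in> Q \<Longrightarrow> le x y \<Longrightarrow> le y z \<Longrightarrow> le x z"
  shows "rep lt l t P \<Longrightarrow> l ` P \<subseteq> Q \<Longrightarrow> rep lt' l' t' P' \<Longrightarrow> l' ` P' \<subseteq> Q \<Longrightarrow>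
    emb le lt l P lt' l' P' \<Longrightarrow> tree_le le t t'"
proof (induction arbitrary: t' P' rule: rep.induct)
  case (rep_Leaf p)
  then obtain p' where "p' \<in> P'" "le (l p) (l' p')" unfolding emb_def by blast
  then show ?case using label_imp_Leaf_le[OF rep_Leaf.prems(2)] by blast
next
  case (rep_Node ts P tt h)
  obtain f where f: "\<And>i. i \<in> P \<Longrightarrow> f i \<in> P'" "\<And>i. i \<in> P \<Longrightarrow> le (l i) (l' (f i))"
    "\<And>i j. i \<in> P \<Longrightarrow> j \<in> P \<Longrightarrow> lt i j \<Longrightarrow> lt' (f i) (f j)"
    using rep_Node.prems(4) unfolding emb_def by blast
  have later: "\<exists>q\<in>P. h p < h q \<and> lt p q" if p: "p \<in> P" for p
  proof -
    obtain q where "q \<in> P" "Suc (h p) \<le> h q" using rep_Node.hyps(4)[OF rep_Node.hyps(3)[OF p]] by blast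
    then show ?thesis using rep_Node.hyps(5)[OF p, of q] by (intro bexI[of _ q]) auto
  qed
  show ?case
  proof (cases t')
    case (Leaf y)
    then obtain p' where p': "P' = {p'}" using rep_Node.prems(2) rep_LeafE by metis
    obtain t where "t |\<in>| ts" using rep_Node.hyps(1) by auto
    then obtain p where p: "p \<in> P" using rep_Node.hyps(4) by blast
    then obtain q where q: "q \<in> P" "lt p q" using later by blast
    have "lt' (f p) (f q)" by (rule f(3)[OF p q])
    moreover have "f p = p'" "f q = p'" using f(1)[OF p] f(1)[OF q(1)] p' by auto
    ultimately show ?thesis using asym'[of p' p'] by simp
  next
    case (Node ts')
    obtain tt' h' where "ts' \<noteq> {||}"
      and rep': "\<And>p. p \<in> P' \<Longrightarrow> rep lt' l' (tt' (h' p)) {q \<in> P'. h' q = h' p}"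
      and mem': "\<And>p. p \<in> P' \<Longrightarrow> tt' (h' p) |\<in>| ts'"
      and "\<And>t n. t |\<in>| ts' \<Longrightarrow> \<exists>p\<in>P'. (n :: nat) \<le> h' p \<and> tt' (h' p) = t"
      and lt': "\<And>p q. p \<in> P' \<Longrightarrow> q \<in> P' \<Longrightarrow> h' p < h' q \<Longrightarrow> lt' p q"
      by (rule rep_NodeE[OF rep_Node.prems(2)[unfolded Node]], rule that)
    have mono: "h' (f p) \<le> h' (f q)" if "p \<in> P" "q \<in> P" "lt p q" for p q
    proof (rule ccontr)
      assume "\<not> h' (f p) \<le> h' (f q)"
      then have "lt' (f q) (f p)" using lt' f(1) that by simp
      then show False using asym' f(3) that by blast
    qed
    have "\<exists>t. t |\<in>| ts' \<and> tree_le le s t" if s: "s |\<in>| ts" for s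
    proof -
      obtain p where p: "p \<in> P" "tt (h p) = s" using rep_Node.hyps(4)[OF s] by blast
      let ?B = "{q \<in> P. h q = h p}"
      obtain q where q: "q \<in> P" "h p < h q" using later[OF p(1)] by blast
      have "h' (f b) \<le> h' (f q)" if b: "b \<in> ?B" for b
        using mono[of b q] rep_Node.hyps(5)[of b q] b q by auto
      then have "(\<lambda>b. h' (f b)) ` ?B \<subseteq> {..h' (f q)}" by auto
      then have fin: "finite ((\<lambda>b. h' (f b)) ` ?B)" by (rule finite_subset) simp
      have "(\<lambda>b. h' (f b)) ` ?B \<noteq> {}" using p(1) by blast
      \<comment> \<open>From \<open>x\<close> on, the block is mapped into the last block of
        \<open>P'\<close> that it meets.\<close>
      from Max_in[OF fin this] obtain x where x: "x \<in> ?B" "h' (f x) = Max ((\<lambda>b. h' (f b)) ` ?B)"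
        by auto
      have mx: "h' (f b) \<le> h' (f x)" if "b \<in> ?B" for b using Max_ge[OF fin] that x(2) by auto
      have rB: "rep lt l s ?B" using rep_Node.hyps(2)[OF p(1)] p(2) by simp
      obtain B' where B': "B' \<subseteq> {y \<in> ?B. y = x \<or> lt x y}" "rep lt l s B'"
        by (rule rep_tail[OF rB x(1)], rule that)
      have lB: "l ` ?B \<subseteq> Q" and lB': "l ` B' \<subseteq> Q" using rep_Node.prems(1) B'(1) by blast+
      have "tree_le le s s" by (rule tree_le_refl[of Q, OF refl rep_ftrees[OF rB lB]])
      then have e1: "emb le lt l ?B lt l B'" using tree_le_imp_emb[OF asym rB B'(2)] by blast
      let ?C = "{q \<in> P'. h' q = h' (f x)}"
      have fC: "f b \<in> ?C" if "b \<in> B'" for b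
      proof -
        have b: "b \<in> ?B" "b = x \<or> lt x b" using B'(1) that by blast+
        have "h' (f x) \<le> h' (f b)" using b mono[of x b] x(1) by auto
        then show ?thesis using mx[OF b(1)] f(1)[of b] b(1) by simp
      qed
      have "B' \<subseteq> P" using B'(1) by blast
      then have e2: "emb le lt l B' lt' l' ?C"
        unfolding emb_def using f(2,3) fC by (intro exI[of _ f]) blast
      have lC: "l' ` ?C \<subseteq> Q" using rep_Node.prems(3) by blast
      have fx: "f x \<in> P'" using f(1) x(1) by blast
      have "emb le lt l ?B lt' l' ?C" by (rule emb_trans[OF e1 e2 tr lB lB' lC])
      then have "tree_le le s (tt' (h' (f x)))"
        using rep_Node.IH[OF p(1) lB rep'[OF fx] lC] p(2) by simp
      then show ?thesis using mem'[OF fx] by blast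
    qed
    then show ?thesis using Node by simp
  qed
qed

lemma rep_map:
  "rep lt l t P \<Longrightarrow> inj_on g P \<Longrightarrow> (\<And>p q. p \<in> P \<Longrightarrow> q \<in> P \<Longrightarrow> lt p q \<Longrightarrow> lt' (g p) (g q)) \<Longrightarrow>
    (\<And>p. p \<in> P \<Longrightarrow> l' (g p) = l p) \<Longrightarrow> rep lt' l' t (g ` P)"
proof (induction rule: rep.induct)
  case (rep_Leaf p)
  then show ?case using rep.rep_Leaf[of lt' l' "g p"] by simp
next
  case (rep_Node ts P tt h)
  let ?h = "h \<circ> inv_into P g"
  have hg: "?h (g p) = h p" if "p \<in> P" for p using inv_into_f_f[OF rep_Node.prems(1) that] by simp
  show ?case
  proof (rule rep.rep_Node[where tt = tt and h = ?h, OF rep_Node.hyps(1)])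
    fix p assume "p \<in> g ` P"
    then obtain x where x: "x \<in> P" "p = g x" by blast
    have eq: "{q \<in> g ` P. ?h q = ?h p} = g ` {q \<in> P. h q = h x}"
    proof (intro equalityI subsetI)
      fix q assume "q \<in> {q \<in> g ` P. ?h q = ?h p}"
      then obtain y where "y \<in> P" "q = g y" "?h q = ?h p" by blast
      then show "q \<in> g ` {q \<in> P. h q = h x}" using hg x by auto
    qed (use hg x in auto)
    have "tt (?h p) = tt (h x)" using hg[OF x(1)] x(2) by simp
    moreover have "rep lt' l' (tt (h x)) (g ` {q \<in> P. h q = h x})"
      by (rule rep_Node.IH[OF x(1)]) (use rep_Node.prems in \<open>auto intro: inj_on_subset\<close>)
    ultimately show "rep lt' l' (tt (?h p)) {q \<in> g ` P. ?h q = ?h p}" by (simp only: eq)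
    show "tt (?h p) |\<in>| ts" using rep_Node.hyps(3)[OF x(1)] hg[OF x(1)] x(2) by simp
  next
    fix t n assume "t |\<in>| ts"
    then obtain p where "p \<in> P" "n \<le> h p" "tt (h p) = t" using rep_Node.hyps(4) by blast
    then show "\<exists>p\<in>g ` P. n \<le> ?h p \<and> tt (?h p) = t" using hg by (intro bexI[of _ "g p"]) auto
  next
    fix p q assume "p \<in> g ` P" "q \<in> g ` P" "?h p < ?h q"
    then obtain x y where "x \<in> P" "p = g x" "y \<in> P" "q = g y" "?h p < ?h q" by blast
    then show "lt' p q" using hg rep_Node.hyps(5) rep_Node.prems(2) by simp
  qed
qed

section \<open>Invariance of the maximal order type under equivalence\<close>

lemma lin_cls_eq_iff:
  assumes "linearization A le L" "x \<in> A" "y \<in> A"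
  shows "lin_cls A L x = lin_cls A L y \<longleftrightarrow> L x y \<and> L y x"
proof
  have refl: "L x x" "L y y" using assms unfolding linearization_def by blast+
  assume "lin_cls A L x = lin_cls A L y"
  then show "L x y \<and> L y x" using assms(2,3) refl unfolding lin_cls_def by blast
next
  have tr: "L u w" if "u \<in> A" "v \<in> A" "w \<in> A" "L u v" "L v w" for u v w
    using assms(1) that unfolding linearization_def by blast
  assume "L x y \<and> L y x"
  then show "lin_cls A L x = lin_cls A L y" using tr assms(2,3) unfolding lin_cls_def by blast
qed

text \<open>\<open>lin_type\<close> lives on equivalence classes, where a map that preserves and
  reflects the order and meets every class is an isomorphism.\<close>

lemma lin_type_transfer:
  assumes wo: "Well_order (lin_type A L)" and L: "linearization A le L" and L': "linearization B le' L'"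
    and f: "\<And>x. x \<in> A \<Longrightarrow> f x \<in> B" "\<And>x y. x \<in> A \<Longrightarrow> y \<in> A \<Longrightarrow> L x y \<longleftrightarrow> L' (f x) (f y)"
    and surj: "\<And>y. y \<in> B \<Longrightarrow> \<exists>x\<in>A. L' (f x) y \<and> L' y (f x)"
  shows "lin_type A L =o lin_type B L'"
proof -
  define g where "g c = lin_cls B L' (f (SOME x. x \<in> A \<and> lin_cls A L x = c))" for c
  have g: "g (lin_cls A L x) = lin_cls B L' (f x)" if x: "x \<in> A" for x
  proof -
    let ?y = "SOME y. y \<in> A \<and> lin_cls A L y = lin_cls A L x"
    have y: "?y \<in> A \<and> lin_cls A L ?y = lin_cls A L x" by (rule someI[of _ x]) (use x in blast)
    then have "L ?y x \<and> L x ?y" using lin_cls_eq_iff[OF L _ x] by blast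
    then have "L' (f ?y) (f x) \<and> L' (f x) (f ?y)" using f(2) x y by blast
    then show ?thesis unfolding g_def using lin_cls_eq_iff[OF L' f(1) f(1)[OF x]] y by blast
  qed
  have refl: "L x x" if "x \<in> A" for x using L that unfolding linearization_def by blast
  have Fld: "Field (lin_type A L) = lin_cls A L ` A"
    unfolding lin_type_def Field_def using refl by fast
  have "inj_on g (Field (lin_type A L))"
    unfolding Fld
  proof (rule inj_onI, elim imageE)
    fix c d x y assume xy: "c = lin_cls A L x" "x \<in> A" "d = lin_cls A L y" "y \<in> A" "g c = g d"
    then have "L' (f x) (f y) \<and> L' (f y) (f x)" using g lin_cls_eq_iff[OF L' f(1) f(1)] by metis
    then show "c = d" using lin_cls_eq_iff[OF L] xy f(2) by blast
  qed
  moreover have "lin_type B L' = dir_image (lin_type A L) g"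
  proof (intro equalityI subsetI)
    fix p assume "p \<in> lin_type B L'"
    then obtain x y where p: "p = (lin_cls B L' x, lin_cls B L' y)" "x \<in> B" "y \<in> B" "L' x y"
      unfolding lin_type_def by blast
    obtain x' where x': "x' \<in> A" "L' (f x') x" "L' x (f x')" using surj[OF p(2)] by blast
    obtain y' where y': "y' \<in> A" "L' (f y') y" "L' y (f y')" using surj[OF p(3)] by blast
    have tr: "L' u w" if "u \<in> B" "v \<in> B" "w \<in> B" "L' u v" "L' v w" for u v w
      using L' that unfolding linearization_def by blast
    have "L' (f x') (f y')"
      using tr[OF f(1)[OF x'(1)] p(2,3) x'(2) p(4)] tr[OF f(1)[OF x'(1)] p(3) f(1)[OF y'(1)] _ y'(3)] by blast
    then have "(lin_cls A L x', lin_cls A L y') \<in> lin_type A L"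
      unfolding lin_type_def using f(2) x' y' by blast
    moreover have "p = (g (lin_cls A L x'), g (lin_cls A L y'))"
      unfolding g[OF x'(1)] g[OF y'(1)] p(1)
      using lin_cls_eq_iff[OF L' p(2) f(1)[OF x'(1)]] lin_cls_eq_iff[OF L' p(3) f(1)[OF y'(1)]] x' y' by blast
    ultimately show "p \<in> dir_image (lin_type A L) g" unfolding dir_image_def by blast
  next
    fix p assume "p \<in> dir_image (lin_type A L) g"
    then obtain c d where p: "p = (g c, g d)" "(c, d) \<in> lin_type A L" unfolding dir_image_def by blast
    then obtain x y where xy: "c = lin_cls A L x" "d = lin_cls A L y" "x \<in> A" "y \<in> A" "L x y"
      unfolding lin_type_def by blast
    have "p = (lin_cls B L' (f x), lin_cls B L' (f y))" using p(1) xy g by simp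
    moreover have "L' (f x) (f y)" using f(2) xy by blast
    ultimately show "p \<in> lin_type B L'" unfolding lin_type_def using f(1) xy(3,4) by blast
  qed
  ultimately show ?thesis using dir_image_ordIso[OF wo] by metis
qed

text \<open>Linearizations of \<open>B\<close> are pulled back along \<open>f\<close>, those of
  \<open>A\<close> along a choice \<open>k\<close> of preimages up to equivalence; both ways keep
  the type.\<close>

lemma is_max_order_type_transfer:
  assumes m: "is_max_order_type A le r"
    and f: "\<And>x. x \<in> A \<Longrightarrow> f x \<in> B" "\<And>x y. x \<in> A \<Longrightarrow> y \<in> A \<Longrightarrow> le x y \<longleftrightarrow> le' (f x) (f y)"
    and surj: "\<And>y. y \<in> B \<Longrightarrow> \<exists>x\<in>A. le' (f x) y \<and> le' y (f x)"
    and tr: "\<And>x y z. x \<in> B \<Longrightarrow> y \<in> B \<Longrightarrow> z \<in> B \<Longrightarrow> le' x y \<Longrightarrow> le' y z \<Longrightarrow> le' x z"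
  shows "is_max_order_type B le' r"
  unfolding is_max_order_type_def
proof (intro conjI allI impI ballI)
  show "Well_order r" using m unfolding is_max_order_type_def by blast
  have mle: "lin_type A L \<le>o r" if "linearization A le L" for L
    using m that unfolding is_max_order_type_def by blast
  {
    fix L' assume L': "linearization B le' L'"
    have L'r: "L' x x" if "x \<in> B" for x using L' that unfolding linearization_def by blast
    have L't: "L' x z" if "x \<in> B" "y \<in> B" "z \<in> B" "L' x y" "L' y z" for x y z
      using L' that unfolding linearization_def by blast
    have L'tot: "L' x y \<or> L' y x" if "x \<in> B" "y \<in> B" for x y
      using L' that unfolding linearization_def by blast
    have L'e: "L' x y" if "x \<in> B" "y \<in> B" "le' x y" for x y
      using L' that unfolding linearization_def by blast
    define L where "L x y \<longleftrightarrow> L' (f x) (f y)" for x y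
    have L: "linearization A le L"
      unfolding linearization_def L_def
    proof (intro conjI ballI impI)
      fix x assume x: "x \<in> A"
      show "L' (f x) (f x)" by (rule L'r[OF f(1)[OF x]])
      fix y assume y: "y \<in> A"
      show "L' (f x) (f y) \<or> L' (f y) (f x)" by (rule L'tot[OF f(1)[OF x] f(1)[OF y]])
      show "L' (f x) (f y)" if "le x y" using L'e[OF f(1)[OF x] f(1)[OF y]] f(2)[OF x y] that by blast
      fix z assume z: "z \<in> A"
      show "L' (f x) (f z)" if "L' (f x) (f y)" "L' (f y) (f z)"
        by (rule L't[OF f(1)[OF x] f(1)[OF y] f(1)[OF z] that])
    qed
    have "lin_type A L =o lin_type B L'"
    proof (rule lin_type_transfer[OF _ L L'])
      show "Well_order (lin_type A L)" using mle[OF L] unfolding ordLeq_def by blast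
      fix y assume y: "y \<in> B"
      then obtain x where x: "x \<in> A" "le' (f x) y" "le' y (f x)" using surj by blast
      then show "\<exists>x\<in>A. L' (f x) y \<and> L' y (f x)"
        using L'e[OF y f(1)[OF x(1)]] L'e[OF f(1)[OF x(1)] y] by blast
    qed (use f(1) L_def in auto)
    then show "lin_type B L' \<le>o r" using mle[OF L] by (meson ordIso_ordLeq_trans ordIso_symmetric)
  next
    fix u assume "u \<in> Field r"
    then obtain L where L: "linearization A le L" "Restr r (underS r u) <o lin_type A L"
      using m unfolding is_max_order_type_def by blast
    have "\<forall>y\<in>B. \<exists>x. x \<in> A \<and> le' (f x) y \<and> le' y (f x)" using surj by blast
    then obtain k where k: "\<And>y. y \<in> B \<Longrightarrow> k y \<in> A" "\<And>y. y \<in> B \<Longrightarrow> le' (f (k y)) y"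
      "\<And>y. y \<in> B \<Longrightarrow> le' y (f (k y))" by metis
    define L' where "L' x y \<longleftrightarrow> L (k x) (k y)" for x y
    have ext: "L x y" if "x \<in> A" "y \<in> A" "le' (f x) (f y)" for x y
      using L(1) f(2) that unfolding linearization_def by blast
    have Lr: "L x x" if "x \<in> A" for x using L(1) that unfolding linearization_def by blast
    have Ltot: "L x y \<or> L y x" if "x \<in> A" "y \<in> A" for x y
      using L(1) that unfolding linearization_def by blast
    have Lt: "L x z" if "x \<in> A" "y \<in> A" "z \<in> A" "L x y" "L y z" for x y z
      using L(1) that unfolding linearization_def by blast
    have L': "linearization B le' L'"
      unfolding linearization_def L'_def
    proof (intro conjI ballI impI)
      fix x assume x: "x \<in> B"
      show "L (k x) (k x)" using Lr k(1)[OF x] by blast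
      fix y assume y: "y \<in> B"
      show "L (k x) (k y) \<or> L (k y) (k x)" using Ltot k(1)[OF x] k(1)[OF y] by blast
      show "L (k x) (k y)" if xy: "le' x y"
      proof -
        have "le' (f (k x)) y" by (rule tr[OF f(1)[OF k(1)[OF x]] x y k(2)[OF x] xy])
        then have "le' (f (k x)) (f (k y))"
          using tr[OF f(1)[OF k(1)[OF x]] y f(1)[OF k(1)[OF y]] _ k(3)[OF y]] by blast
        then show ?thesis using ext k(1)[OF x] k(1)[OF y] by blast
      qed
      fix z assume z: "z \<in> B"
      show "L (k x) (k z)" if "L (k x) (k y)" "L (k y) (k z)"
        by (rule Lt[OF k(1)[OF x] k(1)[OF y] k(1)[OF z] that])
    qed
    have kf: "L x (k (f x))" "L (k (f x)) x" if "x \<in> A" for x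
      using ext k f(1) that by blast+
    have "lin_type A L =o lin_type B L'"
    proof (rule lin_type_transfer[OF _ L(1) L'])
      show "Well_order (lin_type A L)" using L(2) unfolding ordLess_def by blast
      show "f x \<in> B" if "x \<in> A" for x using f(1) that .
      show "L x y \<longleftrightarrow> L' (f x) (f y)" if xy: "x \<in> A" "y \<in> A" for x y
      proof -
        have m: "k (f x) \<in> A" "k (f y) \<in> A" using k(1) f(1) xy by blast+
        show ?thesis unfolding L'_def
        proof
          assume "L x y"
          then have "L (k (f x)) y" by (rule Lt[OF m(1) xy kf(2)[OF xy(1)]])
          then show "L (k (f x)) (k (f y))" by (rule Lt[OF m(1) xy(2) m(2) _ kf(1)[OF xy(2)]])
        next
          assume "L (k (f x)) (k (f y))"
          then have "L x (k (f y))" by (rule Lt[OF xy(1) m kf(1)[OF xy(1)]])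
          then show "L x y" by (rule Lt[OF xy(1) m(2) xy(2) _ kf(2)[OF xy(2)]])
        qed
      qed
      fix y assume y: "y \<in> B"
      show "\<exists>x\<in>A. L' (f x) y \<and> L' y (f x)"
        using kf[OF k(1)[OF y]] k(1)[OF y] unfolding L'_def by blast
    qed
    then show "\<exists>L. linearization B le' L \<and> Restr r (underS r u) <o lin_type B L"
      using L' L(2) ordLess_ordIso_trans by blast
  }
qed

section \<open>Sequences that spell out a given tree\<close>

definition mle :: "nat multiset rel" where
  "mle = {(M, N). M \<le> N}"

lemma Field_mle [simp]: "Field mle = UNIV"
  unfolding mle_def Field_def by auto

lemma Well_order_mle: "Well_order mle"
proof -
  have "wf (mle - Id)" by (rule wf_subset[OF wf]) (auto simp: mle_def)
  then show ?thesis
    unfolding well_order_on_def linear_order_on_def partial_order_on_def preorder_on_def Field_mle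
    by (auto simp: refl_on_def trans_def antisym_def total_on_def mle_def)
qed

lemma mle_omega_pow: "mle =o omega_pow natLeq"
proof -
  let ?P = "mset_fun (Field natLeq) (id :: nat \<Rightarrow> nat)"
  have lt: "(x, y) \<in> natLeq \<longleftrightarrow> id x \<le> id y" for x y by (simp add: natLeq_def)
  have wo: "Well_order natLeq" by (rule natLeq_Well_order)
  have inj: "inj_on id (Field natLeq)" by simp
  have b: "bij_betw ?P UNIV (fsupp natLeq)"
  proof -
    have "{M :: nat multiset. set_mset M \<subseteq> id ` Field natLeq} = UNIV" by (simp add: Field_natLeq)
    then show ?thesis using mset_fun_bij[OF wo inj lt] by (simp only:)
  qed
  have op: "(?P M, ?P N) \<in> omega_pow natLeq \<longleftrightarrow> M \<le> N" for M N
    by (rule mset_fun_omega_pow[OF wo inj lt]) (auto simp: Field_natLeq)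
  have "omega_pow natLeq = dir_image mle ?P"
  proof (intro equalityI subsetI)
    fix p assume p: "p \<in> omega_pow natLeq"
    obtain f g where fg: "p = (f, g)" by (cases p)
    then have "f \<in> fsupp natLeq" "g \<in> fsupp natLeq" using p unfolding omega_pow_def by auto
    then obtain M N where "f = ?P M" "g = ?P N" using b unfolding bij_betw_def by (metis imageE)
    then show "p \<in> dir_image mle ?P" using p op fg unfolding dir_image_def mle_def by blast
  next
    fix p assume "p \<in> dir_image mle ?P"
    then show "p \<in> omega_pow natLeq" using op unfolding dir_image_def mle_def by blast
  qed
  moreover have "inj_on ?P (Field mle)" using b by (simp add: bij_betw_def)
  ultimately show ?thesis using dir_image_ordIso[OF Well_order_mle] by metis
qed

text \<open>Positions of an \<open>'a tseq\<close> are natural numbers, so multisets used as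
  positions have to be coded.\<close>

definition mcode :: "nat multiset \<Rightarrow> nat" where
  "mcode M = to_nat (sorted_list_of_multiset M)"

lemma inj_mcode: "inj mcode"
proof (rule injI)
  fix M N assume "mcode M = mcode N"
  then have "sorted_list_of_multiset M = sorted_list_of_multiset N" unfolding mcode_def by simp
  then show "M = N" by (metis mset_sorted_list_of_multiset)
qed

lemma small_mset: "small TYPE(unit) (A :: nat multiset set)"
  unfolding small_def
  by (rule exI[of _ "Inr \<circ> mcode"]) (meson comp_inj_on inj_Inr inj_mcode inj_on_subset subset_UNIV)

text \<open>A set of multisets below \<open>K\<close> has at most the type of the initial segment
  below \<open>K\<close>, by comparing both as ordinals.\<close>

lemma Restr_mle_ordLess:
  assumes "\<And>M. M \<in> P \<Longrightarrow> M < K"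
  shows "Restr mle P <o mle"
proof -
  let ?s = "Restr mle (underS mle K)"
  have us: "underS mle K = {M. M < K}" unfolding underS_def mle_def by auto
  have wo: "Well_order (Restr mle P)" "Well_order ?s" by (rule Well_order_Restr[OF Well_order_mle])+
  have F: "Field (Restr mle P) = P" "Field ?s = {M. M < K}"
    using Field_Restr_Well_order[OF Well_order_mle] us by auto
  obtain a :: "unit ordinal" where a: "Restr mle P =o oseg a"
    by (rule Well_order_oseg_ex[OF wo(1)]) (rule small_mset)
  obtain b :: "unit ordinal" where b: "?s =o oseg b"
    by (rule Well_order_oseg_ex[OF wo(2)]) (rule small_mset)
  obtain G where G: "bij_betw G P {..<a}"
    "\<And>x y. x \<in> P \<Longrightarrow> y \<in> P \<Longrightarrow> (x, y) \<in> Restr mle P \<longleftrightarrow> G x \<le> G y"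
    by (rule ordIso_osegE[OF a, unfolded F(1)], rule that)
  obtain H where H: "bij_betw H {M. M < K} {..<b}"
    "\<And>x y. x \<in> {M. M < K} \<Longrightarrow> y \<in> {M. M < K} \<Longrightarrow> (x, y) \<in> ?s \<longleftrightarrow> H x \<le> H y"
    by (rule ordIso_osegE[OF b, unfolded F(2)], rule that)
  have G': "x \<le> y \<longleftrightarrow> G x \<le> G y" if "x \<in> P" "y \<in> P" for x y
    using G(2)[OF that] that unfolding mle_def by auto
  have H': "x \<le> y \<longleftrightarrow> H x \<le> H y" if "x < K" "y < K" for x y
    using H(2)[of x y] that unfolding us by (auto simp: mle_def)
  let ?i = "inv_into P G"
  have i: "?i c \<in> P" "G (?i c) = c" if "c < a" for c
    using G(1) that unfolding bij_betw_def by (auto simp: inv_into_into f_inv_into_f)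
  have "a \<le> b"
  proof (rule strict_mono_le)
    show "H (?i c) < b" if "c < a" for c using H(1) assms[OF i(1)[OF that]] unfolding bij_betw_def by blast
    show "H (?i c) < H (?i d)" if cd: "c < d" "d < a" for c d
    proof -
      have ca: "c < a" using cd by simp
      have "\<not> ?i d \<le> ?i c" using G'[OF i(1)[OF cd(2)] i(1)[OF ca]] i(2)[OF cd(2)] i(2)[OF ca] cd(1) by simp
      then show ?thesis using H'[OF assms[OF i(1)[OF cd(2)]] assms[OF i(1)[OF ca]]] by simp
    qed
  qed
  then have "oseg a \<le>o oseg b" by (simp add: oseg_le_iff)
  then have "Restr mle P \<le>o ?s"
    by (rule ordLeq_ordIso_trans[OF ordIso_ordLeq_trans[OF a] ordIso_symmetric[OF b]])
  moreover have "?s <o mle" by (rule underS_Restr_ordLess[OF Well_order_mle]) simp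
  ultimately show ?thesis by (rule ordLeq_ordLess_trans)
qed

text \<open>With n bounding the heights of the children, block i is placed at the multiple i of
  \<open>\<omega>\<^sup>n\<close>. The coefficient of n recovers the block, and a tree of height k
  has length at most \<open>\<omega>\<^sup>k\<close>.\<close>

lemma tree_positions:
  "t \<in> ftrees Q \<Longrightarrow> \<exists>(P :: nat multiset set) l. rep (<) l t P \<and> (\<forall>M\<in>P. M < {#height t#})"
proof (induction rule: ftrees.induct)
  case (leaf x)
  have "rep (<) (\<lambda>_. x) (Leaf x) {{#} :: nat multiset}"
    using rep_Leaf[of "(<)" "\<lambda>_. x" "{#} :: nat multiset"] by simp
  then show ?case by (intro exI[of _ "{{#}}"]) auto
next
  case (node ts)
  obtain xs where xs: "set xs = fset ts" using finite_list[OF finite_fset[of ts]] by blast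
  have "fset ts \<noteq> {}" using node(1) by (metis bot_fset.rep_eq fset_inject)
  then have len: "0 < length xs" using xs by auto
  \<comment> \<open>Running through the children cyclically makes each recur infinitely
    often.\<close>
  define tt where "tt i = xs ! (i mod length xs)" for i
  have tts: "tt i |\<in>| ts" for i
    using xs len nth_mem[of "i mod length xs" xs] unfolding tt_def by auto
  have inf: "\<exists>i\<ge>n. tt i = t" if t: "t |\<in>| ts" for t n
  proof -
    obtain j where j: "j < length xs" "xs ! j = t" using t xs by (metis in_set_conv_nth)
    have "tt (n * length xs + j) = t" unfolding tt_def using j by simp
    moreover have "n \<le> n * length xs + j" using len by (cases "length xs") auto
    ultimately show ?thesis by blast
  qed
  have "\<forall>t. \<exists>P l. t |\<in>| ts \<longrightarrow> rep (<) l t (P :: nat multiset set) \<and> (\<forall>M\<in>P. M < {#height t#})"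
    using node(3) by blast
  then obtain PP ll where PL: "\<And>t. t |\<in>| ts \<Longrightarrow> rep (<) (ll t) t (PP t :: nat multiset set)"
    "\<And>t M. t |\<in>| ts \<Longrightarrow> M \<in> PP t \<Longrightarrow> M < {#height t#}" by metis
  obtain n where n: "height (Node ts) = Suc n" by simp
  define blk where "blk i M = replicate_mset i n + M" for i and M :: "nat multiset"
  define P where "P = (\<Union>i. blk i ` PP (tt i))"
  define h where "h K = count K n" for K :: "nat multiset"
  \<comment> \<open>Subtracting the shift recovers the position in the sequence of the
    child.\<close>
  define l where "l K = ll (tt (h K)) (K - replicate_mset (h K) n)" for K
  have small: "x < n" if "M \<in> PP (tt i)" "x \<in># M" for x M i
    using PL(2)[OF tts that(1)] that(2) height_child[OF tts[of i]] n by force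
  have hb: "h (blk i M) = i" if "M \<in> PP (tt i)" for i M
  proof -
    have "n \<notin># M" using small[OF that] by blast
    then show ?thesis unfolding h_def blk_def by (simp add: not_in_iff)
  qed
  have lb: "l (blk i M) = ll (tt i) M" if "M \<in> PP (tt i)" for i M
    unfolding l_def hb[OF that] unfolding blk_def by simp
  have fib: "{K \<in> P. h K = i} = blk i ` PP (tt i)" for i
    unfolding P_def using hb by auto
  have le_n: "x \<le> n" if K: "K \<in> P" "x \<in># K" for K x
  proof -
    obtain i M where M: "M \<in> PP (tt i)" "K = blk i M" using K(1) unfolding P_def by blast
    then have "x \<in># replicate_mset i n \<or> x \<in># M" using K(2) unfolding blk_def by auto
    then show ?thesis using small[OF M(1)] by (auto simp: less_imp_le split: if_splits)
  qed
  have "rep (<) l (Node ts) P"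
  proof (rule rep_Node[where tt = tt and h = h, OF node(1)])
    fix p assume "p \<in> P"
    have "rep (<) l (tt i) (blk i ` PP (tt i))" for i
    proof (rule rep_map[OF PL(1)[OF tts]])
      show "inj_on (blk i) (PP (tt i))" by (simp add: blk_def inj_on_def)
      show "blk i M < blk i N" if "M < N" for M N using that by (simp add: blk_def)
    qed (rule lb)
    then show "rep (<) l (tt (h p)) {q \<in> P. h q = h p}" unfolding fib by simp
    show "tt (h p) |\<in>| ts" by (rule tts)
  next
    fix t m assume "t |\<in>| ts"
    then obtain i where i: "m \<le> i" "tt i = t" using inf by blast
    obtain M where "M \<in> PP (tt i)" using rep_nonempty[OF PL(1)[OF tts]] by blast
    then have "blk i M \<in> P" "h (blk i M) = i" using hb unfolding P_def by auto
    then show "\<exists>p\<in>P. m \<le> h p \<and> tt (h p) = t" using i by (intro bexI[of _ "blk i M"]) auto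
  next
    fix p q assume pq: "p \<in> P" "q \<in> P" "h p < h q"
    have "p \<noteq> q" using pq(3) by auto
    moreover have "\<exists>x>y. count p x < count q x" if "count q y < count p y" for y
    proof -
      have "y \<in># p" using that by (metis count_greater_zero_iff gr_zeroI not_less_zero)
      moreover have "y \<noteq> n" using that pq(3) unfolding h_def by auto
      ultimately have "y < n" using le_n[OF pq(1)] by fastforce
      then show ?thesis using pq(3) unfolding h_def by blast
    qed
    ultimately show "p < q" unfolding less_multiset\<^sub>H\<^sub>O by blast
  qed
  moreover have "\<forall>M\<in>P. M < {#height (Node ts)#}" using le_n n by (auto simp: less_Suc_eq_le)
  ultimately show ?case by blast
qed

abbreviation slt :: "'i rel \<Rightarrow> 'i \<Rightarrow> 'i \<Rightarrow> bool" where
  "slt r p q \<equiv> (p, q) \<in> r \<and> p \<noteq> q"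

lemma seq_emb_emb: "seq_emb le s t \<longleftrightarrow>
    emb le (slt (fst s)) (snd s) (Field (fst s)) (slt (fst t)) (snd t) (Field (fst t))"
  unfolding seq_emb_def emb_def by blast

lemma slt_asym: "Well_order r \<Longrightarrow> slt r p q \<Longrightarrow> \<not> slt r q p"
  unfolding well_order_on_def linear_order_on_def partial_order_on_def by (meson antisymD)

lemma emb_slt_cong:
  assumes "\<And>p q. p \<in> P \<Longrightarrow> q \<in> P \<Longrightarrow> lt1 p q \<longleftrightarrow> lt2 p q" "P' \<subseteq> P"
  shows "emb le lt l A lt1 l' P' \<longleftrightarrow> emb le lt l A lt2 l' P'"
  unfolding emb_def using assms by (intro iff_exI) (auto simp: subset_iff)

text \<open>Each proper tail contains a spelling of \<open>t\<close> by \<open>rep_tail\<close>, and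
  the sequence embeds there because \<open>t\<close> is below itself; so it is
  indecomposable.\<close>

lemma seq_of_tree:
  assumes t: "t \<in> ftrees Q" and refl: "\<And>x. x \<in> Q \<Longrightarrow> le x x"
  shows "\<exists>s\<in>iF_omega_omega Q le. rep (slt (fst s)) (snd s) t (Field (fst s))"
proof -
  obtain P :: "nat multiset set" and l where P: "rep (<) l t P" "\<forall>M\<in>P. M < {#height t#}"
    using tree_positions[OF t] by blast
  define r where "r = dir_image (Restr mle P) mcode"
  define l' where "l' = l \<circ> inv mcode"
  have FP: "Field (Restr mle P) = P" by (rule Field_Restr_Well_order[OF Well_order_mle]) simp
  have "inj_on mcode (Field (Restr mle P))" using inj_mcode inj_on_subset by blast
  then have iso: "Restr mle P =o r"
    unfolding r_def by (rule dir_image_ordIso[OF Well_order_Restr[OF Well_order_mle]])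
  then have wo: "Well_order r" unfolding ordIso_def by blast
  have rm: "(mcode M, mcode N) \<in> r \<longleftrightarrow> M \<in> P \<and> N \<in> P \<and> M \<le> N" for M N
    unfolding r_def dir_image_def mle_def using inj_mcode by (auto simp: inj_eq)
  have Fr: "Field r = mcode ` P"
    using dir_image_Field[of "Restr mle P" mcode] FP unfolding r_def by simp
  have rep: "rep (slt r) l' t (Field r)"
    unfolding Fr
    by (rule rep_map[OF P(1)])
      (use inj_mcode rm in \<open>auto simp: l'_def inj_eq inv_f_f intro: inj_on_subset\<close>)
  have lt: "r <o omega_pow natLeq"
  proof -
    have "r =o Restr mle P" using iso ordIso_symmetric by blast
    also have "Restr mle P <o mle" by (rule Restr_mle_ordLess) (use P(2) in blast)
    also have "mle =o omega_pow natLeq" by (rule mle_omega_pow)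
    finally show ?thesis .
  qed
  have labels: "l' ` Field r \<subseteq> set_ftree t" using rep_labels[OF rep] by blast
  have setQ: "set_ftree t \<subseteq> Q" using t by (induction rule: ftrees.induct) auto
  have fin: "finite (set_ftree t)" using t by (induction rule: ftrees.induct) auto
  have "indecomposable le (r, l')"
    unfolding indecomposable_def
  proof
    fix u assume "u \<in> proper_tails (r, l')"
    then obtain x where x: "u = (Restr r (above r x), l')" "x \<in> Field r"
      unfolding proper_tails_def by auto
    have sub: "above r x \<subseteq> Field r" unfolding above_def Field_def by auto
    have Fu: "Field (fst u) = above r x" unfolding x(1) fst_conv by (rule Field_Restr_Well_order[OF wo sub])
    obtain P' where P': "P' \<subseteq> {y \<in> Field r. y = x \<or> slt r x y}" "rep (slt r) l' t P'"
      by (rule rep_tail[OF rep x(2)], rule that)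
    have "(x, x) \<in> r" using wo x(2) unfolding well_order_on_def linear_order_on_def
      partial_order_on_def preorder_on_def refl_on_def by blast
    then have P'a: "P' \<subseteq> above r x" using P'(1) unfolding above_def by blast
    have "tree_le le t t" by (rule tree_le_refl[OF refl t])
    then have "emb le (slt r) l' (Field r) (slt r) l' P'"
      using tree_le_imp_emb[OF slt_asym[OF wo] rep P'(2)] by blast
    then have "emb le (slt r) l' (Field r) (slt r) l' (above r x)" using emb_mono P'a by blast
    then show "seq_emb le (r, l') u"
      unfolding seq_emb_emb Fu unfolding x(1) fst_conv snd_conv
      by (subst emb_slt_cong[of "above r x" _ "slt r"]) auto
  qed
  then have "(r, l') \<in> iF_omega_omega Q le"
    unfolding iF_omega_omega_def
    using wo lt rep_nonempty[OF rep] labels setQ finite_subset[OF labels fin] by auto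
  then show ?thesis using rep by (intro bexI[of _ "(r, l')"]) simp_all
qed

section \<open>Cutting sequences into blocks that spell trees\<close>

definition decomposed :: "('i \<Rightarrow> 'i \<Rightarrow> bool) \<Rightarrow> ('i \<Rightarrow> 'a) \<Rightarrow> 'a ftree set \<Rightarrow> 'i set \<Rightarrow> ('i \<Rightarrow> nat) \<Rightarrow> bool" where
  "decomposed lt l F P h \<longleftrightarrow> (\<forall>p\<in>P. \<exists>t\<in>F. rep lt l t {q \<in> P. h q = h p}) \<and>
     (\<forall>p\<in>P. \<forall>q\<in>P. h p < h q \<longrightarrow> lt p q)"

text \<open>If only finitely many trees occur, those occurring in an \<open>\<omega>\<close>-sequence of blocks from some
  point on all recur, so that the remaining blocks together spell a node.\<close>
lemma decomposed_bounded:
  assumes F: "finite F" and dec: "decomposed lt l F P H"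
  obtains h k where "decomposed lt l (F \<union> {Node ts | ts. fset ts \<subseteq> F}) P h" "\<And>p. p \<in> P \<Longrightarrow> h p < (k :: nat)"
proof (cases "\<exists>k. \<forall>p\<in>P. H p < k")
  case True
  then obtain k where "\<And>p. p \<in> P \<Longrightarrow> H p < k" by blast
  moreover have "decomposed lt l (F \<union> {Node ts | ts. fset ts \<subseteq> F}) P H"
    using dec unfolding decomposed_def by blast
  ultimately show ?thesis using that by blast
next
  case False
  have mono: "lt p q" if "p \<in> P" "q \<in> P" "H p < H q" for p q
    using dec that unfolding decomposed_def by blast
  have "\<exists>t. t \<in> F \<and> rep lt l t {q \<in> P. H q = H p}" if "p \<in> P" for p
    using dec that unfolding decomposed_def by blast
  note ex = this
  define tt where "tt i = (SOME t. t \<in> F \<and> rep lt l t {q \<in> P. H q = i})" for i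
  have tt: "tt (H p) \<in> F" "rep lt l (tt (H p)) {q \<in> P. H q = H p}" if "p \<in> P" for p
    using someI_ex[OF ex[OF that]] unfolding tt_def by blast+
  define TY where "TY = {t \<in> F. \<forall>n. \<exists>p\<in>P. n \<le> H p \<and> tt (H p) = t}"
  have "\<forall>t\<in>F - TY. \<exists>n. \<forall>p\<in>P. n \<le> H p \<longrightarrow> tt (H p) \<noteq> t" unfolding TY_def by blast
  then obtain b where b: "\<And>t p. t \<in> F - TY \<Longrightarrow> p \<in> P \<Longrightarrow> b t \<le> H p \<Longrightarrow> tt (H p) \<noteq> t" by metis
  \<comment> \<open>Each tree of \<open>F\<close> outside \<open>TY\<close> is absent from
    \<open>b t\<close> on; the sum bounds these numbers simultaneously.\<close>
  define N where "N = (\<Sum>t\<in>F. b t)"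
  have TY: "tt (H p) \<in> TY" if p: "p \<in> P" "N \<le> H p" for p
  proof (rule ccontr)
    assume "tt (H p) \<notin> TY"
    then have m: "tt (H p) \<in> F - TY" using tt(1)[OF p(1)] by blast
    then have "b (tt (H p)) \<le> N" unfolding N_def using F by (intro member_le_sum) auto
    then show False using b[OF m p(1)] p(2) by simp
  qed
  have fsT: "fset (Abs_fset TY) = TY"
    by (rule Abs_fset_inverse) (use F in \<open>simp add: TY_def\<close>)
  let ?T = "{p \<in> P. N \<le> H p}"
  have "rep lt l (Node (Abs_fset TY)) ?T"
  proof (rule rep_Node[where tt = tt and h = H])
    obtain p where "p \<in> P" "N \<le> H p" using False by (meson not_le)
    then have "fset (Abs_fset TY) \<noteq> {}" unfolding fsT using TY by blast
    then show "Abs_fset TY \<noteq> {||}" by (metis bot_fset.rep_eq)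
  next
    fix p assume p: "p \<in> ?T"
    then have "{q \<in> ?T. H q = H p} = {q \<in> P. H q = H p}" by auto
    then show "rep lt l (tt (H p)) {q \<in> ?T. H q = H p}" using tt(2)[of p] p by simp
    show "tt (H p) |\<in>| Abs_fset TY" unfolding fsT using TY p by blast
  next
    fix t n assume "t |\<in>| Abs_fset TY"
    then have "t \<in> TY" unfolding fsT .
    then have "\<forall>n. \<exists>p\<in>P. n \<le> H p \<and> tt (H p) = t" unfolding TY_def by blast
    then obtain p where "p \<in> P" "max n N \<le> H p" "tt (H p) = t" by blast
    then show "\<exists>p\<in>?T. n \<le> H p \<and> tt (H p) = t" by auto
  qed (use mono in blast)
  moreover have "Node (Abs_fset TY) \<in> {Node ts | ts. fset ts \<subseteq> F}" using fsT unfolding TY_def by blast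
  ultimately have T: "\<exists>t\<in>F \<union> {Node ts | ts. fset ts \<subseteq> F}. rep lt l t ?T" by blast
  \<comment> \<open>The minimum with \<open>N\<close> merges all blocks from \<open>N\<close> on
    into one, the one that spells the node.\<close>
  have "decomposed lt l (F \<union> {Node ts | ts. fset ts \<subseteq> F}) P (\<lambda>p. min (H p) N)"
    unfolding decomposed_def
  proof (intro conjI ballI impI)
    fix p assume p: "p \<in> P"
    show "\<exists>t\<in>F \<union> {Node ts | ts. fset ts \<subseteq> F}. rep lt l t {q \<in> P. min (H q) N = min (H p) N}"
    proof (cases "H p < N")
      case True
      then have "{q \<in> P. min (H q) N = min (H p) N} = {q \<in> P. H q = H p}" by (auto simp: min_def)
      then show ?thesis using tt[OF p] by auto
    next
      case False
      then have "{q \<in> P. min (H q) N = min (H p) N} = ?T" by (auto simp: min_def)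
      then show ?thesis using T by (simp only:)
    qed
    fix q assume "q \<in> P" "min (H p) N < min (H q) N"
    then show "lt p q" using mono[OF p] by (simp add: min_def split: if_splits)
  qed
  then show ?thesis using that[of "\<lambda>p. min (H p) N" "Suc N"] by (simp add: min_def less_Suc_eq_le)
qed

text \<open>The finite set \<open>F\<close> must not depend on \<open>P\<close>: the induction step
  has infinitely many pieces, and \<open>decomposed_bounded\<close> needs finitely many trees among
  all of them. The condition on \<open>v\<close> limits the length to
  \<open>\<omega>\<^sup>n\<close>.\<close>

lemma rep_decomposition:
  fixes l :: "'i \<Rightarrow> 'a"
  assumes "finite Q0"
  shows "\<exists>F. finite F \<and> (\<forall>P (v :: 'i \<Rightarrow> nat multiset). inj_on v P \<longrightarrow> (\<forall>p\<in>P. v p < {#n#}) \<longrightarrow>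
     (\<forall>p\<in>P. \<forall>q\<in>P. v p < v q \<longrightarrow> lt p q) \<longrightarrow> l ` P \<subseteq> Q0 \<longrightarrow>
     (\<exists>h k. decomposed lt l F P h \<and> (\<forall>p\<in>P. h p < (k :: nat))))"
proof (induction n)
  case 0
  have "\<exists>h k. decomposed lt l (Leaf ` Q0) P h \<and> (\<forall>p\<in>P. h p < (k :: nat))"
    if v: "inj_on v P" "\<forall>p\<in>P. v p < {#0#}" and l: "l ` P \<subseteq> Q0" for P and v :: "'i \<Rightarrow> nat multiset"
  proof -
    \<comment> \<open>Only the empty multiset is below \<open>{#0#}\<close>, so \<open>P\<close> has
      at most one position.\<close>
    have e: "v p = {#}" if "p \<in> P" for p
      using v(2) that by (metis mset_lt_single_right_iff multiset_nonemptyE not_less_zero)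
    have "decomposed lt l (Leaf ` Q0) P (\<lambda>_. 0)"
      unfolding decomposed_def
    proof (intro conjI ballI impI)
      fix p assume p: "p \<in> P"
      have "{q \<in> P. (0 :: nat) = 0} = {p}" using p e inj_onD[OF v(1)] by auto
      then show "\<exists>t\<in>Leaf ` Q0. rep lt l t {q \<in> P. (0 :: nat) = 0}"
        using rep_Leaf[of lt l p] l p by auto
    qed simp
    then show ?thesis by (intro exI[of _ "\<lambda>_. 0"] exI[of _ 1]) simp
  qed
  then show ?case using assms by (intro exI[of _ "Leaf ` Q0"]) blast
next
  case (Suc n)
  then obtain F where F: "finite F" and IH: "\<And>P (v :: 'i \<Rightarrow> nat multiset). inj_on v P \<Longrightarrow>
     \<forall>p\<in>P. v p < {#n#} \<Longrightarrow> \<forall>p\<in>P. \<forall>q\<in>P. v p < v q \<longrightarrow> lt p q \<Longrightarrow> l ` P \<subseteq> Q0 \<Longrightarrow>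
     \<exists>h k. decomposed lt l F P h \<and> (\<forall>p\<in>P. h p < (k :: nat))" by blast
  let ?F = "F \<union> {Node ts | ts. fset ts \<subseteq> F}"
  have "{Node ts | ts. fset ts \<subseteq> F} \<subseteq> (\<lambda>X. Node (Abs_fset X)) ` Pow F"
  proof
    fix t assume "t \<in> {Node ts | ts. fset ts \<subseteq> F}"
    then obtain ts where "t = Node ts" "fset ts \<in> Pow F" by blast
    then show "t \<in> (\<lambda>X. Node (Abs_fset X)) ` Pow F" by (metis fset_inverse image_eqI)
  qed
  then have fin: "finite ?F" using F finite_subset by blast
  have "\<exists>h k. decomposed lt l ?F P h \<and> (\<forall>p\<in>P. h p < (k :: nat))"
    if v: "inj_on v P" "\<forall>p\<in>P. v p < {#Suc n#}" "\<forall>p\<in>P. \<forall>q\<in>P. v p < v q \<longrightarrow> lt p q"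
      and l: "l ` P \<subseteq> Q0" for P and v :: "'i \<Rightarrow> nat multiset"
  proof -
    \<comment> \<open>The coefficient of the top exponent cuts \<open>P\<close> into pieces of
      length at most \<open>\<omega>\<^sup>n\<close>; \<open>v'\<close> locates positions inside a
      piece.\<close>
    define c where "c p = count (v p) n" for p
    define v' where "v' p = {#x \<in># v p. x < n#}" for p
    let ?B = "\<lambda>i. {p \<in> P. c p = i}"
    have split: "v p = replicate_mset (c p) n + v' p" if p: "p \<in> P" for p
    proof (rule multiset_eqI)
      fix x
      have "x \<notin># v p" if "n < x" using v(2) p that by fastforce
      then show "count (v p) x = count (replicate_mset (c p) n + v' p) x"
        unfolding c_def v'_def by (cases x n rule: linorder_cases) (auto simp: not_in_iff)
    qed
    have less: "v p < v q" if pq: "p \<in> P" "q \<in> P" "c p < c q" for p q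
    proof -
      have "v p \<noteq> v q" using pq(3) unfolding c_def by auto
      moreover have "\<exists>x>y. count (v p) x < count (v q) x" if y: "count (v q) y < count (v p) y" for y
      proof -
        have "y \<in># v p" using y by (metis count_greater_zero_iff gr_zeroI not_less_zero)
        then have "y < Suc n" using v(2) pq(1) by auto
        moreover have "y \<noteq> n" using y pq(3) unfolding c_def by auto
        ultimately have "n > y" by simp
        then show ?thesis using pq(3) unfolding c_def by blast
      qed
      ultimately show ?thesis unfolding less_multiset\<^sub>H\<^sub>O by blast
    qed
    have "\<exists>h k. decomposed lt l F (?B i) h \<and> (\<forall>p\<in>?B i. h p < (k :: nat))" for i
    proof (rule IH[of v'])
      show "inj_on v' (?B i)"
      proof (rule inj_onI)
        fix p q assume "p \<in> ?B i" "q \<in> ?B i" "v' p = v' q"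
        then show "p = q" using split[of p] split[of q] inj_onD[OF v(1), of p q] by simp
      qed
      show "\<forall>p\<in>?B i. v' p < {#n#}" unfolding v'_def by simp
      show "\<forall>p\<in>?B i. \<forall>q\<in>?B i. v' p < v' q \<longrightarrow> lt p q"
      proof (intro ballI impI)
        fix p q assume "p \<in> ?B i" "q \<in> ?B i" "v' p < v' q"
        then have "v p < v q" "p \<in> P" "q \<in> P" using split[of p] split[of q] by simp_all
        then show "lt p q" using v(3) by blast
      qed
      show "l ` ?B i \<subseteq> Q0" using l by blast
    qed
    then have "\<exists>hk. decomposed lt l F (?B i) (fst hk) \<and> (\<forall>p\<in>?B i. fst hk p < (snd hk :: nat))" for i
      by simp
    note ex = this
    define hk where "hk i = (SOME hk. decomposed lt l F (?B i) (fst hk) \<and> (\<forall>p\<in>?B i. fst hk p < (snd hk :: nat)))" for i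
    define hh where "hh i = fst (hk i)" for i
    define kk where "kk i = snd (hk i)" for i
    have hh: "decomposed lt l F (?B i) (hh i)" "\<And>p. p \<in> ?B i \<Longrightarrow> hh i p < kk i" for i
      using someI_ex[OF ex[of i]] unfolding hh_def kk_def hk_def by blast+
    \<comment> \<open>Each piece has boundedly many block numbers, so offsets can number the blocks
      of all pieces in one sequence.\<close>
    define off where "off i = (\<Sum>j<i. kk j)" for i
    define H where "H p = off (c p) + hh (c p) p" for p
    have off: "off i \<le> off j" if "i \<le> j" for i j
      unfolding off_def by (rule sum_mono2) (use that in auto)
    have Hlt: "H p < H q" if "p \<in> P" "q \<in> P" "c p < c q" for p q
    proof -
      have "H p < off (Suc (c p))" unfolding H_def off_def using hh(2)[of p "c p"] that(1) by simp
      also have "\<dots> \<le> off (c q)" using off that(3) by simp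
      also have "\<dots> \<le> H q" unfolding H_def by simp
      finally show ?thesis .
    qed
    have dec: "decomposed lt l F P H"
      unfolding decomposed_def
    proof (intro conjI ballI impI)
      fix p assume p: "p \<in> P"
      have "{q \<in> P. H q = H p} = {q \<in> ?B (c p). hh (c p) q = hh (c p) p}"
      proof (intro equalityI subsetI)
        fix q assume q: "q \<in> {q \<in> P. H q = H p}"
        then have "c q = c p" using Hlt[of p q] Hlt[of q p] p by (metis (mono_tags, lifting) less_irrefl linorder_neqE_nat mem_Collect_eq)
        then show "q \<in> {q \<in> ?B (c p). hh (c p) q = hh (c p) p}" using q unfolding H_def by simp
      qed (auto simp: H_def)
      moreover have "\<exists>t\<in>F. rep lt l t {q \<in> ?B (c p). hh (c p) q = hh (c p) p}"
        using hh(1)[of "c p"] p unfolding decomposed_def by blast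
      ultimately show "\<exists>t\<in>F. rep lt l t {q \<in> P. H q = H p}" by (simp only:)
      fix q assume q: "q \<in> P" "H p < H q"
      consider "c p < c q" | "c p = c q" | "c q < c p" by linarith
      then show "lt p q"
      proof cases
        case 1
        then show ?thesis using v(3) less p q by blast
      next
        case 2
        then have "hh (c p) p < hh (c p) q" using q(2) unfolding H_def by simp
        then show ?thesis using hh(1)[of "c p"] p q(1) 2 unfolding decomposed_def by simp
      next
        case 3
        then show ?thesis using Hlt[OF q(1) p] q(2) by simp
      qed
    qed
    obtain h k where "decomposed lt l ?F P h" "\<And>p. p \<in> P \<Longrightarrow> h p < (k :: nat)"
      by (rule decomposed_bounded[OF F dec], rule that)
    then show ?thesis by blast
  qed
  then show ?case using fin by (intro exI[of _ ?F]) blast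
qed

text \<open>With a bounded numbering there is a last block. It is a tail that spells a tree, and by
  indecomposability the whole sequence embeds into it.\<close>

lemma tree_of_seq:
  assumes s: "s \<in> iF_omega_omega Q le" and refl: "\<And>x. x \<in> Q \<Longrightarrow> le x x"
  shows "\<exists>t\<in>ftrees Q. \<exists>P\<subseteq>Field (fst s). rep (slt (fst s)) (snd s) t P \<and>
    emb le (slt (fst s)) (snd s) (Field (fst s)) (slt (fst s)) (snd s) P"
proof -
  obtain r l where rl: "s = (r, l)" by (cases s)
  have wo: "Well_order r" and ne: "Field r \<noteq> {}" and len: "r <o omega_pow natLeq"
    and lQ: "l ` Field r \<subseteq> Q" and fin: "finite (l ` Field r)" and ind: "indecomposable le (r, l)"
    using s unfolding iF_omega_omega_def rl by auto
  have tot: "(p, q) \<in> r \<or> (q, p) \<in> r" if "p \<in> Field r" "q \<in> Field r" for p q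
    using wo that unfolding well_order_on_def linear_order_on_def partial_order_on_def preorder_on_def
      refl_on_def total_on_def by metis
  have "r <o mle" using len mle_omega_pow ordIso_symmetric ordLess_ordIso_trans by blast
  then obtain K where K: "r =o Restr mle (underS mle K)"
    using ordLess_iff_ordIso_Restr[OF Well_order_mle wo] by blast
  have us: "underS mle K = {M. M < K}" unfolding underS_def mle_def by auto
  have FK: "Field (Restr mle (underS mle K)) = {M. M < K}"
    using Field_Restr_Well_order[OF Well_order_mle, of "underS mle K"] us by simp
  obtain v where "iso r (Restr mle (underS mle K)) v" using K unfolding ordIso_def by blast
  then have vb: "bij_betw v (Field r) {M. M < K}" and
    vo: "\<And>p q. p \<in> Field r \<Longrightarrow> q \<in> Field r \<Longrightarrow> (p, q) \<in> r \<longleftrightarrow> (v p, v q) \<in> Restr mle (underS mle K)"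
    unfolding iso_iff2 FK by blast+
  have vK: "v p < K" if "p \<in> Field r" for p using vb that unfolding bij_betw_def by blast
  have vinj: "inj_on v (Field r)" using vb bij_betw_def by blast
  have vle: "(p, q) \<in> r \<longleftrightarrow> v p \<le> v q" if "p \<in> Field r" "q \<in> Field r" for p q
    using vo[OF that] vK that unfolding us by (auto simp: mle_def)
  \<comment> \<open>An exponent above all those of \<open>K\<close>, so that the length is at most
    \<open>\<omega>\<^sup>n\<close>; inserting 0 covers an empty \<open>K\<close>.\<close>
  define n where "n = Suc (Max (insert 0 (set_mset K)))"
  have "K < {#n#}" unfolding n_def by (simp add: less_Suc_eq_le)
  then have vn: "\<forall>p\<in>Field r. v p < {#n#}" using vK less_trans by blast
  have vlt: "\<forall>p\<in>Field r. \<forall>q\<in>Field r. v p < v q \<longrightarrow> slt r p q"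
    using vle by (metis less_imp_le less_irrefl)
  obtain F h k where dec: "decomposed (slt r) l F (Field r) h" and hk: "\<And>p. p \<in> Field r \<Longrightarrow> h p < (k :: nat)"
  proof -
    obtain F where "\<forall>P (v :: nat \<Rightarrow> nat multiset). inj_on v P \<longrightarrow> (\<forall>p\<in>P. v p < {#n#}) \<longrightarrow>
     (\<forall>p\<in>P. \<forall>q\<in>P. v p < v q \<longrightarrow> slt r p q) \<longrightarrow> l ` P \<subseteq> l ` Field r \<longrightarrow>
     (\<exists>h k. decomposed (slt r) l F P h \<and> (\<forall>p\<in>P. h p < (k :: nat)))"
      using rep_decomposition[OF fin, of n "slt r" l] by (elim exE conjE) (rule that)
    from this[THEN spec, of "Field r", THEN spec, of v] vinj vn vlt
    obtain h k where "decomposed (slt r) l F (Field r) h \<and> (\<forall>p\<in>Field r. h p < (k :: nat))" by auto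
    then show ?thesis using that by blast
  qed
  have "h ` Field r \<subseteq> {..<k}" using hk by auto
  then have finh: "finite (h ` Field r)" by (rule finite_subset) simp
  have "h ` Field r \<noteq> {}" using ne by blast
  from Max_in[OF finh this] obtain p0 where p0: "p0 \<in> Field r" "h p0 = Max (h ` Field r)" by auto
  have hmax: "h p \<le> h p0" if "p \<in> Field r" for p using Max_ge[OF finh] that p0(2) by simp
  define P where "P = {q \<in> Field r. h q = h p0}"
  obtain t where t: "rep (slt r) l t P" using dec p0(1) unfolding decomposed_def P_def by blast
  have PF: "P \<subseteq> Field r" unfolding P_def by blast
  have tQ: "t \<in> ftrees Q" by (rule rep_ftrees[OF t]) (use PF lQ in blast)
  define M where "M = (LEAST M. M \<in> v ` P)"
  have "\<exists>M. M \<in> v ` P" using p0(1) unfolding P_def by blast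
  then have "M \<in> v ` P" unfolding M_def by (rule LeastI_ex)
  then obtain x where x: "x \<in> P" "v x = M" by blast
  have xF: "x \<in> Field r" using x PF by blast
  have least: "(x, y) \<in> r" if y: "y \<in> P" for y
  proof -
    have "v x \<le> v y" unfolding x(2) M_def by (rule Least_le) (use y in blast)
    then show ?thesis using vle[OF xF] y PF by blast
  qed
  \<comment> \<open>No block comes after that of \<open>p0\<close>, so the tail from its least
    position is the block itself.\<close>
  have above: "above r x = P"
  proof (intro equalityI subsetI)
    fix y assume "y \<in> above r x"
    then have y: "(x, y) \<in> r" "y \<in> Field r" unfolding above_def Field_def by auto
    have "\<not> h y < h x"
    proof
      assume "h y < h x"
      then have "slt r y x" using dec y(2) xF unfolding decomposed_def by blast
      then show False using slt_asym[OF wo, of y x] y(1) by auto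
    qed
    then have "h y = h p0" using hmax[OF y(2)] x(1) unfolding P_def by simp
    then show "y \<in> P" using y(2) unfolding P_def by blast
  qed (use least in \<open>auto simp: above_def\<close>)
  have "emb le (slt r) l (Field r) (slt r) l P"
  proof (cases "\<exists>y\<in>Field r. slt r y x")
    case True
    then have "(Restr r P, l) \<in> proper_tails (r, l)"
      unfolding proper_tails_def using xF above by auto
    then have "seq_emb le (r, l) (Restr r P, l)" using ind unfolding indecomposable_def by blast
    then have "emb le (slt r) l (Field r) (slt (Restr r P)) l P"
      unfolding seq_emb_emb fst_conv snd_conv Field_Restr_Well_order[OF wo PF] .
    then show ?thesis unfolding emb_def by blast
  next
    case False
    \<comment> \<open>Here \<open>x\<close> is the first position, so there is no proper tail to
      appeal to, but the block is the whole sequence.\<close>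
    have "y \<in> P" if y: "y \<in> Field r" for y
      using tot[OF xF y] False y x(1) above unfolding above_def by auto
    then have "Field r \<subseteq> P" by blast
    then show ?thesis by (rule emb_subset) (use lQ refl in blast)
  qed
  then show ?thesis using tQ t PF unfolding rl by auto
qed

text \<open>\<open>\<phi>\<close> preserves and reflects the order, and by
  \<open>tree_of_seq\<close> it meets every class of sequences, so the maximal order type carries
  over from trees.\<close>

theorem max_order_type_iF:
  assumes Q: "wqo_on Q le" and m: "is_max_order_type (ftrees Q) (tree_le le) r"
  shows "is_max_order_type (iF_omega_omega Q le) (seq_emb le) r"
proof -
  have refl: "le x x" if "x \<in> Q" for x using Q that unfolding wqo_on_def by blast
  have tr: "le x z" if "x \<in> Q" "y \<in> Q" "z \<in> Q" "le x y" "le y z" for x y z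
    using Q that unfolding wqo_on_def by blast
  let ?lt = "\<lambda>s :: 'a tseq. slt (fst s)" and ?F = "\<lambda>s :: 'a tseq. Field (fst s)"
  define \<phi> where "\<phi> t = (SOME s. s \<in> iF_omega_omega Q le \<and> rep (?lt s) (snd s) t (?F s))" for t
  have \<phi>: "\<phi> t \<in> iF_omega_omega Q le" "rep (?lt (\<phi> t)) (snd (\<phi> t)) t (?F (\<phi> t))" if "t \<in> ftrees Q" for t
  proof -
    have "\<exists>s. s \<in> iF_omega_omega Q le \<and> rep (?lt s) (snd s) t (?F s)"
      using seq_of_tree[of t Q le, OF that refl] by blast
    from someI_ex[OF this] show "\<phi> t \<in> iF_omega_omega Q le" "rep (?lt (\<phi> t)) (snd (\<phi> t)) t (?F (\<phi> t))"
      unfolding \<phi>_def by blast+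
  qed
  have iF: "Well_order (fst s)" "snd s ` ?F s \<subseteq> Q" if "s \<in> iF_omega_omega Q le" for s
    using that unfolding iF_omega_omega_def by blast+
  show ?thesis
  proof (rule is_max_order_type_transfer[OF m, where f = \<phi>])
    show "\<phi> t \<in> iF_omega_omega Q le" if "t \<in> ftrees Q" for t by (rule \<phi>(1)[OF that])
    fix t u assume t: "t \<in> ftrees Q" and u: "u \<in> ftrees Q"
    note wt = slt_asym[OF iF(1)[OF \<phi>(1)[OF t]]] and wu = slt_asym[OF iF(1)[OF \<phi>(1)[OF u]]]
    show "tree_le le t u \<longleftrightarrow> seq_emb le (\<phi> t) (\<phi> u)"
      unfolding seq_emb_emb
    proof
      assume "tree_le le t u"
      from tree_le_imp_emb[OF wt \<phi>(2)[OF t] \<phi>(2)[OF u] this] show "emb le (?lt (\<phi> t)) (snd (\<phi> t)) (?F (\<phi> t)) (?lt (\<phi> u)) (snd (\<phi> u)) (?F (\<phi> u))"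
        by blast
    next
      assume "emb le (?lt (\<phi> t)) (snd (\<phi> t)) (?F (\<phi> t)) (?lt (\<phi> u)) (snd (\<phi> u)) (?F (\<phi> u))"
      show "tree_le le t u"
        by (rule emb_imp_tree_le[OF _ _ _ _ \<phi>(2)[OF t] iF(2)[OF \<phi>(1)[OF t]] \<phi>(2)[OF u]
              iF(2)[OF \<phi>(1)[OF u]] \<open>emb _ _ _ _ _ _ _\<close>])
          (fact wt wu refl tr)+
    qed
  next
    fix s assume s: "s \<in> iF_omega_omega Q le"
    obtain t P where t: "t \<in> ftrees Q" and P: "P \<subseteq> ?F s" "rep (?lt s) (snd s) t P"
      "emb le (?lt s) (snd s) (?F s) (?lt s) (snd s) P"
      using tree_of_seq[OF s refl] by blast
    have tt: "tree_le le t t" by (rule tree_le_refl[OF refl t])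
    have lP: "snd s ` P \<subseteq> Q" using iF(2)[OF s] P(1) by blast
    have "emb le (?lt (\<phi> t)) (snd (\<phi> t)) (?F (\<phi> t)) (?lt s) (snd s) P"
      by (rule tree_le_imp_emb[OF slt_asym[OF iF(1)[OF \<phi>(1)[OF t]]] \<phi>(2)[OF t] P(2) tt])
    then have 1: "seq_emb le (\<phi> t) s" unfolding seq_emb_emb using emb_mono P(1) by blast
    have e: "emb le (?lt s) (snd s) P (?lt (\<phi> t)) (snd (\<phi> t)) (?F (\<phi> t))"
      by (rule tree_le_imp_emb[OF slt_asym[OF iF(1)[OF s]] P(2) \<phi>(2)[OF t] tt])
    have "seq_emb le s (\<phi> t)" unfolding seq_emb_emb
      by (rule emb_trans[OF P(3) e tr iF(2)[OF s] lP iF(2)[OF \<phi>(1)[OF t]]])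
    then show "\<exists>t\<in>ftrees Q. seq_emb le (\<phi> t) s \<and> seq_emb le s (\<phi> t)" using 1 t by blast
  next
    fix s u w assume suw: "s \<in> iF_omega_omega Q le" "u \<in> iF_omega_omega Q le" "w \<in> iF_omega_omega Q le"
      "seq_emb le s u" "seq_emb le u w"
    show "seq_emb le s w"
      unfolding seq_emb_emb
      by (rule emb_trans[OF suw(4,5)[unfolded seq_emb_emb] tr iF(2)[OF suw(1)] iF(2)[OF suw(2)] iF(2)[OF suw(3)]])
  qed
qed

theorem theorem4p27:
  fixes Q :: "'a set" and le :: "'a \<Rightarrow> 'a \<Rightarrow> bool"
    and \<alpha> :: "'b rel" and \<beta> :: "'c rel"
  assumes "wqo_on Q le" and "Q \<noteq> {}"
    and "is_max_order_type Q le \<alpha>"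
    and "is_g \<alpha> \<beta>"
  shows "is_max_order_type (iF_omega_omega Q le) (seq_emb le) \<beta> \<and>
         is_max_order_type (ftrees Q) (tree_le le) \<beta>"
  using max_order_type_ftrees[OF assms] max_order_type_iF[OF assms(1)] by blast

end
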